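(* Let $X$ denote $\mathbb{R}$ or $\mathbb{T}$ and let $d\ge 1$. Let $I\subset\mathbb{R}$ be a time interval, and let $U$ be a continuous function on $I$ valued into the Sobolev space $H^2(X,\mathbb{C}^{d\times d})$ such that $\partial_t U$ is continuous on $I$ valued into $L^2(X,\mathbb{C}^{d\times d})$. Then $U$ is a solution on $I$ of the spin Benjamin--Ono equation $$\partial_t U=\partial_x\big(|D|U-U^2\big)-i[U,|D|U]$$ if and only if $$\partial_t L_U=[B_U,L_U]\quad\text{on } I .$$
   Context: $X=\mathbb{R}$ or $X=\mathbb{T}$ (the one-dimensional torus). $D=\frac1i\partial_x$, and $|D|$ is the Fourier multiplier with symbol $|k|$. For matrices or operators $A,B$, $[A,B]=AB-BA$. Functions are valued in the complex $d\times d$ matrices $\mathbb{C}^{d\times d}$ (not necessarily Hermitian), and products are pointwise matrix products. $\mathscr{H}=L^2_+(X,\mathbb{C}^{d\times d})$ is the Hilbert space of $L^2$ functions on $X$ valued in $\mathbb{C}^{d\times d}$ whose Fourier transform is supported in nonnegative modes (including the zero mode), with inner product $\langle A\,|\,B\rangle=\int_X \mathrm{tr}(AB^* )\,dx$. $\Pi_{\ge 0}$ is the orthogonal projector from $L^2(X,\mathbb{C}^{d\times d})$ onto $\mathscr{H}$. For a matrix-valued symbol $U$, the Toeplitz operator $T_U$ is defined by $T_U(F)=\Pi_{\ge0}(UF)$. The Lax operator is the unbounded operator on $\mathscr{H}$ given by $L_U=D-T_U$ with domain $\mathrm{dom}(L_U)=\{F\in\mathscr{H}: DF\in\mathscr{H}\}$.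 For $U\in H^2(X,\mathbb{C}^{d\times d})$, $B_U$ is the bounded operator on $\mathscr{H}$ given by $B_U=i\,(T_{|D|U}-T_U^2)$. The domain of $L_{U(t)}$ does not depend on $t$; $\partial_t L_U$ is the time derivative of $L_{U(t)}$ as operators on this common domain (so $\partial_tL_U=-T_{\partial_tU}$), and the identity $\partial_t L_U=[B_U,L_U]$ is an identity of operators on this domain. *)

theory Defs
  imports "HOL-Analysis.Analysis"
begin

text \<open>
  Functions on $X$ are represented by functions on the reals, and elements of $L^2$ by
  arbitrary square integrable representatives, so that equality in $L^2$ is equality almost
  everywhere. The torus is $\mathbb{R}/2\pi\mathbb{Z}$, represented by its fundamental domain
  $[0,2\pi)$; values outside this domain are irrelevant.
\<close>

datatype base = Line | Torus

fun base_measure :: "base \<Rightarrow> real measure" where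
  "base_measure Line = lborel"
| "base_measure Torus = restrict_space lborel {0..<2 * pi}"

fun freq_measure :: "base \<Rightarrow> real measure" where
  "freq_measure Line = lborel"
| "freq_measure Torus = count_space \<int>"

type_synonym 'd cmat = "complex ^ 'd ^ 'd"

type_synonym 'd field = "real \<Rightarrow> 'd cmat"

definition cscale :: "complex \<Rightarrow> 'd::finite cmat \<Rightarrow> 'd cmat" (infixr "*\<^sub>c" 75) where
  "c *\<^sub>c A = map_matrix (\<lambda>z. c * z) A"

definition adjoint_mat :: "'d::finite cmat \<Rightarrow> 'd cmat" where
  "adjoint_mat A = map_matrix cnj (transpose A)"


subsection \<open>Square integrable functions\<close>

text \<open>The norm of \<^typ>\<open>'d cmat\<close> is the Frobenius norm, whose square at $A$ is
  $\mathrm{tr}(AA^*)$.\<close>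

definition L2 :: "real measure \<Rightarrow> 'd::finite field set" where
  "L2 M = {f \<in> borel_measurable M. integrable M (\<lambda>x. (norm (f x))\<^sup>2)}"

definition L2_inner :: "base \<Rightarrow> 'd::finite field \<Rightarrow> 'd field \<Rightarrow> complex" where
  "L2_inner X A B = (\<integral>x. trace (A x ** adjoint_mat (B x)) \<partial>base_measure X)"

definition L2_tendsto ::
  "real measure \<Rightarrow> ('i \<Rightarrow> 'd::finite field) \<Rightarrow> 'd field \<Rightarrow> 'i filter \<Rightarrow> bool" where
  "L2_tendsto M f g \<F> \<longleftrightarrow>
     ((\<lambda>i. \<integral>\<^sup>+ x. ennreal ((norm (f i x - g x))\<^sup>2) \<partial>M) \<longlongrightarrow> 0) \<F>"


subsection \<open>Fourier transform and Fourier multipliers\<close>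

text \<open>
  On the line, \<open>g\<close> is the $L^2$ limit of the transforms of the truncations of \<open>f\<close> to
  $[-n,n]$. On the torus the truncation has no effect for $n \ge 7$, so \<open>g\<close> is the family of
  (unnormalised) Fourier coefficients of \<open>f\<close>, indexed by the integers.
\<close>

definition has_fourier :: "base \<Rightarrow> 'd::finite field \<Rightarrow> 'd field \<Rightarrow> bool" where
  "has_fourier X f g \<longleftrightarrow>
     f \<in> L2 (base_measure X) \<and> g \<in> L2 (freq_measure X) \<and>
     L2_tendsto (freq_measure X)
       (\<lambda>n k. LINT x : {- real n .. real n} | base_measure X. cis (- (k * x)) *\<^sub>c f x)
       g sequentially"

definition fourier :: "base \<Rightarrow> 'd::finite field \<Rightarrow> 'd field" where
  "fourier X f = (SOME g. has_fourier X f g)"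

definition abs_D :: "base \<Rightarrow> 'd::finite field \<Rightarrow> 'd field" where
  "abs_D X U = (SOME V. V \<in> L2 (base_measure X) \<and>
     (AE k in freq_measure X. fourier X V k = \<bar>k\<bar> *\<^sub>R fourier X U k))"

definition sobolev_weight :: "base \<Rightarrow> real \<Rightarrow> 'd::finite field \<Rightarrow> 'd field" where
  "sobolev_weight X s f = (\<lambda>k. (1 + k\<^sup>2) powr (s / 2) *\<^sub>R fourier X f k)"

definition sobolev :: "base \<Rightarrow> real \<Rightarrow> 'd::finite field set" where
  "sobolev X s = {f \<in> L2 (base_measure X). sobolev_weight X s f \<in> L2 (freq_measure X)}"


subsection \<open>Distributional derivative in the space variable\<close>

definition deriv1 :: "(real \<Rightarrow> complex) \<Rightarrow> real \<Rightarrow> complex" where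
  "deriv1 \<phi> = (\<lambda>x. vector_derivative \<phi> (at x))"

definition smooth :: "(real \<Rightarrow> complex) \<Rightarrow> bool" where
  "smooth \<phi> \<longleftrightarrow> (\<forall>n x. (deriv1 ^^ n) \<phi> differentiable (at x))"

text \<open>Schwartz functions on the line, smooth periodic functions on the torus.\<close>

fun test_functions :: "base \<Rightarrow> (real \<Rightarrow> complex) set" where
  "test_functions Line =
     {\<phi>. smooth \<phi> \<and> (\<forall>m n. bounded (range (\<lambda>x. x ^ m *\<^sub>R (deriv1 ^^ n) \<phi> x)))}"
| "test_functions Torus = {\<phi>. smooth \<phi> \<and> (\<forall>x. \<phi> (x + 2 * pi) = \<phi> x)}"

definition has_dx :: "base \<Rightarrow> 'd::finite field \<Rightarrow> 'd field \<Rightarrow> bool" where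
  "has_dx X f g \<longleftrightarrow>
     f \<in> L2 (base_measure X) \<and> g \<in> L2 (base_measure X) \<and>
     (\<forall>\<phi> \<in> test_functions X.
        (\<integral>x. deriv1 \<phi> x *\<^sub>c f x \<partial>base_measure X) = - (\<integral>x. \<phi> x *\<^sub>c g x \<partial>base_measure X))"

text \<open>$D = \frac{1}{i}\partial_x$.\<close>

definition D_op :: "base \<Rightarrow> 'd::finite field \<Rightarrow> 'd field" where
  "D_op X f = (SOME g. has_dx X f (\<lambda>x. \<i> *\<^sub>c g x))"


subsection \<open>The Hardy space, Toeplitz operators and the Lax pair\<close>

definition hardy :: "base \<Rightarrow> 'd::finite field set" where
  "hardy X = {F \<in> L2 (base_measure X). AE k in freq_measure X. k < 0 \<longrightarrow> fourier X F k = 0}"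

definition hardy_proj :: "base \<Rightarrow> 'd::finite field \<Rightarrow> 'd field" where
  "hardy_proj X G =
     (SOME P. P \<in> hardy X \<and> (\<forall>K \<in> hardy X. L2_inner X (\<lambda>x. G x - P x) K = 0))"

definition toeplitz :: "base \<Rightarrow> 'd::finite field \<Rightarrow> 'd field \<Rightarrow> 'd field" where
  "toeplitz X U F = hardy_proj X (\<lambda>x. U x ** F x)"

definition lax_dom :: "base \<Rightarrow> 'd::finite field set" where
  "lax_dom X = {F \<in> hardy X. \<exists>G \<in> hardy X. has_dx X F (\<lambda>x. \<i> *\<^sub>c G x)}"

definition lax_L :: "base \<Rightarrow> 'd::finite field \<Rightarrow> 'd field \<Rightarrow> 'd field" where
  "lax_L X U F = (\<lambda>x. D_op X F x - toeplitz X U F x)"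

definition lax_B :: "base \<Rightarrow> 'd::finite field \<Rightarrow> 'd field \<Rightarrow> 'd field" where
  "lax_B X U F =
     (\<lambda>x. \<i> *\<^sub>c (toeplitz X (abs_D X U) F x - toeplitz X U (toeplitz X U F) x))"

definition op_commutator ::
  "('d::finite field \<Rightarrow> 'd field) \<Rightarrow> ('d field \<Rightarrow> 'd field) \<Rightarrow> 'd field \<Rightarrow> 'd field" where
  "op_commutator A B F = (\<lambda>x. A (B F) x - B (A F) x)"


subsection \<open>Time-dependent functions\<close>

definition L2_has_time_derivative ::
  "base \<Rightarrow> real set \<Rightarrow> (real \<Rightarrow> 'd::finite field) \<Rightarrow> 'd field \<Rightarrow> real \<Rightarrow> bool" where
  "L2_has_time_derivative X I u v t \<longleftrightarrow>
     v \<in> L2 (base_measure X) \<and>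
     L2_tendsto (base_measure X) (\<lambda>s x. (1 / (s - t)) *\<^sub>R (u s x - u t x)) v (at t within I)"

definition L2_continuous_on :: "base \<Rightarrow> real set \<Rightarrow> (real \<Rightarrow> 'd::finite field) \<Rightarrow> bool" where
  "L2_continuous_on X I u \<longleftrightarrow>
     (\<forall>t\<in>I. u t \<in> L2 (base_measure X) \<and> L2_tendsto (base_measure X) u (u t) (at t within I))"

definition sobolev_continuous_on ::
  "base \<Rightarrow> real \<Rightarrow> real set \<Rightarrow> (real \<Rightarrow> 'd::finite field) \<Rightarrow> bool" where
  "sobolev_continuous_on X s I u \<longleftrightarrow>
     (\<forall>t\<in>I. u t \<in> sobolev X s \<and>
        L2_tendsto (freq_measure X) (\<lambda>r. sobolev_weight X s (u r)) (sobolev_weight X s (u t))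
          (at t within I))"

definition L2_C1_on :: "base \<Rightarrow> real set \<Rightarrow> (real \<Rightarrow> 'd::finite field) \<Rightarrow> bool" where
  "L2_C1_on X I u \<longleftrightarrow>
     (\<exists>u'. L2_continuous_on X I u' \<and> (\<forall>t\<in>I. L2_has_time_derivative X I u (u' t) t))"

definition spin_BO_solution :: "base \<Rightarrow> real set \<Rightarrow> (real \<Rightarrow> 'd::finite field) \<Rightarrow> bool" where
  "spin_BO_solution X I U \<longleftrightarrow>
     (\<forall>t\<in>I. let u = U t; v = abs_D X (U t) in
        \<exists>w. has_dx X (\<lambda>x. v x - u x ** u x) w \<and>
          L2_has_time_derivative X I U (\<lambda>x. w x - \<i> *\<^sub>c (u x ** v x - v x ** u x)) t)"

text \<open>
  $\partial_t L_U = [B_U, L_U]$ as operators on the common domain of the $L_{U(t)}$: the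
  commutator is defined on this whole domain, and \<open>s \<mapsto> L\<^bsub>U(s)\<^esub> F\<close> is differentiable in
  $L^2$ for every \<open>F\<close> in it.
\<close>

definition lax_equation :: "base \<Rightarrow> real set \<Rightarrow> (real \<Rightarrow> 'd::finite field) \<Rightarrow> bool" where
  "lax_equation X I U \<longleftrightarrow>
     (\<forall>t\<in>I. \<forall>F \<in> lax_dom X.
        lax_B X (U t) F \<in> lax_dom X \<and>
        L2_has_time_derivative X I (\<lambda>s. lax_L X (U s) F)
          (op_commutator (lax_B X (U t)) (lax_L X (U t)) F) t)"

end

theory Submission
  imports Defs "HOL-Probability.Characteristic_Functions" "HOL-Probability.Sinc_Integral"
begin

text \<open>
  For smooth enough $U$ the commutator can be computed exactly. Put $v = |D|U$. Since $D$ acts on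
  products by the Leibniz rule and commutes with the projector $\Pi$ onto the Hardy space,
  $[D, T_U] = T_{DU}$, and therefore
  $$[B_U, L_U] = i\bigl(- T_{Dv} + T_{DU - v}\, T_U + T_U\, T_{DU + v}\bigr).$$
  The Fourier transform of $DU - v$ is $(k - |k|) \hat U$, which lives on negative frequencies, and
  that of $DU + v$ is $(k + |k|) \hat U$, which lives on nonnegative ones. A symbol with nonnegative
  spectrum preserves the Hardy space, and a symbol with negative spectrum preserves the functions
  with negative spectrum. Hence $T_U T_{DU + v} = T_{U (DU + v)}$ and
  $T_{DU - v} T_U = T_{(DU - v) U}$, so that the commutator is a single Toeplitz operator,
  $$[B_U, L_U] = - T_R, \qquad R = \partial_x (|D|U - U^2) - i [U, |D|U].$$
  On the other side $\partial_t L_U = - T_{\partial_t U}$, because the functions $F$ in the domain are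
  bounded and $\Pi$ is a contraction. The Lax equation thus says $T_{\partial_t U - R} F = 0$ for
  all $F$ in the domain, and a symbol $W$ with this property vanishes: replacing $F$ by
  $e^{inx} F$ shows that no frequency $\ge -n$ occurs in $W F$, for every $n$, so $W F = 0$, and $F$ can
  be a scalar function whose zeros form a null set. These three facts are \<open>lax_commutator\<close>, \<open>lax_L_has_time_derivative\<close> and
  \<open>toeplitz_zero_imp_zero\<close>.

  All operators involved are Fourier multipliers and multiplications, so everything rests on
  a Plancherel theory that is uniform in $X$: the transform is a bijective isometry, up to the
  factor $2 \pi$, from functions on $X$ onto functions of the frequency
  (\<open>has_ft_norm\<close>, \<open>has_ft_surj\<close>). On the torus this comes from the Weierstrass approximation
  theorem on the circle. On the line Plancherel's formula for a function supported in one period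
  follows from Parseval's formula on the torus, applied to $e^{-i \theta x} f$ and averaged over
  $\theta \in [0, 1)$; scaling removes the restriction on the support, and the multiplication formula
  $\int \hat f g = \int f \hat g$ gives surjectivity. The combination of the pairing formula with
  modulation shows that products transform into convolutions (\<open>fourier_product\<close>); both the
  Leibniz rule and the statements about spectra of products are read off from the convolution.
  Finally, weak differentiation is multiplication by $ik$ (\<open>has_dx_iff_fmult\<close>), which
  is tested against exponentials on the torus and against translated Gaussians on the line.
\<close>

section \<open>Square integrable scalar functions\<close>

definition sqint :: "'a measure \<Rightarrow> ('a \<Rightarrow> complex) set" where
  "sqint M = {f \<in> borel_measurable M. integrable M (\<lambda>x. (cmod (f x))\<^sup>2)}"

definition sq_tendsto :: "'a measure \<Rightarrow> (nat \<Rightarrow> 'a \<Rightarrow> complex) \<Rightarrow> ('a \<Rightarrow> complex) \<Rightarrow> bool" where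
  "sq_tendsto M f g \<longleftrightarrow> (\<lambda>n. \<integral>x. (cmod (f n x - g x))\<^sup>2 \<partial>M) \<longlonglongrightarrow> 0"

lemma sqint_measurable [measurable_dest]: "f \<in> sqint M \<Longrightarrow> f \<in> borel_measurable M"
  and sqint_integrable: "f \<in> sqint M \<Longrightarrow> integrable M (\<lambda>x. (cmod (f x))\<^sup>2)"
  by (auto simp: sqint_def)

lemma sqint_nn_integral:
  "f \<in> sqint M \<Longrightarrow> (\<integral>\<^sup>+x. ennreal ((cmod (f x))\<^sup>2) \<partial>M) = ennreal (\<integral>x. (cmod (f x))\<^sup>2 \<partial>M)"
  by (intro nn_integral_eq_integral sqint_integrable) auto

lemma sqintI_nn:
  assumes "f \<in> borel_measurable M" "(\<integral>\<^sup>+x. ennreal ((cmod (f x))\<^sup>2) \<partial>M) < \<infinity>"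
  shows "f \<in> sqint M"
  using assms by (auto simp: sqint_def integrable_iff_bounded)

lemma sqint_bound:
  assumes "g \<in> borel_measurable M" "integrable M h" "AE x in M. (cmod (g x))\<^sup>2 \<le> h x"
  shows "g \<in> sqint M"
proof -
  have "integrable M (\<lambda>x. (cmod (g x))\<^sup>2)"
    by (rule Bochner_Integration.integrable_bound[OF assms(2)]) (use assms in auto)
  then show ?thesis using assms by (auto simp: sqint_def)
qed

lemma cmod_add_sq: "(cmod (a + b))\<^sup>2 \<le> 2 * (cmod a)\<^sup>2 + 2 * (cmod b)\<^sup>2"
proof -
  have "(cmod (a + b))\<^sup>2 \<le> (cmod a + cmod b)\<^sup>2"
    by (intro power_mono norm_triangle_ineq) auto
  also have "\<dots> \<le> 2 * (cmod a)\<^sup>2 + 2 * (cmod b)\<^sup>2"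
    using zero_le_power2[of "cmod a - cmod b"] by (simp add: power2_eq_square algebra_simps)
  finally show ?thesis .
qed

lemma sqint_add: "f \<in> sqint M \<Longrightarrow> g \<in> sqint M \<Longrightarrow> (\<lambda>x. f x + g x) \<in> sqint M"
  by (rule sqint_bound[where h="\<lambda>x. 2 * (cmod (f x))\<^sup>2 + 2 * (cmod (g x))\<^sup>2"])
     (auto intro!: cmod_add_sq sqint_integrable)

lemma sqint_cmult: "f \<in> sqint M \<Longrightarrow> (\<lambda>x. c * f x) \<in> sqint M"
  by (rule sqint_bound[where h="\<lambda>x. (cmod c)\<^sup>2 * (cmod (f x))\<^sup>2"])
     (auto intro!: sqint_integrable simp: norm_mult power_mult_distrib)

lemma sqint_uminus: "f \<in> sqint M \<Longrightarrow> (\<lambda>x. - f x) \<in> sqint M"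
  using sqint_cmult[of f M "-1"] by simp

lemma sqint_diff: "f \<in> sqint M \<Longrightarrow> g \<in> sqint M \<Longrightarrow> (\<lambda>x. f x - g x) \<in> sqint M"
  using sqint_add[OF _ sqint_uminus, of f M g] by simp

lemma sqint_zero [simp]: "(\<lambda>x. 0) \<in> sqint M"
  by (auto simp: sqint_def)

lemma sqint_sum: "(\<And>i. i \<in> A \<Longrightarrow> f i \<in> sqint M) \<Longrightarrow> (\<lambda>x. \<Sum>i\<in>A. f i x) \<in> sqint M"
  by (induction A rule: infinite_finite_induct) (auto intro: sqint_add)

lemma sqint_cnj: "f \<in> sqint M \<Longrightarrow> (\<lambda>x. cnj (f x)) \<in> sqint M"
  by (rule sqint_bound[where h="\<lambda>x. (cmod (f x))\<^sup>2"])
     (auto intro!: sqint_integrable borel_measurable_continuous_onI continuous_intros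
        measurable_compose[OF sqint_measurable, where g=cnj])

lemma sqint_bounded_mult:
  assumes "f \<in> sqint M" "g \<in> borel_measurable M" "AE x in M. cmod (g x) \<le> C"
  shows "(\<lambda>x. g x * f x) \<in> sqint M"
proof (rule sqint_bound[where h="\<lambda>x. C\<^sup>2 * (cmod (f x))\<^sup>2"])
  show "AE x in M. (cmod (g x * f x))\<^sup>2 \<le> C\<^sup>2 * (cmod (f x))\<^sup>2"
    using assms(3) by eventually_elim (auto simp: norm_mult power_mult_distrib intro!: mult_right_mono power_mono)
qed (use assms in \<open>auto intro: sqint_integrable\<close>)

lemma sqint_cong_AE:
  assumes "f \<in> sqint M" "g \<in> borel_measurable M" "AE x in M. f x = g x"
  shows "g \<in> sqint M"
  by (rule sqint_bound[where h="\<lambda>x. (cmod (f x))\<^sup>2"])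
     (use assms in \<open>auto intro: sqint_integrable\<close>)

lemma sqint_mult_integrable:
  assumes "f \<in> sqint M" "g \<in> sqint M"
  shows "integrable M (\<lambda>x. f x * g x)"
proof (rule Bochner_Integration.integrable_bound[where f="\<lambda>x. (cmod (f x))\<^sup>2 + (cmod (g x))\<^sup>2"])
  show "AE x in M. norm (f x * g x) \<le> norm ((cmod (f x))\<^sup>2 + (cmod (g x))\<^sup>2)"
  proof (rule AE_I2)
    fix x
    have "0 \<le> (cmod (f x) - cmod (g x))\<^sup>2" "0 \<le> cmod (f x) * cmod (g x)" by auto
    then show "norm (f x * g x) \<le> norm ((cmod (f x))\<^sup>2 + (cmod (g x))\<^sup>2)"
      unfolding power2_diff norm_mult real_norm_def by linarith
  qed
qed (use assms in \<open>auto intro: sqint_integrable\<close>)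

text \<open>Integrating \<open>2 \<bar>f g\<bar> \<le> t \<bar>f\<bar>\<^sup>2 + \<bar>g\<bar>\<^sup>2 / t\<close> and optimising in \<open>t\<close>.\<close>

lemma sqint_Cauchy_Schwarz:
  assumes f: "f \<in> sqint M" and g: "g \<in> sqint M"
  shows "(\<integral>x. cmod (f x * g x) \<partial>M) \<le> sqrt (\<integral>x. (cmod (f x))\<^sup>2 \<partial>M) * sqrt (\<integral>x. (cmod (g x))\<^sup>2 \<partial>M)"
proof -
  define A where "A = (\<integral>x. (cmod (f x))\<^sup>2 \<partial>M)"
  define B where "B = (\<integral>x. (cmod (g x))\<^sup>2 \<partial>M)"
  have A0: "A \<ge> 0" and B0: "B \<ge> 0" by (auto simp: A_def B_def)
  have int: "integrable M (\<lambda>x. cmod (f x * g x))"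
    using sqint_mult_integrable[OF f g] by (rule integrable_norm)
  show ?thesis
  proof (cases "A = 0 \<or> B = 0")
    case True
    have "AE x in M. f x * g x = 0"
    proof (cases "A = 0")
      case True
      then have "AE x in M. (cmod (f x))\<^sup>2 = 0"
        unfolding A_def by (subst (asm) integral_nonneg_eq_0_iff_AE) (auto intro: sqint_integrable f)
      then show ?thesis by eventually_elim auto
    next
      case False
      with True have "B = 0" by auto
      then have "AE x in M. (cmod (g x))\<^sup>2 = 0"
        unfolding B_def by (subst (asm) integral_nonneg_eq_0_iff_AE) (auto intro: sqint_integrable g)
      then show ?thesis by eventually_elim auto
    qed
    then have "AE x in M. cmod (f x * g x) = 0" by eventually_elim simp
    then have "(\<integral>x. cmod (f x * g x) \<partial>M) = 0"
      by (subst integral_nonneg_eq_0_iff_AE) (use int in auto)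
    then show ?thesis using A0 B0 by (simp add: A_def B_def)
  next
    case False
    then have pos: "A > 0" "B > 0" using A0 B0 by auto
    define t where "t = sqrt B / sqrt A"
    have t: "t > 0" using pos by (simp add: t_def)
    have "2 * cmod (f x * g x) \<le> t * (cmod (f x))\<^sup>2 + (cmod (g x))\<^sup>2 / t" for x
    proof -
      have "0 \<le> (sqrt t * cmod (f x) - cmod (g x) / sqrt t)\<^sup>2" by simp
      also have "\<dots> = t * (cmod (f x))\<^sup>2 + (cmod (g x))\<^sup>2 / t - 2 * cmod (f x * g x)"
        using t by (simp add: power2_diff power_mult_distrib power_divide norm_mult)
      finally show ?thesis by simp
    qed
    moreover have ig: "integrable M (\<lambda>x. (cmod (g x))\<^sup>2 / t)"
      using sqint_integrable[OF g] by simp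
    ultimately have "(\<integral>x. 2 * cmod (f x * g x) \<partial>M) \<le> (\<integral>x. t * (cmod (f x))\<^sup>2 + (cmod (g x))\<^sup>2 / t \<partial>M)"
      by (intro integral_mono Bochner_Integration.integrable_add integrable_mult_right sqint_integrable f g int) (use ig in auto)
    also have "\<dots> = t * A + B / t"
      by (subst Bochner_Integration.integral_add) (use ig in \<open>auto intro: sqint_integrable f g simp: A_def B_def\<close>)
    also have "t * A + B / t = 2 * (sqrt A * sqrt B)"
    proof -
      define a b where "a = sqrt A" and "b = sqrt B"
      have "a > 0" "b > 0" "A = a * a" "B = b * b" "t = b / a"
        using pos by (auto simp: a_def b_def t_def)
      then show ?thesis unfolding a_def[symmetric] b_def[symmetric] by simp
    qed
    finally show ?thesis by (simp add: A_def B_def)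
  qed
qed

lemma sq_tendsto_norm_bounded:
  assumes f: "\<And>n. f n \<in> sqint M" "g \<in> sqint M" "sq_tendsto M f g"
  shows "(\<integral>x. (cmod (f n x))\<^sup>2 \<partial>M) \<le> 2 * (\<integral>x. (cmod (f n x - g x))\<^sup>2 \<partial>M) + 2 * (\<integral>x. (cmod (g x))\<^sup>2 \<partial>M)"
proof -
  have "(cmod (f n x))\<^sup>2 \<le> 2 * (cmod (f n x - g x))\<^sup>2 + 2 * (cmod (g x))\<^sup>2" for x
    using cmod_add_sq[of "f n x - g x" "g x"] by simp
  then have "(\<integral>x. (cmod (f n x))\<^sup>2 \<partial>M) \<le> (\<integral>x. 2 * (cmod (f n x - g x))\<^sup>2 + 2 * (cmod (g x))\<^sup>2 \<partial>M)"
    by (intro integral_mono) (auto intro!: sqint_integrable f sqint_diff)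
  also have "\<dots> = 2 * (\<integral>x. (cmod (f n x - g x))\<^sup>2 \<partial>M) + 2 * (\<integral>x. (cmod (g x))\<^sup>2 \<partial>M)"
    by (subst Bochner_Integration.integral_add) (auto intro!: sqint_integrable f sqint_diff)
  finally show ?thesis .
qed

text \<open>The passage to the limit in every formula that is first proved for truncations or for partial sums.\<close>

lemma sq_tendsto_pairing:
  assumes f: "\<And>n. f n \<in> sqint M" "F \<in> sqint M" "sq_tendsto M f F"
    and g: "\<And>n. g n \<in> sqint M" "G \<in> sqint M" "sq_tendsto M g G"
  shows "(\<lambda>n. \<integral>x. f n x * g n x \<partial>M) \<longlonglongrightarrow> (\<integral>x. F x * G x \<partial>M)"
proof -
  define a where "a n = (\<integral>x. (cmod (f n x - F x))\<^sup>2 \<partial>M)" for n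
  define b where "b n = (\<integral>x. (cmod (g n x - G x))\<^sup>2 \<partial>M)" for n
  have a: "a \<longlonglongrightarrow> 0" and b: "b \<longlonglongrightarrow> 0"
    using f(3) g(3) unfolding sq_tendsto_def a_def b_def by auto
  define e where "e n = sqrt (a n) * sqrt (2 * b n + 2 * (\<integral>x. (cmod (G x))\<^sup>2 \<partial>M))
     + sqrt (\<integral>x. (cmod (F x))\<^sup>2 \<partial>M) * sqrt (b n)" for n
  have e: "e \<longlonglongrightarrow> 0"
    unfolding e_def by (rule tendsto_eq_intros a b refl | simp)+
  have le: "norm ((\<integral>x. f n x * g n x \<partial>M) - (\<integral>x. F x * G x \<partial>M)) \<le> e n" for n
  proof -
    have i1: "integrable M (\<lambda>x. (f n x - F x) * g n x)" and i2: "integrable M (\<lambda>x. F x * (g n x - G x))"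
      by (intro sqint_mult_integrable sqint_diff f g)+
    have "(\<integral>x. f n x * g n x \<partial>M) - (\<integral>x. F x * G x \<partial>M) = (\<integral>x. f n x * g n x - F x * G x \<partial>M)"
      by (subst Bochner_Integration.integral_diff) (auto intro!: sqint_mult_integrable f g)
    also have "\<dots> = (\<integral>x. (f n x - F x) * g n x + F x * (g n x - G x) \<partial>M)"
      by (intro Bochner_Integration.integral_cong) (auto simp: algebra_simps)
    also have "\<dots> = (\<integral>x. (f n x - F x) * g n x \<partial>M) + (\<integral>x. F x * (g n x - G x) \<partial>M)"
      by (subst Bochner_Integration.integral_add) (auto intro: i1 i2)
    finally have eq: "(\<integral>x. f n x * g n x \<partial>M) - (\<integral>x. F x * G x \<partial>M) = \<dots>" .
    have "norm (\<integral>x. (f n x - F x) * g n x \<partial>M) \<le> (\<integral>x. cmod ((f n x - F x) * g n x) \<partial>M)"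
      by (rule integral_norm_bound)
    also have "\<dots> \<le> sqrt (a n) * sqrt (\<integral>x. (cmod (g n x))\<^sup>2 \<partial>M)"
      unfolding a_def by (intro sqint_Cauchy_Schwarz sqint_diff f g)
    also have "\<dots> \<le> sqrt (a n) * sqrt (2 * b n + 2 * (\<integral>x. (cmod (G x))\<^sup>2 \<partial>M))"
      using sq_tendsto_norm_bounded[OF g, of n]
      by (intro mult_left_mono real_sqrt_le_mono) (auto simp: b_def a_def)
    finally have 1: "norm (\<integral>x. (f n x - F x) * g n x \<partial>M) \<le> \<dots>" .
    have "norm (\<integral>x. F x * (g n x - G x) \<partial>M) \<le> (\<integral>x. cmod (F x * (g n x - G x)) \<partial>M)"
      by (rule integral_norm_bound)
    also have "\<dots> \<le> sqrt (\<integral>x. (cmod (F x))\<^sup>2 \<partial>M) * sqrt (b n)"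
      unfolding b_def by (intro sqint_Cauchy_Schwarz sqint_diff f g)
    finally show ?thesis unfolding eq e_def using 1 by (intro norm_triangle_mono) auto
  qed
  have "(\<lambda>n. (\<integral>x. f n x * g n x \<partial>M) - (\<integral>x. F x * G x \<partial>M)) \<longlonglongrightarrow> 0"
    by (rule Lim_null_comparison[OF always_eventually e]) (rule allI, rule le)
  then show ?thesis by (rule LIM_zero_cancel)
qed

lemma sq_tendsto_const: "sq_tendsto M (\<lambda>n. f) f"
  by (simp add: sq_tendsto_def)

lemma sq_cmod_pairing: "(\<integral>x. f x * cnj (f x) \<partial>M) = complex_of_real (\<integral>x. (cmod (f x))\<^sup>2 \<partial>M)"
proof -
  have "complex_of_real (\<integral>x. (cmod (f x))\<^sup>2 \<partial>M) = (\<integral>x. complex_of_real ((cmod (f x))\<^sup>2) \<partial>M)"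
    by (rule integral_complex_of_real[symmetric])
  also have "\<dots> = (\<integral>x. f x * cnj (f x) \<partial>M)"
    by (intro Bochner_Integration.integral_cong refl complex_norm_square)
  finally show ?thesis by (rule sym)
qed

lemma sq_tendsto_cnj: "sq_tendsto M f g \<Longrightarrow> sq_tendsto M (\<lambda>n x. cnj (f n x)) (\<lambda>x. cnj (g x))"
  unfolding sq_tendsto_def complex_cnj_diff[symmetric] complex_mod_cnj .

lemma sq_tendsto_norm:
  assumes f: "\<And>n. f n \<in> sqint M" "F \<in> sqint M" "sq_tendsto M f F"
  shows "(\<lambda>n. \<integral>x. (cmod (f n x))\<^sup>2 \<partial>M) \<longlonglongrightarrow> (\<integral>x. (cmod (F x))\<^sup>2 \<partial>M)"
  using sq_tendsto_pairing[OF f sqint_cnj[OF f(1)] sqint_cnj[OF f(2)] sq_tendsto_cnj[OF f(3)]]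
  unfolding sq_cmod_pairing tendsto_of_real_iff .

lemma sqint_eq_0_AE:
  assumes "f \<in> sqint M" "(\<integral>x. (cmod (f x))\<^sup>2 \<partial>M) \<le> 0"
  shows "AE x in M. f x = 0"
proof -
  have "(\<integral>x. (cmod (f x))\<^sup>2 \<partial>M) = 0" using assms(2) by (intro antisym) auto
  then have "AE x in M. (cmod (f x))\<^sup>2 = 0"
    by (subst (asm) integral_nonneg_eq_0_iff_AE) (auto intro: sqint_integrable assms)
  then show ?thesis by eventually_elim auto
qed

lemma sq_tendsto_unique:
  assumes f: "\<And>n. f n \<in> sqint M" and g: "g \<in> sqint M" "sq_tendsto M f g" and h: "h \<in> sqint M" "sq_tendsto M f h"
  shows "AE x in M. g x = h x"
proof -
  have "(\<integral>x. (cmod (g x - h x))\<^sup>2 \<partial>M) \<le> 0"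
  proof (rule tendsto_lowerbound)
    show "(\<lambda>n. 2 * (\<integral>x. (cmod (f n x - g x))\<^sup>2 \<partial>M) + 2 * (\<integral>x. (cmod (f n x - h x))\<^sup>2 \<partial>M)) \<longlonglongrightarrow> 0"
      using g(2) h(2) unfolding sq_tendsto_def by (auto intro!: tendsto_eq_intros)
    have "(\<integral>x. (cmod (g x - h x))\<^sup>2 \<partial>M) \<le>
        2 * (\<integral>x. (cmod (f n x - g x))\<^sup>2 \<partial>M) + 2 * (\<integral>x. (cmod (f n x - h x))\<^sup>2 \<partial>M)" for n
    proof -
      have "(cmod (g x - h x))\<^sup>2 \<le> 2 * (cmod (f n x - g x))\<^sup>2 + 2 * (cmod (f n x - h x))\<^sup>2" for x
        using cmod_add_sq[of "g x - f n x" "f n x - h x"] by (simp add: norm_minus_commute)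
      then have "(\<integral>x. (cmod (g x - h x))\<^sup>2 \<partial>M) \<le> (\<integral>x. 2 * (cmod (f n x - g x))\<^sup>2 + 2 * (cmod (f n x - h x))\<^sup>2 \<partial>M)"
        by (intro integral_mono) (auto intro!: sqint_integrable f g h sqint_diff)
      also have "\<dots> = 2 * (\<integral>x. (cmod (f n x - g x))\<^sup>2 \<partial>M) + 2 * (\<integral>x. (cmod (f n x - h x))\<^sup>2 \<partial>M)"
        by (subst Bochner_Integration.integral_add) (auto intro!: sqint_integrable f g h sqint_diff)
      finally show ?thesis .
    qed
    then show "\<forall>\<^sub>F n in sequentially. (\<integral>x. (cmod (g x - h x))\<^sup>2 \<partial>M) \<le>
        2 * (\<integral>x. (cmod (f n x - g x))\<^sup>2 \<partial>M) + 2 * (\<integral>x. (cmod (f n x - h x))\<^sup>2 \<partial>M)"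
      by simp
  qed auto
  then show ?thesis using sqint_eq_0_AE[OF sqint_diff[OF g(1) h(1)]] by auto
qed

text \<open>The subsequence is chosen so sparse that \<open>\<Sum>k. 2 ^ k * (cmod (f\<^bsub>r (k+1)\<^esub> - f\<^bsub>r k\<^esub>))\<^sup>2\<close> has a
  finite integral; where this series converges, the increments decay geometrically.\<close>

lemma sqint_complete:
  assumes f: "\<And>n. f n \<in> sqint M"
    and C: "\<And>e. e > 0 \<Longrightarrow> \<exists>N. \<forall>m\<ge>N. \<forall>n\<ge>N. (\<integral>x. (cmod (f m x - f n x))\<^sup>2 \<partial>M) < e"
  obtains g where "g \<in> sqint M" "sq_tendsto M f g"
proof -
  have [measurable]: "f n \<in> borel_measurable M" for n using f by (rule sqint_measurable)
  have "\<forall>k. \<exists>N. \<forall>m\<ge>N. \<forall>n\<ge>N. (\<integral>x. (cmod (f m x - f n x))\<^sup>2 \<partial>M) < (1/4)^k"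
    using C by auto
  from choice[OF this] obtain N where
    N': "\<forall>k. \<forall>m\<ge>N k. \<forall>n\<ge>N k. (\<integral>x. (cmod (f m x - f n x))\<^sup>2 \<partial>M) < (1/4)^k" ..
  have N: "(\<integral>x. (cmod (f m x - f n x))\<^sup>2 \<partial>M) < (1/4)^k" if "m \<ge> N k" "n \<ge> N k" for k m n
    using N' that by simp
  \<comment> \<open>Partial sums make the indices monotone and keep them above \<open>N k\<close>.\<close>
  define r where "r k = (\<Sum>i\<le>k. N i)" for k
  have rN: "r k \<ge> N k" for k unfolding r_def by (simp add: member_le_sum)
  have rmono: "j \<le> k \<Longrightarrow> r j \<le> r k" for j k unfolding r_def by (intro sum_mono2) auto
  have nnf: "(\<integral>\<^sup>+x. ennreal ((cmod (f m x - f n x))\<^sup>2) \<partial>M) = ennreal (\<integral>x. (cmod (f m x - f n x))\<^sup>2 \<partial>M)" for m n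
    using sqint_nn_integral[OF sqint_diff[OF f f]] .
  define D where "D k x = cmod (f (r (Suc k)) x - f (r k) x)" for k x
  have [measurable]: "D k \<in> borel_measurable M" for k unfolding D_def by measurable
  have "(\<integral>\<^sup>+x. (\<Sum>k. ennreal (2^k * (D k x)\<^sup>2)) \<partial>M) = (\<Sum>k. \<integral>\<^sup>+x. ennreal (2^k * (D k x)\<^sup>2) \<partial>M)"
    by (rule nn_integral_suminf) measurable
  also have "\<dots> \<le> (\<Sum>k. ennreal ((1/2)^k))"
  proof (rule suminf_le)
    fix k
    have "(\<integral>\<^sup>+x. ennreal (2^k * (D k x)\<^sup>2) \<partial>M) = ennreal (2^k) * (\<integral>\<^sup>+x. ennreal ((D k x)\<^sup>2) \<partial>M)"
      by (subst nn_integral_cmult[symmetric]) (auto simp: ennreal_mult)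
    also have "\<dots> \<le> ennreal (2^k) * ennreal ((1/4)^k)"
      unfolding D_def nnf
      by (intro mult_left_mono ennreal_leI less_imp_le N rN order_trans[OF rN rmono]) auto
    also have "\<dots> = ennreal ((1/2)^k)" by (simp add: ennreal_mult[symmetric] power_mult_distrib[symmetric])
    finally show "(\<integral>\<^sup>+x. ennreal (2^k * (D k x)\<^sup>2) \<partial>M) \<le> ennreal ((1/2)^k)" .
  qed auto
  also have "\<dots> < \<infinity>"
    by (subst suminf_ennreal2) (auto intro: summable_geometric)
  finally have "(\<integral>\<^sup>+x. (\<Sum>k. ennreal (2^k * (D k x)\<^sup>2)) \<partial>M) < \<infinity>" .
  then have fin: "AE x in M. (\<Sum>k. ennreal (2^k * (D k x)\<^sup>2)) \<noteq> \<infinity>"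
    by (intro nn_integral_PInf_AE) auto
  define g where "g x = lim (\<lambda>k. f (r k) x)" for x
  have [measurable]: "g \<in> borel_measurable M" unfolding g_def by measurable
  have conv: "AE x in M. (\<lambda>k. f (r k) x) \<longlonglongrightarrow> g x"
    using fin
  proof eventually_elim
    case (elim x)
    have "\<exists>h\<ge>0. y = ennreal h" if "y \<noteq> \<infinity>" for y
      using that by (cases y rule: ennreal_cases) auto
    from this[OF elim] obtain h where h: "(\<Sum>k. ennreal (2^k * (D k x)\<^sup>2)) = ennreal h" "h \<ge> 0"
      by (elim exE conjE)
    have Dle: "D k x \<le> sqrt h * (1 / sqrt 2)^k" for k
    proof -
      have "ennreal (2^k * (D k x)\<^sup>2) \<le> ennreal h"
        using sum_le_suminf[of "\<lambda>k. ennreal (2^k * (D k x)\<^sup>2)" "{k}"] h by auto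
      then have "2^k * (D k x)\<^sup>2 \<le> h" using h by (simp add: ennreal_le_iff)
      then have "(D k x)\<^sup>2 \<le> h * (1/2)^k" by (simp add: field_simps power_divide)
      then have "sqrt ((D k x)\<^sup>2) \<le> sqrt (h * (1/2)^k)" by (rule real_sqrt_le_mono)
      moreover have "sqrt (h * (1/2)^k) = sqrt h * (1 / sqrt 2)^k"
        by (simp only: real_sqrt_mult real_sqrt_power real_sqrt_divide real_sqrt_one)
      ultimately show ?thesis by (simp add: D_def)
    qed
    have "summable (\<lambda>k. sqrt h * (1 / sqrt 2)^k)"
      by (intro summable_mult summable_geometric) simp
    then have "summable (\<lambda>k. f (r (Suc k)) x - f (r k) x)"
      by (rule summable_comparison_test'[where N=0]) (use Dle in \<open>simp add: D_def\<close>)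
    then have "convergent (\<lambda>n. (\<Sum>k<n. f (r (Suc k)) x - f (r k) x))"
      unfolding summable_iff_convergent .
    then have "convergent (\<lambda>n. f (r n) x - f (r 0) x)"
      unfolding sum_lessThan_telescope[of "\<lambda>k. f (r k) x"] .
    then have "convergent (\<lambda>n. f (r n) x)"
      unfolding convergent_diff_const_right_iff .
    then show ?case unfolding g_def convergent_LIMSEQ_iff .
  qed
  have main: "(\<integral>\<^sup>+x. ennreal ((cmod (f n x - g x))\<^sup>2) \<partial>M) \<le> ennreal ((1/4)^K)" if n: "n \<ge> N K" for n K
  proof -
    have "(\<integral>\<^sup>+x. ennreal ((cmod (f n x - g x))\<^sup>2) \<partial>M)
        = (\<integral>\<^sup>+x. liminf (\<lambda>k. ennreal ((cmod (f n x - f (r k) x))\<^sup>2)) \<partial>M)"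
    proof (rule nn_integral_cong_AE, use conv in eventually_elim)
      case (elim x)
      have "(\<lambda>k. ennreal ((cmod (f n x - f (r k) x))\<^sup>2)) \<longlonglongrightarrow> ennreal ((cmod (f n x - g x))\<^sup>2)"
        by (intro tendsto_ennrealI tendsto_power tendsto_norm tendsto_diff tendsto_const elim)
      from lim_imp_Liminf[OF _ this] show ?case by simp
    qed
    also have "\<dots> \<le> liminf (\<lambda>k. \<integral>\<^sup>+x. ennreal ((cmod (f n x - f (r k) x))\<^sup>2) \<partial>M)"
      by (rule nn_integral_liminf) measurable
    also have "\<dots> \<le> liminf (\<lambda>k. ennreal ((1/4)^K))"
    proof (rule Liminf_mono, rule eventually_sequentiallyI[of K])
      fix k assume "k \<ge> K"
      then have "r k \<ge> N K" using rN[of K] rmono[of K k] by simp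
      then show "(\<integral>\<^sup>+x. ennreal ((cmod (f n x - f (r k) x))\<^sup>2) \<partial>M) \<le> ennreal ((1/4)^K)"
        unfolding nnf using N n by (intro ennreal_leI less_imp_le) auto
    qed
    also have "\<dots> = ennreal ((1/4)^K)" by (simp add: Liminf_const)
    finally show ?thesis .
  qed
  have "(\<lambda>x. f (N 0) x - g x) \<in> sqint M"
    using main[of 0 "N 0"] by (intro sqintI_nn) (auto intro: le_less_trans)
  from sqint_diff[OF f[of "N 0"] this] have gs: "g \<in> sqint M" by simp
  have "sq_tendsto M f g"
    unfolding sq_tendsto_def
  proof (rule LIMSEQ_I)
    fix e :: real assume "e > 0"
    then obtain K where K: "(1/4)^K < e" using real_arch_pow_inv[of e "1/4"] by auto
    have "norm ((\<integral>x. (cmod (f n x - g x))\<^sup>2 \<partial>M) - 0) < e" if "n \<ge> N K" for n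
    proof -
      have "ennreal (\<integral>x. (cmod (f n x - g x))\<^sup>2 \<partial>M) \<le> ennreal ((1/4)^K)"
        using main[OF that] sqint_nn_integral[OF sqint_diff[OF f gs]] by simp
      then show ?thesis using K by (simp add: ennreal_le_iff)
    qed
    then show "\<exists>no. \<forall>n\<ge>no. norm ((\<integral>x. (cmod (f n x - g x))\<^sup>2 \<partial>M) - 0) < e" by auto
  qed
  with gs show ?thesis by (rule that)
qed

section \<open>Fourier series on the torus\<close>

abbreviation torus_measure :: "real measure" where
  "torus_measure \<equiv> restrict_space lborel {0..<2 * pi}"

lemma torus_measure_finite: "finite_measure torus_measure"
  by (rule finite_measureI) (simp add: space_restrict_space emeasure_restrict_space)

interpretation torus: finite_measure torus_measure
  by (rule torus_measure_finite)

lemma borel_measurable_torus: "f \<in> borel_measurable borel \<Longrightarrow> f \<in> borel_measurable torus_measure"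
  by (intro measurable_restrict_space1) simp

lemma cis_measurable [measurable]: "cis \<in> borel_measurable borel"
  by (intro borel_measurable_continuous_onI continuous_intros)

lemma cis_mult_measurable [measurable]:
  "f \<in> borel_measurable M \<Longrightarrow> (\<lambda>x. cis (f x)) \<in> borel_measurable M"
  by (rule measurable_compose[OF _ cis_measurable])

lemma integrable_cis_mult:
  fixes f :: "'a \<Rightarrow> complex"
  assumes "integrable M f" "h \<in> borel_measurable M"
  shows "integrable M (\<lambda>x. cis (h x) * f x)"
  by (rule Bochner_Integration.integrable_bound[OF assms(1)])
     (use assms in \<open>auto simp: norm_mult intro!: borel_measurable_times cis_mult_measurable borel_measurable_integrable\<close>)

lemma id_measurable_torus [measurable]: "(\<lambda>x. x) \<in> borel_measurable torus_measure"
  by (intro borel_measurable_torus) simp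

text \<open>The class of multipliers that preserve the vanishing of all Fourier coefficients contains the
  coordinate functions of the circle and is an algebra.\<close>

lemma vanishing_coeffs_poly:
  assumes "real_polynomial_function p"
  shows "integrable torus_measure F \<Longrightarrow> (\<And>k::int. (\<integral>x. cis (of_int k * x) * F x \<partial>torus_measure) = 0)
    \<Longrightarrow> integrable torus_measure (\<lambda>x. of_real (p (cis x)) * F x) \<and>
       (\<forall>k::int. (\<integral>x. cis (of_int k * x) * (of_real (p (cis x)) * F x) \<partial>torus_measure) = 0)"
  using assms
proof (induction p arbitrary: F rule: real_polynomial_function.induct)
  case (linear p)
  interpret bounded_linear p by fact
  define a where "a = (complex_of_real (p 1) - \<i> * of_real (p \<i>)) / 2"
  define b where "b = (complex_of_real (p 1) + \<i> * of_real (p \<i>)) / 2"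
  have p: "of_real (p (cis x)) = a * cis x + b * cis (- x)" for x
  proof -
    have "cis x = cos x *\<^sub>R 1 + sin x *\<^sub>R \<i>" by (simp add: complex_eq_iff)
    then have "p (cis x) = cos x * p 1 + sin x * p \<i>" by (simp only: add scaleR) simp
    then show ?thesis by (simp add: a_def b_def complex_eq_iff field_simps)
  qed
  have eq: "cis (of_int k * x) * (of_real (p (cis x)) * F x)
      = a * (cis (of_int (k + 1) * x) * F x) + b * (cis (of_int (k - 1) * x) * F x)" for k x
  proof -
    have "cis (of_int (k + 1) * x) = cis (of_int k * x) * cis x"
      "cis (of_int (k - 1) * x) = cis (of_int k * x) * cis (- x)"
      by (simp_all only: cis_mult) (simp_all add: algebra_simps)
    then show ?thesis unfolding p by (simp only:) (simp add: algebra_simps)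
  qed
  have int: "integrable torus_measure (\<lambda>x. cis (of_int k * x) * F x)" for k
    by (intro integrable_cis_mult linear.prems borel_measurable_times) auto
  have int1: "integrable torus_measure (\<lambda>x. cis (of_int k * x) * (of_real (p (cis x)) * F x))" for k
    unfolding eq by (intro Bochner_Integration.integrable_add integrable_mult_right int)
  have "(\<integral>x. cis (of_int k * x) * (of_real (p (cis x)) * F x) \<partial>torus_measure) = 0" for k :: int
    unfolding eq
    by (subst Bochner_Integration.integral_add) (use int linear.prems in \<open>simp_all del: of_int_add of_int_diff\<close>)
  with int1[of 0] show ?case by simp
next
  case (const c)
  have "cis (of_int k * x) * (of_real c * F x) = of_real c * (cis (of_int k * x) * F x)" for k x
    by simp
  with const show ?case by (auto simp del: mult_cancel_left simp: mult.left_commute)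
next
  case (add p q)
  note P = add.IH(1)[OF add.prems] and Q = add.IH(2)[OF add.prems]
  have "integrable torus_measure (\<lambda>x. cis (of_int k * x) * (of_real (p (cis x)) * F x))"
    "integrable torus_measure (\<lambda>x. cis (of_int k * x) * (of_real (q (cis x)) * F x))" for k
    by (intro integrable_cis_mult P[THEN conjunct1] Q[THEN conjunct1]; measurable)+
  with P Q show ?case by (simp add: distrib_left distrib_right)
next
  case (mult p q)
  note Q = mult.IH(2)[OF mult.prems]
  have "\<And>k::int. (\<integral>x. cis (of_int k * x) * (of_real (q (cis x)) * F x) \<partial>torus_measure) = 0"
    using Q by blast
  from mult.IH(1)[OF Q[THEN conjunct1] this] show ?case by (simp add: mult.assoc)
qed

text \<open>A continuous function on the circle is a uniform limit of polynomials in the coordinates, which are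
  trigonometric polynomials.\<close>

lemma vanishing_coeffs_continuous:
  fixes \<phi> :: "complex \<Rightarrow> real"
  assumes F: "integrable torus_measure F"
    and 0: "\<And>k::int. (\<integral>x. cis (of_int k * x) * F x \<partial>torus_measure) = 0"
    and \<phi>: "continuous_on UNIV \<phi>"
  shows "(\<integral>x. of_real (\<phi> (cis x)) * F x \<partial>torus_measure) = 0"
proof -
  have cont: "continuous_on (sphere 0 1) \<phi>" using \<phi> continuous_on_subset by blast
  define C where "C = (\<integral>x. cmod (F x) \<partial>torus_measure)"
  have [measurable]: "\<phi> \<in> borel_measurable borel" using \<phi> by (rule borel_measurable_continuous_onI)
  have m: "(\<lambda>x. of_real (\<phi> (cis x)) * F x) \<in> borel_measurable torus_measure"
    using F by measurable
  obtain B where "\<forall>y\<in>\<phi> ` sphere 0 1. norm y \<le> B"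
    using compact_imp_bounded[OF compact_continuous_image[OF cont compact_sphere]]
    unfolding bounded_iff by blast
  then have B: "norm (\<phi> z) \<le> B" if "z \<in> sphere 0 1" for z using that by blast
  have i1: "integrable torus_measure (\<lambda>x. of_real (\<phi> (cis x)) * F x)"
  proof (rule Bochner_Integration.integrable_bound[OF integrable_mult_right[OF integrable_norm[OF F], of B] m], rule AE_I2)
    fix x
    have "norm (\<phi> (cis x)) \<le> B" by (intro B) simp
    then have "norm (\<phi> (cis x)) * norm (F x) \<le> B * norm (F x)" by (intro mult_right_mono) auto
    also have "\<dots> \<le> norm (B * norm (F x))" by simp
    finally show "norm (of_real (\<phi> (cis x)) * F x) \<le> norm (B * norm (F x))"
      unfolding norm_mult norm_of_real real_norm_def .
  qed
  have "norm (\<integral>x. of_real (\<phi> (cis x)) * F x \<partial>torus_measure) \<le> e * C" if e: "e > 0" for e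
  proof -
    obtain p where p: "real_polynomial_function p" "\<And>z. z \<in> sphere 0 1 \<Longrightarrow> \<bar>\<phi> z - p z\<bar> < e"
      using Stone_Weierstrass_real_polynomial_function[OF compact_sphere cont e] by blast
    note P = vanishing_coeffs_poly[OF p(1) F 0]
    have "(\<integral>x. of_real (\<phi> (cis x)) * F x \<partial>torus_measure)
        = (\<integral>x. of_real (\<phi> (cis x)) * F x \<partial>torus_measure) - (\<integral>x. of_real (p (cis x)) * F x \<partial>torus_measure)"
      using P[THEN conjunct2, rule_format, of 0] by simp
    also have "\<dots> = (\<integral>x. of_real (\<phi> (cis x)) * F x - of_real (p (cis x)) * F x \<partial>torus_measure)"
      by (intro Bochner_Integration.integral_diff[symmetric] i1 P[THEN conjunct1])
    finally have "norm (\<integral>x. of_real (\<phi> (cis x)) * F x \<partial>torus_measure)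
        \<le> (\<integral>x. norm (of_real (\<phi> (cis x)) * F x - of_real (p (cis x)) * F x) \<partial>torus_measure)"
      by (simp only: integral_norm_bound)
    also have "\<dots> \<le> (\<integral>x. e * cmod (F x) \<partial>torus_measure)"
    proof (rule integral_mono)
      fix x
      have "\<bar>\<phi> (cis x) - p (cis x)\<bar> \<le> e" by (intro less_imp_le p) simp
      then have "norm (of_real (\<phi> (cis x) - p (cis x)) * F x) \<le> e * cmod (F x)"
        unfolding norm_mult norm_of_real by (intro mult_right_mono) auto
      then show "norm (of_real (\<phi> (cis x)) * F x - of_real (p (cis x)) * F x) \<le> e * cmod (F x)"
        by (simp add: left_diff_distrib)
    qed (intro integrable_norm integrable_mult_right Bochner_Integration.integrable_diff F i1 P[THEN conjunct1])+
    also have "\<dots> = e * C" by (simp add: C_def)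
    finally show ?thesis .
  qed
  note le = this
  have C0: "C \<ge> 0" by (simp add: C_def)
  have "norm (\<integral>x. of_real (\<phi> (cis x)) * F x \<partial>torus_measure) \<le> 0"
  proof (rule field_le_epsilon)
    fix e :: real assume "e > 0"
    then have "e / (C + 1) > 0" using C0 by simp
    from le[OF this] have "norm (\<integral>x. of_real (\<phi> (cis x)) * F x \<partial>torus_measure) \<le> e * (C / (C + 1))"
      by simp
    also have "\<dots> \<le> e * 1" using C0 \<open>e > 0\<close> by (intro mult_left_mono) auto
    finally show "norm (\<integral>x. of_real (\<phi> (cis x)) * F x \<partial>torus_measure) \<le> 0 + e" by simp
  qed
  then show ?thesis by simp
qed

text \<open>Arcs of the circle are cut out by half planes, and so their indicators are limits of continuous
  functions of \<open>cis x\<close>.\<close>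

lemma cos_gt_iff_on_circle:
  assumes x: "0 \<le> x" "x < 2 * pi" and r: "0 < r" "0 \<le> c - r" "c + r \<le> 2 * pi"
  shows "cos (x - c) > cos r \<longleftrightarrow> \<bar>x - c\<bar> < r"
proof -
  define t where "t = \<bar>x - c\<bar>"
  have t: "0 \<le> t" "t \<le> 2 * pi - r" unfolding t_def using x r by linarith+
  have rpi: "r \<le> pi" using r by simp
  have ct: "cos (x - c) = cos t" unfolding t_def by (rule cos_abs_real[symmetric])
  show ?thesis
  proof (cases "t < r")
    case True
    then have "cos r < cos t" using t rpi by (intro cos_monotone_0_pi) auto
    with True show ?thesis unfolding ct t_def[symmetric] by simp
  next
    case False
    have "cos t \<le> cos r"
    proof (cases "t \<le> pi")
      case True
      with False r rpi show ?thesis by (intro cos_monotone_0_pi_le) auto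
    next
      case F: False
      have "cos t = cos (2 * pi - t)" by (rule cos_2pi_minus[symmetric])
      also have "\<dots> \<le> cos r" using F t r by (intro cos_monotone_0_pi_le) auto
      finally show ?thesis .
    qed
    with False show ?thesis unfolding ct t_def[symmetric] by simp
  qed
qed

lemma vanishing_coeffs_arc:
  assumes F: "integrable torus_measure F"
    and 0: "\<And>k::int. (\<integral>x. cis (of_int k * x) * F x \<partial>torus_measure) = 0"
    and r: "0 < r" "0 \<le> c - r" "c + r \<le> 2 * pi"
  shows "(\<integral>x. indicator {c - r<..<c + r} x * F x \<partial>torus_measure) = 0"
proof -
  \<comment> \<open>Continuous functions on the plane that increase to the indicator of a half plane.\<close>
  define \<phi> where "\<phi> n z = max 0 (min 1 (real n * (Re (cis (- c) * z) - cos r)))" for n z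
  have cont: "continuous_on UNIV (\<phi> n)" for n unfolding \<phi>_def by (intro continuous_intros)
  have [measurable]: "\<phi> n \<in> borel_measurable borel" for n using cont by (rule borel_measurable_continuous_onI)
  have \<phi>01: "0 \<le> \<phi> n z" "\<phi> n z \<le> 1" for n z by (auto simp: \<phi>_def)
  have "(\<lambda>n. \<integral>x. of_real (\<phi> n (cis x)) * F x \<partial>torus_measure)
     \<longlonglongrightarrow> (\<integral>x. indicator {c - r<..<c + r} x * F x \<partial>torus_measure)"
  proof (rule integral_dominated_convergence[where w="\<lambda>x. cmod (F x)"])
    show "AE x in torus_measure. (\<lambda>n. of_real (\<phi> n (cis x)) * F x) \<longlonglongrightarrow> indicator {c - r<..<c + r} x * F x"
    proof (rule AE_I2)
      fix x assume "x \<in> space torus_measure"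
      then have x: "0 \<le> x" "x < 2 * pi" by (auto simp: space_restrict_space)
      have Re: "Re (cis (- c) * cis x) = cos (x - c)" by (simp add: cis_mult)
      have "(\<lambda>n. \<phi> n (cis x)) \<longlonglongrightarrow> indicator {c - r<..<c + r} x"
      proof (cases "cos (x - c) > cos r")
        case True
        then have "x \<in> {c - r<..<c + r}" using cos_gt_iff_on_circle[OF x r] by auto
        moreover have "\<forall>\<^sub>F n in sequentially. \<phi> n (cis x) = 1"
        proof -
          obtain N :: nat where N: "real N * (cos (x - c) - cos r) > 1"
            using True reals_Archimedean3[of "cos (x - c) - cos r"] by auto
          show ?thesis
          proof (rule eventually_sequentiallyI[of N])
            fix n assume "n \<ge> N"
            then have "real N * (cos (x - c) - cos r) \<le> real n * (cos (x - c) - cos r)"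
              using True by (intro mult_right_mono) auto
            with N show "\<phi> n (cis x) = 1" unfolding \<phi>_def Re by linarith
          qed
        qed
        ultimately show ?thesis by (simp add: tendsto_eventually)
      next
        case False
        then have "x \<notin> {c - r<..<c + r}" using cos_gt_iff_on_circle[OF x r] by auto
        moreover have "\<phi> n (cis x) = 0" for n
        proof -
          have "real n * (cos (x - c) - cos r) \<le> 0" using False by (intro mult_nonneg_nonpos) auto
          then show ?thesis unfolding \<phi>_def Re by linarith
        qed
        ultimately show ?thesis by simp
      qed
      then have "(\<lambda>n. complex_of_real (\<phi> n (cis x))) \<longlonglongrightarrow> of_real (indicator {c - r<..<c + r} x)"
        by (rule tendsto_of_real)
      then show "(\<lambda>n. of_real (\<phi> n (cis x)) * F x) \<longlonglongrightarrow> indicator {c - r<..<c + r} x * F x"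
        unfolding of_real_indicator by (rule tendsto_mult_right)
    qed
    show "AE x in torus_measure. norm (of_real (\<phi> n (cis x)) * F x) \<le> cmod (F x)" for n
      using \<phi>01 by (intro AE_I2) (simp add: norm_mult mult_left_le_one_le)
    show "(\<lambda>x. indicator {c - r<..<c + r} x * F x) \<in> borel_measurable torus_measure"
      using F by measurable
    show "(\<lambda>x. of_real (\<phi> n (cis x)) * F x) \<in> borel_measurable torus_measure" for n
      using F by measurable
  qed (use F in auto)
  moreover have "(\<integral>x. of_real (\<phi> n (cis x)) * F x \<partial>torus_measure) = 0" for n
    by (rule vanishing_coeffs_continuous[OF F 0 cont])
  ultimately show ?thesis by (simp add: LIMSEQ_const_iff)
qed

text \<open>Integrals over arcs determine the integrals over all Borel sets.\<close>

lemma vanishing_coeffs_imp_zero: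
  assumes F: "integrable torus_measure F"
    and 0: "\<And>k::int. (\<integral>x. cis (of_int k * x) * F x \<partial>torus_measure) = 0"
  shows "AE x in torus_measure. F x = 0"
proof -
  define F0 where "F0 x = indicator {0..<2 * pi} x *\<^sub>R F x" for x
  have F0: "integrable lborel F0"
    using F unfolding F0_def by (subst (asm) integrable_restrict_space) auto
  have [measurable]: "F0 \<in> borel_measurable borel"
    using borel_measurable_integrable[OF F0] by simp
  have sint: "set_integrable lborel A F0" if "A \<in> sets borel" for A
    using integrable_mult_indicator[OF _ F0, of A] that by (simp add: set_integrable_def)
  have all: "(LINT x:UNIV|lborel. F0 x) = 0"
    using 0[of 0] by (simp add: integral_restrict_space F0_def set_lebesgue_integral_def)
  have "(LINT x:A|lborel. F0 x) = 0" if "A \<in> sets borel" for A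
    using that
  proof (induction A rule: borel_set_induct)
    case empty
    then show ?case by (simp add: set_lebesgue_integral_def)
  next
    case (interval a b)
    define a' b' where "a' = max a 0" and "b' = min b (2 * pi)"
    have "AE x in lborel. x \<noteq> a'" "AE x in lborel. x \<noteq> b'" by (rule AE_lborel_singleton)+
    then have "AE x in lborel. indicator {a..b} x *\<^sub>R F0 x = indicator {a'<..<b'} x *\<^sub>R F0 x"
      by eventually_elim (auto simp: F0_def a'_def b'_def split: split_indicator)
    then have "(LINT x:{a..b}|lborel. F0 x) = (LINT x:{a'<..<b'}|lborel. F0 x)"
      unfolding set_lebesgue_integral_def by (intro integral_cong_AE) auto
    also have "\<dots> = 0"
    proof (cases "a' < b'")
      case True
      define c r where "c = (a' + b') / 2" and "r = (b' - a') / 2"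
      have "c - r = a'" "c + r = b'" by (auto simp: c_def r_def field_simps)
      moreover have "0 < r" "0 \<le> c - r" "c + r \<le> 2 * pi"
        using True calculation by (auto simp: r_def a'_def b'_def)
      ultimately have "(\<integral>x. indicator {a'<..<b'} x * F x \<partial>torus_measure) = 0"
        using vanishing_coeffs_arc[OF F 0, of r c] by simp
      moreover have "(\<integral>x. indicator {a'<..<b'} x * F x \<partial>torus_measure) = (LINT x:{a'<..<b'}|lborel. F0 x)"
        unfolding set_lebesgue_integral_def
        by (subst integral_restrict_space) (auto simp: F0_def intro!: Bochner_Integration.integral_cong split: split_indicator)
      ultimately show ?thesis by simp
    qed (simp add: set_lebesgue_integral_def)
    finally show ?case .
  next
    case (compl A)
    have "(LINT x:(A \<union> - A)|lborel. F0 x) = (LINT x:A|lborel. F0 x) + (LINT x:- A|lborel. F0 x)"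
      using compl.hyps by (intro set_integral_Un sint) auto
    with compl.IH all show ?case by simp
  next
    case (union B)
    have "(LINT x:(\<Union>i. B i)|lborel. F0 x) = (\<Sum>i. (LINT x:B i|lborel. F0 x))"
      by (rule lebesgue_integral_countable_add)
         (use union.hyps sint in \<open>auto simp: disjoint_family_on_def intro!: sint sets.countable_UN\<close>)
    with union.IH show ?case by simp
  qed
  then have "AE x in lborel. F0 x = 0"
    by (intro sigma_finite_measure.density_unique_banach[OF sigma_finite_lborel, where f'="\<lambda>x. 0"] F0) (auto simp: set_lebesgue_integral_def)
  then show ?thesis
    by (subst AE_restrict_space_iff) (auto simp: F0_def elim!: eventually_mono)
qed

lemma cis_has_vector_derivative:
  "((\<lambda>x. cis (c * x)) has_vector_derivative (\<i> * of_real c * cis (c * x))) (at x within S)"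
proof -
  have "((\<lambda>z. exp (\<i> * of_real c * z)) has_field_derivative \<i> * of_real c * exp (\<i> * of_real c * of_real x)) (at (of_real x))"
    by (rule derivative_eq_intros refl | simp)+
  from has_vector_derivative_real_field[OF this, of S] show ?thesis
    by (simp add: cis_conv_exp mult.assoc)
qed

lemma torus_integral_Icc:
  fixes f :: "real \<Rightarrow> complex"
  assumes "f \<in> borel_measurable borel"
  shows "(\<integral>x. f x \<partial>torus_measure) = (\<integral>x. indicator {0..2 * pi} x *\<^sub>R f x \<partial>lborel)"
proof -
  have "AE x in lborel. x \<noteq> 2 * pi" by (rule AE_lborel_singleton)
  then have "AE x in lborel. indicator {0..<2 * pi} x *\<^sub>R f x = indicator {0..2 * pi} x *\<^sub>R f x"
    by eventually_elim (auto split: split_indicator)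
  then show ?thesis
    by (subst integral_restrict_space) (use assms in \<open>auto intro!: integral_cong_AE\<close>)
qed

lemma torus_integral_cis:
  "(\<integral>x. cis (of_int m * x) \<partial>torus_measure) = (if m = 0 then 2 * pi else 0)"
proof (cases "m = 0")
  case True
  then show ?thesis by (simp add: measure_restrict_space space_restrict_space scaleR_conv_of_real)
next
  case False
  have "(\<integral>x. cis (of_int m * x) \<partial>torus_measure) = (\<integral>x. indicator {0..2 * pi} x *\<^sub>R cis (of_int m * x) \<partial>lborel)"
    by (rule torus_integral_Icc) measurable
  also have "\<dots> = cis (of_int m * (2 * pi)) / (\<i> * of_int m) - cis (of_int m * 0) / (\<i> * of_int m)"
  proof (rule integral_FTC_atLeastAtMost)
    fix x :: real
    have "((\<lambda>x. cis (of_int m * x) / (\<i> * of_int m)) has_vector_derivative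
        (\<i> * of_real (of_int m) * cis (of_int m * x)) / (\<i> * of_int m)) (at x within {0..2 * pi})"
      by (intro has_vector_derivative_divide cis_has_vector_derivative)
    then show "((\<lambda>x. cis (of_int m * x) / (\<i> * of_int m)) has_vector_derivative cis (of_int m * x)) (at x within {0..2 * pi})"
      using False by simp
  qed (auto intro!: continuous_intros)
  also have "cis (of_int m * (2 * pi)) = 1"
    using cis_multiple_2pi[of "of_int m"] by (simp add: mult.commute)
  finally show ?thesis using False by simp
qed

lemma torus_orthogonal:
  assumes "k \<in> \<int>" "l \<in> \<int>"
  shows "(\<integral>x. cis (k * x) * cis (- (l * x)) \<partial>torus_measure) = (if k = l then 2 * pi else 0)"
proof -
  from assms obtain i j where kl: "k = of_int i" "l = of_int j" by (auto elim!: Ints_cases)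
  have "cis (k * x) * cis (- (l * x)) = cis (of_int (i - j) * x)" for x
    by (simp add: cis_mult kl algebra_simps)
  then show ?thesis using torus_integral_cis[of "i - j"] by (simp add: kl)
qed

lemma torus_cis_integrable: "integrable torus_measure (\<lambda>x. c * cis (k * x))"
  by (rule torus.integrable_const_bound[where B="cmod c"]) (auto simp: norm_mult)

lemma torus_bounded_sqint:
  assumes "f \<in> borel_measurable torus_measure" "\<And>x. cmod (f x) \<le> B"
  shows "f \<in> sqint torus_measure"
  by (rule sqint_bound[where h="\<lambda>_. B\<^sup>2"]) (use assms in \<open>auto intro!: power_mono\<close>)

lemma torus_cis_sqint: "(\<lambda>x. c * cis (k * x)) \<in> sqint torus_measure"
  by (rule torus_bounded_sqint[where B="cmod c"]) (auto simp: norm_mult)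

lemma torus_sqint_integrable: "f \<in> sqint torus_measure \<Longrightarrow> integrable torus_measure f"
  using sqint_mult_integrable[OF torus_bounded_sqint[of "\<lambda>_. 1" 1]] by fastforce

text \<open>Normalised such that the Fourier coefficients, which carry no factor \<open>1 / (2 \<pi>)\<close>, are the values of
  \<open>g\<close>.\<close>

definition trig_poly :: "real set \<Rightarrow> (real \<Rightarrow> complex) \<Rightarrow> real \<Rightarrow> complex" where
  "trig_poly S g x = (\<Sum>k\<in>S. g k / (2 * pi) * cis (k * x))"

lemma trig_poly_sqint: "trig_poly S g \<in> sqint torus_measure"
  unfolding trig_poly_def[abs_def] by (intro sqint_sum torus_cis_sqint)

lemma coeff_trig_poly:
  assumes S: "finite S" "S \<subseteq> \<int>" and k: "k \<in> \<int>"
  shows "(\<integral>x. cis (- (k * x)) * trig_poly S g x \<partial>torus_measure) = (if k \<in> S then g k else 0)"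
proof -
  have int: "integrable torus_measure (\<lambda>x. g l / (2 * pi) * (cis (l * x) * cis (- (k * x))))" for l
    using torus_cis_integrable[of "g l / (2 * pi)" "l - k"] by (simp add: cis_mult algebra_simps)
  have "cis (- (k * x)) * trig_poly S g x = (\<Sum>l\<in>S. g l / (2 * pi) * (cis (l * x) * cis (- (k * x))))" for x
    unfolding trig_poly_def sum_distrib_left by (simp add: mult_ac)
  then have "(\<integral>x. cis (- (k * x)) * trig_poly S g x \<partial>torus_measure)
      = (\<Sum>l\<in>S. \<integral>x. g l / (2 * pi) * (cis (l * x) * cis (- (k * x))) \<partial>torus_measure)"
    using int by simp
  also have "\<dots> = (\<Sum>l\<in>S. if l = k then g k else 0)"
    using S k by (intro sum.cong refl) (auto simp: torus_orthogonal subset_iff)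
  finally show ?thesis using S by (simp add: sum.delta)
qed

lemma pairing_trig_poly:
  assumes S: "finite S" and f: "f \<in> sqint torus_measure"
  shows "(\<integral>x. f x * cnj (trig_poly S g x) \<partial>torus_measure)
    = (\<Sum>k\<in>S. cnj (g k) / (2 * pi) * (\<integral>x. cis (- (k * x)) * f x \<partial>torus_measure))"
proof -
  have int: "integrable torus_measure (\<lambda>x. cnj (g l) / (2 * pi) * (cis (- (l * x)) * f x))" for l
    by (intro integrable_mult_right integrable_cis_mult torus_sqint_integrable f) measurable
  have "f x * cnj (trig_poly S g x) = (\<Sum>l\<in>S. cnj (g l) / (2 * pi) * (cis (- (l * x)) * f x))" for x
    unfolding trig_poly_def cnj_sum sum_distrib_left by (simp add: mult_ac cis_cnj)
  then show ?thesis using int by simp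
qed

lemma trig_poly_norm:
  assumes S: "finite S" "S \<subseteq> \<int>"
  shows "(\<integral>x. (cmod (trig_poly S g x))\<^sup>2 \<partial>torus_measure) = (\<Sum>k\<in>S. (cmod (g k))\<^sup>2) / (2 * pi)"
proof -
  have "complex_of_real (\<integral>x. (cmod (trig_poly S g x))\<^sup>2 \<partial>torus_measure)
      = (\<Sum>k\<in>S. cnj (g k) / (2 * pi) * (\<integral>x. cis (- (k * x)) * trig_poly S g x \<partial>torus_measure))"
    unfolding sq_cmod_pairing[symmetric] by (rule pairing_trig_poly[OF S(1) trig_poly_sqint])
  also have "\<dots> = (\<Sum>k\<in>S. complex_of_real ((cmod (g k))\<^sup>2) / (2 * pi))"
  proof (intro sum.cong refl)
    fix k assume "k \<in> S"
    then show "cnj (g k) / (2 * pi) * (\<integral>x. cis (- (k * x)) * trig_poly S g x \<partial>torus_measure)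
        = complex_of_real ((cmod (g k))\<^sup>2) / (2 * pi)"
      unfolding complex_norm_square using coeff_trig_poly[OF S, of k g] S(2) by auto
  qed
  also have "\<dots> = complex_of_real ((\<Sum>k\<in>S. (cmod (g k))\<^sup>2) / (2 * pi))"
    by (simp add: sum_divide_distrib)
  finally show ?thesis by (simp only: of_real_eq_iff)
qed

text \<open>The distance from \<open>f\<close> to its partial sum has the square
  \<open>\<parallel>f\<parallel>\<^sup>2 - \<Sum>k\<in>S. \<bar>g k\<bar>\<^sup>2 / (2 \<pi>)\<close>, which is nonnegative.\<close>

lemma Bessel:
  assumes S: "finite S" "S \<subseteq> \<int>" and f: "f \<in> sqint torus_measure"
  shows "(\<Sum>k\<in>S. (cmod (\<integral>x. cis (- (k * x)) * f x \<partial>torus_measure))\<^sup>2)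
     \<le> 2 * pi * (\<integral>x. (cmod (f x))\<^sup>2 \<partial>torus_measure)"
proof -
  define g where "g k = (\<integral>x. cis (- (k * x)) * f x \<partial>torus_measure)" for k
  define p where "p = trig_poly S g"
  define s where "s = (\<Sum>k\<in>S. (cmod (g k))\<^sup>2) / (2 * pi)"
  have p: "p \<in> sqint torus_measure" unfolding p_def by (rule trig_poly_sqint)
  have fp: "(\<integral>x. f x * cnj (p x) \<partial>torus_measure) = of_real s"
    unfolding p_def pairing_trig_poly[OF S(1) f] g_def[symmetric] s_def
    by (simp add: sum_divide_distrib complex_norm_square mult_ac flip: of_real_power)
  have "(\<integral>x. p x * cnj (f x) \<partial>torus_measure) = (\<integral>x. cnj (f x * cnj (p x)) \<partial>torus_measure)"
    by (simp add: mult.commute)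
  also have "\<dots> = cnj (\<integral>x. f x * cnj (p x) \<partial>torus_measure)" by (rule Bochner_Integration.integral_cnj)
  finally have "(\<integral>x. p x * cnj (f x) \<partial>torus_measure) = cnj (\<integral>x. f x * cnj (p x) \<partial>torus_measure)" .
  then have pf: "(\<integral>x. p x * cnj (f x) \<partial>torus_measure) = of_real s" by (simp add: fp)
  have pp: "(\<integral>x. p x * cnj (p x) \<partial>torus_measure) = of_real s"
    unfolding sq_cmod_pairing p_def trig_poly_norm[OF S] s_def ..
  have "complex_of_real (\<integral>x. (cmod (f x - p x))\<^sup>2 \<partial>torus_measure)
      = (\<integral>x. (f x * cnj (f x) - f x * cnj (p x)) - (p x * cnj (f x) - p x * cnj (p x)) \<partial>torus_measure)"
    unfolding sq_cmod_pairing[symmetric] by (simp add: algebra_simps)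
  also have "\<dots> = ((\<integral>x. f x * cnj (f x) \<partial>torus_measure) - of_real s) - (of_real s - of_real s)"
    unfolding fp[symmetric] using pf pp fp
    by (subst Bochner_Integration.integral_diff Bochner_Integration.integral_diff;
        (intro Bochner_Integration.integrable_diff sqint_mult_integrable sqint_cnj f p)?)+ simp
  also have "\<dots> = complex_of_real ((\<integral>x. (cmod (f x))\<^sup>2 \<partial>torus_measure) - s)"
    unfolding sq_cmod_pairing by simp
  finally have "(\<integral>x. (cmod (f x - p x))\<^sup>2 \<partial>torus_measure) = (\<integral>x. (cmod (f x))\<^sup>2 \<partial>torus_measure) - s"
    by (simp only: of_real_eq_iff)
  moreover have "0 \<le> (\<integral>x. (cmod (f x - p x))\<^sup>2 \<partial>torus_measure)" by simp
  ultimately have "s \<le> (\<integral>x. (cmod (f x))\<^sup>2 \<partial>torus_measure)" by linarith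
  then show ?thesis unfolding s_def g_def by (simp add: field_simps)
qed

definition int_segment :: "nat \<Rightarrow> real set" where
  "int_segment n = {k \<in> \<int>. - real n \<le> k \<and> k \<le> real n}"

lemma int_segment: "finite (int_segment n)" "int_segment n \<subseteq> \<int>"
  "m \<le> n \<Longrightarrow> int_segment m \<subseteq> int_segment n"
  unfolding int_segment_def using finite_int_segment[of "- real n" "real n"] by auto

lemma eventually_in_int_segment:
  assumes "k \<in> \<int>"
  shows "\<forall>\<^sub>F n in sequentially. k \<in> int_segment n"
proof -
  obtain N :: nat where "\<bar>k\<bar> \<le> real N" using real_arch_simple by blast
  then show ?thesis using assms by (intro eventually_sequentiallyI[of N]) (auto simp: int_segment_def)
qed

lemma count_space_partial_sums:
  fixes h :: "real \<Rightarrow> real"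
  assumes "integrable (count_space \<int>) h"
  shows "(\<lambda>n. \<Sum>k\<in>int_segment n. h k) \<longlonglongrightarrow> (\<integral>k. h k \<partial>count_space \<int>)"
proof -
  have "(\<lambda>n. \<integral>k. indicator (int_segment n) k * h k \<partial>count_space \<int>) \<longlonglongrightarrow> (\<integral>k. h k \<partial>count_space \<int>)"
  proof (rule integral_dominated_convergence[where w="\<lambda>k. norm (h k)"])
    show "AE k in count_space \<int>. (\<lambda>n. indicator (int_segment n) k * h k) \<longlonglongrightarrow> h k"
    proof (rule AE_I2)
      fix k :: real assume "k \<in> space (count_space \<int>)"
      then have "\<forall>\<^sub>F n in sequentially. k \<in> int_segment n" by (intro eventually_in_int_segment) simp
      then have "\<forall>\<^sub>F n in sequentially. indicator (int_segment n) k * h k = h k"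
        by eventually_elim simp
      then show "(\<lambda>n. indicator (int_segment n) k * h k) \<longlonglongrightarrow> h k" by (rule tendsto_eventually)
    qed
  qed (use assms in \<open>auto split: split_indicator\<close>)
  moreover have "(\<integral>k. indicator (int_segment n) k * h k \<partial>count_space \<int>) = (\<Sum>k\<in>int_segment n. h k)" for n
  proof -
    have "(\<integral>k. indicator (int_segment n) k * h k \<partial>count_space \<int>) = (\<Sum>k\<in>{k\<in>\<int>. indicator (int_segment n) k * h k \<noteq> 0}. indicator (int_segment n) k * h k)"
      by (rule lebesgue_integral_count_space_finite_support)
         (rule finite_subset[OF _ int_segment(1)[of n]], auto split: split_indicator_asm)
    also have "\<dots> = (\<Sum>k\<in>int_segment n. h k)"
      using int_segment[of n] by (intro sum.mono_neutral_cong_left) (auto split: split_indicator_asm)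
    finally show ?thesis .
  qed
  ultimately show ?thesis by simp
qed

lemma integrable_count_space_bounded_sums:
  fixes h :: "real \<Rightarrow> real"
  assumes nonneg: "\<And>k. h k \<ge> 0" and B: "\<And>n. (\<Sum>k\<in>int_segment n. h k) \<le> B"
  shows "integrable (count_space \<int>) h"
proof -
  have "(\<integral>\<^sup>+k. ennreal (h k) \<partial>count_space \<int>)
      = (\<integral>\<^sup>+k. liminf (\<lambda>n. ennreal (indicator (int_segment n) k * h k)) \<partial>count_space \<int>)"
  proof (rule nn_integral_cong)
    fix k :: real assume "k \<in> space (count_space \<int>)"
    then have "\<forall>\<^sub>F n in sequentially. k \<in> int_segment n" by (intro eventually_in_int_segment) simp
    then have "\<forall>\<^sub>F n in sequentially. ennreal (indicator (int_segment n) k * h k) = ennreal (h k)"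
      by eventually_elim simp
    then have "(\<lambda>n. ennreal (indicator (int_segment n) k * h k)) \<longlonglongrightarrow> ennreal (h k)"
      by (rule tendsto_eventually)
    from lim_imp_Liminf[OF _ this] show "ennreal (h k) = liminf (\<lambda>n. ennreal (indicator (int_segment n) k * h k))"
      by simp
  qed
  also have "\<dots> \<le> liminf (\<lambda>n. \<integral>\<^sup>+k. ennreal (indicator (int_segment n) k * h k) \<partial>count_space \<int>)"
    by (rule nn_integral_liminf) simp
  also have "\<dots> \<le> liminf (\<lambda>n::nat. ennreal B)"
  proof (rule Liminf_mono, rule always_eventually, rule allI)
    fix n
    have "(\<integral>\<^sup>+k. ennreal (indicator (int_segment n) k * h k) \<partial>count_space \<int>)
       = (\<Sum>k\<in>int_segment n. ennreal (indicator (int_segment n) k * h k))"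
      using int_segment[of n] by (intro nn_integral_count_space') auto
    also have "\<dots> = (\<Sum>k\<in>int_segment n. ennreal (h k))"
      by (intro sum.cong) auto
    also have "\<dots> = ennreal (\<Sum>k\<in>int_segment n. h k)"
      by (simp add: sum_ennreal nonneg)
    also have "\<dots> \<le> ennreal B" using B by (rule ennreal_leI)
    finally show "(\<integral>\<^sup>+k. ennreal (indicator (int_segment n) k * h k) \<partial>count_space \<int>) \<le> ennreal B" .
  qed
  also have "\<dots> < \<infinity>" by (simp add: Liminf_const)
  finally show ?thesis using nonneg by (simp add: integrable_iff_bounded)
qed

lemma torus_Riesz_Fischer:
  assumes g: "g \<in> sqint (count_space \<int>)"
  obtains f where "f \<in> sqint torus_measure"
    "\<And>k. k \<in> \<int> \<Longrightarrow> (\<integral>x. cis (- (k * x)) * f x \<partial>torus_measure) = g k"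
    "(\<integral>x. (cmod (f x))\<^sup>2 \<partial>torus_measure) = (\<integral>k. (cmod (g k))\<^sup>2 \<partial>count_space \<int>) / (2 * pi)"
proof -
  define s where "s n = (\<Sum>k\<in>int_segment n. (cmod (g k))\<^sup>2)" for n
  define p where "p n = trig_poly (int_segment n) g" for n
  have p: "p n \<in> sqint torus_measure" for n unfolding p_def by (rule trig_poly_sqint)
  have s: "s \<longlonglongrightarrow> (\<integral>k. (cmod (g k))\<^sup>2 \<partial>count_space \<int>)"
    unfolding s_def using sqint_integrable[OF g] by (rule count_space_partial_sums)
  have diff: "(\<integral>x. (cmod (p m x - p n x))\<^sup>2 \<partial>torus_measure) = (s m - s n) / (2 * pi)" if "n \<le> m" for m n
  proof -
    have "p m x - p n x = trig_poly (int_segment m - int_segment n) g x" for x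
      unfolding p_def trig_poly_def using int_segment(1) int_segment(3)[OF that] by (simp add: sum_diff)
    moreover have "s m - s n = (\<Sum>k\<in>int_segment m - int_segment n. (cmod (g k))\<^sup>2)"
      unfolding s_def using int_segment(1) int_segment(3)[OF that] by (simp add: sum_diff)
    ultimately show ?thesis using trig_poly_norm[of "int_segment m - int_segment n" g] int_segment by auto
  qed
  have absdiff: "(\<integral>x. (cmod (p m x - p n x))\<^sup>2 \<partial>torus_measure) \<le> \<bar>s m - s n\<bar> / (2 * pi)" for m n
  proof (cases "n \<le> m")
    case True
    show ?thesis unfolding diff[OF True] by (intro divide_right_mono) auto
  next
    case False
    then have "n \<ge> m" by simp
    have "(\<integral>x. (cmod (p m x - p n x))\<^sup>2 \<partial>torus_measure) = (s n - s m) / (2 * pi)"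
      unfolding diff[OF \<open>n \<ge> m\<close>, symmetric] by (simp add: norm_minus_commute)
    also have "\<dots> \<le> \<bar>s m - s n\<bar> / (2 * pi)" by (intro divide_right_mono) auto
    finally show ?thesis .
  qed
  have "\<exists>N. \<forall>m\<ge>N. \<forall>n\<ge>N. (\<integral>x. (cmod (p m x - p n x))\<^sup>2 \<partial>torus_measure) < e" if "e > 0" for e
  proof -
    from that have "e * (2 * pi) > 0" by simp
    from CauchyD[OF LIMSEQ_imp_Cauchy[OF s] this] obtain N where
      N: "\<forall>m\<ge>N. \<forall>n\<ge>N. norm (s m - s n) < e * (2 * pi)" by blast
    have "(\<integral>x. (cmod (p m x - p n x))\<^sup>2 \<partial>torus_measure) < e" if mn: "m \<ge> N" "n \<ge> N" for m n
    proof -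
      have "\<bar>s m - s n\<bar> / (2 * pi) < e" using N mn by (simp add: field_simps)
      with absdiff[of m n] show ?thesis by linarith
    qed
    then show ?thesis by (intro exI[of _ N]) simp
  qed
  from sqint_complete[OF p this] obtain f where f: "f \<in> sqint torus_measure" "sq_tendsto torus_measure p f"
    by blast
  have coeff: "(\<integral>x. cis (- (k * x)) * f x \<partial>torus_measure) = g k" if k: "k \<in> \<int>" for k
  proof -
    have c: "(\<lambda>x. cis (- (k * x))) \<in> sqint torus_measure"
      using torus_cis_sqint[of 1 "- k"] by simp
    have "(\<lambda>n. \<integral>x. cis (- (k * x)) * p n x \<partial>torus_measure) \<longlonglongrightarrow> (\<integral>x. cis (- (k * x)) * f x \<partial>torus_measure)"
      by (rule sq_tendsto_pairing[OF c c sq_tendsto_const p f])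
    moreover have "\<forall>\<^sub>F n in sequentially. (\<integral>x. cis (- (k * x)) * p n x \<partial>torus_measure) = g k"
      using eventually_in_int_segment[OF k]
      by eventually_elim (simp add: p_def coeff_trig_poly int_segment k)
    ultimately show ?thesis by (rule LIMSEQ_unique[OF _ tendsto_eventually])
  qed
  have "(\<lambda>n. \<integral>x. (cmod (p n x))\<^sup>2 \<partial>torus_measure) \<longlonglongrightarrow> (\<integral>x. (cmod (f x))\<^sup>2 \<partial>torus_measure)"
    by (rule sq_tendsto_norm[OF p f])
  moreover have "(\<lambda>n. \<integral>x. (cmod (p n x))\<^sup>2 \<partial>torus_measure) \<longlonglongrightarrow> (\<integral>k. (cmod (g k))\<^sup>2 \<partial>count_space \<int>) / (2 * pi)"
    unfolding p_def trig_poly_norm[OF int_segment(1,2)] s_def[symmetric] by (intro tendsto_divide s tendsto_const) simp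
  ultimately have "(\<integral>x. (cmod (f x))\<^sup>2 \<partial>torus_measure) = (\<integral>k. (cmod (g k))\<^sup>2 \<partial>count_space \<int>) / (2 * pi)"
    by (rule LIMSEQ_unique)
  with f(1) coeff show ?thesis by (rule that)
qed

text \<open>By Bessel's inequality the coefficients are square summable, so some function has the same coefficients
  and the right norm; by uniqueness it is \<open>f\<close>.\<close>

lemma torus_Parseval:
  assumes f: "f \<in> sqint torus_measure"
  defines "g \<equiv> \<lambda>k. \<integral>x. cis (- (k * x)) * f x \<partial>torus_measure"
  shows "g \<in> sqint (count_space \<int>)"
    and "(\<integral>x. (cmod (f x))\<^sup>2 \<partial>torus_measure) = (\<integral>k. (cmod (g k))\<^sup>2 \<partial>count_space \<int>) / (2 * pi)"
proof -
  have "integrable (count_space \<int>) (\<lambda>k. (cmod (g k))\<^sup>2)"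
    unfolding g_def
    by (rule integrable_count_space_bounded_sums[OF _ Bessel[OF int_segment(1,2) f]]) simp
  then show g: "g \<in> sqint (count_space \<int>)" by (simp add: sqint_def)
  obtain h where h: "h \<in> sqint torus_measure"
    "\<And>k. k \<in> \<int> \<Longrightarrow> (\<integral>x. cis (- (k * x)) * h x \<partial>torus_measure) = g k"
    "(\<integral>x. (cmod (h x))\<^sup>2 \<partial>torus_measure) = (\<integral>k. (cmod (g k))\<^sup>2 \<partial>count_space \<int>) / (2 * pi)"
    using torus_Riesz_Fischer[OF g] by blast
  have "AE x in torus_measure. f x - h x = 0"
  proof (rule vanishing_coeffs_imp_zero)
    show "integrable torus_measure (\<lambda>x. f x - h x)"
      by (intro Bochner_Integration.integrable_diff torus_sqint_integrable f h)
    fix k :: int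
    have i: "integrable torus_measure (\<lambda>x. cis (of_int k * x) * f x)"
      "integrable torus_measure (\<lambda>x. cis (of_int k * x) * h x)"
      by (intro integrable_cis_mult torus_sqint_integrable f h; measurable)+
    have "(\<integral>x. cis (of_int k * x) * h x \<partial>torus_measure) = (\<integral>x. cis (of_int k * x) * f x \<partial>torus_measure)"
      using h(2)[of "of_int (- k)"] unfolding g_def by simp
    then show "(\<integral>x. cis (of_int k * x) * (f x - h x) \<partial>torus_measure) = 0"
      unfolding right_diff_distrib by (subst Bochner_Integration.integral_diff) (use i in auto)
  qed
  then have "AE x in torus_measure. (cmod (f x))\<^sup>2 = (cmod (h x))\<^sup>2" by eventually_elim simp
  then have "(\<integral>x. (cmod (f x))\<^sup>2 \<partial>torus_measure) = (\<integral>x. (cmod (h x))\<^sup>2 \<partial>torus_measure)"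
    by (intro integral_cong_AE) (use f h in auto)
  then show "(\<integral>x. (cmod (f x))\<^sup>2 \<partial>torus_measure) = (\<integral>k. (cmod (g k))\<^sup>2 \<partial>count_space \<int>) / (2 * pi)"
    using h(3) by simp
qed

text \<open>On the line this rule would send the measurability prover to the restricted space.\<close>

declare id_measurable_torus [measurable del]

section \<open>The Fourier transform on the line\<close>

definition line_ft :: "(real \<Rightarrow> complex) \<Rightarrow> real \<Rightarrow> complex" where
  "line_ft f k = (\<integral>x. cis (- (k * x)) * f x \<partial>lborel)"

lemma sqint_lborel_measurable [measurable_dest]: "f \<in> sqint lborel \<Longrightarrow> f \<in> borel_measurable borel"
  using sqint_measurable[of f lborel] by simp

lemma line_ft_measurable [measurable]:
  assumes [measurable]: "f \<in> borel_measurable borel"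
  shows "line_ft f \<in> borel_measurable borel"
  unfolding line_ft_def[abs_def] by measurable

text \<open>Integrals over the line are integrals over a unit interval of sums over the integers. This transfers
  Parseval's formula to the line.\<close>

lemma nn_integral_periodization:
  fixes \<phi> :: "real \<Rightarrow> ennreal"
  assumes [measurable]: "\<phi> \<in> borel_measurable borel"
  shows "(\<integral>\<^sup>+x. \<phi> x \<partial>lborel)
    = (\<integral>\<^sup>+\<theta>. indicator {0..<1} \<theta> * (\<integral>\<^sup>+k. \<phi> (\<theta> + k) \<partial>count_space \<int>) \<partial>lborel)"
proof -
  have cZ: "countable (\<int> :: real set)" unfolding Ints_def by simp
  have "(\<integral>\<^sup>+\<theta>. indicator {0..<1} \<theta> * (\<integral>\<^sup>+k. \<phi> (\<theta> + k) \<partial>count_space \<int>) \<partial>lborel)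
      = (\<integral>\<^sup>+\<theta>. (\<integral>\<^sup>+k. indicator {0..<1} \<theta> * \<phi> (\<theta> + k) \<partial>count_space \<int>) \<partial>lborel)"
    by (subst nn_integral_cmult) auto
  also have "\<dots> = (\<integral>\<^sup>+k. (\<integral>\<^sup>+\<theta>. indicator {0..<1} \<theta> * \<phi> (\<theta> + k) \<partial>lborel) \<partial>count_space \<int>)"
    by (rule nn_integral_count_space_nn_integral[OF cZ]) measurable
  also have "\<dots> = (\<integral>\<^sup>+k. (\<integral>\<^sup>+x. indicator {k..<k+1} x * \<phi> x \<partial>lborel) \<partial>count_space \<int>)"
  proof (rule nn_integral_cong)
    fix k :: real
    have "(\<integral>\<^sup>+x. indicator {k..<k+1} x * \<phi> x \<partial>lborel)
        = ennreal \<bar>1\<bar> * (\<integral>\<^sup>+x. indicator {k..<k+1} (k + 1 * x) * \<phi> (k + 1 * x) \<partial>lborel)"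
      by (rule nn_integral_real_affine) auto
    also have "\<dots> = (\<integral>\<^sup>+\<theta>. indicator {0..<1} \<theta> * \<phi> (\<theta> + k) \<partial>lborel)"
      by (auto intro!: nn_integral_cong simp: add.commute split: split_indicator)
    finally show "(\<integral>\<^sup>+\<theta>. indicator {0..<1} \<theta> * \<phi> (\<theta> + k) \<partial>lborel) = (\<integral>\<^sup>+x. indicator {k..<k+1} x * \<phi> x \<partial>lborel)"
      by simp
  qed
  also have "\<dots> = (\<integral>\<^sup>+x. (\<integral>\<^sup>+k. indicator {k..<k+1} x * \<phi> x \<partial>count_space \<int>) \<partial>lborel)"
    by (rule nn_integral_count_space_nn_integral[OF cZ, symmetric]) measurable
  also have "\<dots> = (\<integral>\<^sup>+x. \<phi> x \<partial>lborel)"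
  proof (rule nn_integral_cong)
    fix x :: real
    have "(\<integral>\<^sup>+k. indicator {k..<k+1} x * \<phi> x \<partial>count_space \<int>)
        = (\<Sum>k\<in>{of_int \<lfloor>x\<rfloor>}. indicator {k..<k+1} x * \<phi> x)"
    proof (rule nn_integral_count_space')
      fix k :: real assume k: "k \<in> \<int>" "k \<notin> {of_int \<lfloor>x\<rfloor>}"
      have "x \<notin> {k..<k+1}"
      proof
        assume "x \<in> {k..<k+1}"
        moreover obtain j where "k = of_int j" using k(1) by (auto elim: Ints_cases)
        ultimately have "\<lfloor>x\<rfloor> = j" by (intro floor_unique) auto
        with k \<open>k = of_int j\<close> show False by simp
      qed
      then show "indicator {k..<k+1} x * \<phi> x = 0" by simp
    qed auto
    also have "\<dots> = \<phi> x" by (simp add: indicator_def)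
    finally show "(\<integral>\<^sup>+k. indicator {k..<k+1} x * \<phi> x \<partial>count_space \<int>) = \<phi> x" .
  qed
  finally show ?thesis ..
qed

text \<open>The Fourier coefficients of \<open>cis (- \<theta> x) f x\<close> are the values of the transform of \<open>f\<close> at the points
  \<open>\<theta> + k\<close>, and the norm of this function does not depend on \<open>\<theta>\<close>.\<close>

lemma line_Plancherel_one_period:
  assumes f: "f \<in> sqint lborel" and supp: "\<And>x. x \<notin> {0..<2 * pi} \<Longrightarrow> f x = 0"
  shows "(\<integral>\<^sup>+k. ennreal ((cmod (line_ft f k))\<^sup>2) \<partial>lborel) = ennreal (2 * pi * (\<integral>x. (cmod (f x))\<^sup>2 \<partial>lborel))"
proof -
  have [measurable]: "f \<in> borel_measurable borel" using f by (rule sqint_lborel_measurable)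
  define h where "h \<theta> x = cis (- (\<theta> * x)) * f x" for \<theta> x
  have ind: "indicator {0..<2 * pi} x *\<^sub>R (c * f x) = c * f x" for c x
    using supp by (auto split: split_indicator)
  have ind': "indicator {0..<2 * pi} x *\<^sub>R (cmod (f x))\<^sup>2 = (cmod (f x))\<^sup>2" for x
    using supp by (auto split: split_indicator)
  have hnorm: "cmod (h \<theta> x) = cmod (f x)" for \<theta> x by (simp add: h_def norm_mult)
  have hm: "h \<theta> \<in> borel_measurable torus_measure" for \<theta>
    unfolding h_def[abs_def] by (intro borel_measurable_torus) measurable
  have "integrable torus_measure (\<lambda>x. (cmod (h \<theta> x))\<^sup>2)" for \<theta>
    unfolding hnorm using sqint_integrable[OF f]
    by (subst integrable_restrict_space) (simp_all add: ind' del: real_scaleR_def)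
  then have h: "h \<theta> \<in> sqint torus_measure" for \<theta> using hm by (simp add: sqint_def)
  have coeff: "(\<integral>x. cis (- (k * x)) * h \<theta> x \<partial>torus_measure) = line_ft f (\<theta> + k)" for k \<theta>
  proof -
    have "cis (- (k * x)) * h \<theta> x = cis (- ((\<theta> + k) * x)) * f x" for x
      by (simp add: h_def cis_mult algebra_simps flip: mult.assoc)
    then show ?thesis
      unfolding line_ft_def by (subst integral_restrict_space) (simp_all add: ind del: scaleR_conv_of_real)
  qed
  have norm: "(\<integral>x. (cmod (h \<theta> x))\<^sup>2 \<partial>torus_measure) = (\<integral>x. (cmod (f x))\<^sup>2 \<partial>lborel)" for \<theta>
    unfolding hnorm by (subst integral_restrict_space) (simp_all add: ind' del: real_scaleR_def)
  have P: "(\<integral>\<^sup>+k. ennreal ((cmod (line_ft f (\<theta> + k)))\<^sup>2) \<partial>count_space \<int>)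
      = ennreal (2 * pi * (\<integral>x. (cmod (f x))\<^sup>2 \<partial>lborel))" for \<theta>
    using torus_Parseval[OF h[of \<theta>]] sqint_nn_integral[OF torus_Parseval(1)[OF h[of \<theta>]]]
    unfolding coeff norm by simp
  have "(\<integral>\<^sup>+k. ennreal ((cmod (line_ft f k))\<^sup>2) \<partial>lborel)
      = (\<integral>\<^sup>+\<theta>. indicator {0..<1::real} \<theta> * ennreal (2 * pi * (\<integral>x. (cmod (f x))\<^sup>2 \<partial>lborel)) \<partial>lborel)"
    by (subst nn_integral_periodization) (auto simp: P)
  also have "\<dots> = ennreal (2 * pi * (\<integral>x. (cmod (f x))\<^sup>2 \<partial>lborel))"
    by (subst nn_integral_multc) auto
  finally show ?thesis .
qed

text \<open>An affine change of variables moves the support into one period.\<close>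

lemma line_Plancherel_compact_support:
  assumes f: "f \<in> sqint lborel" and supp: "\<And>x. \<bar>x\<bar> > real n \<Longrightarrow> f x = 0"
  shows "line_ft f \<in> sqint lborel"
    and "(\<integral>k. (cmod (line_ft f k))\<^sup>2 \<partial>lborel) = 2 * pi * (\<integral>x. (cmod (f x))\<^sup>2 \<partial>lborel)"
proof -
  have [measurable]: "f \<in> borel_measurable borel" using f by (rule sqint_lborel_measurable)
  \<comment> \<open>The interval \<open>[- L, (2 \<pi> - 1) L)\<close> is the image of one period and contains \<open>[- n, n]\<close>.\<close>
  define L where "L = real n + 1"
  have L: "L > 0" by (simp add: L_def)
  define f1 where "f1 x = f (- L + L * x)" for x
  have f1: "f1 \<in> sqint lborel"
    using lborel_integrable_real_affine[OF sqint_integrable[OF f], of L "- L"] L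
    by (simp add: sqint_def f1_def[abs_def])
  have supp1: "f1 x = 0" if "x \<notin> {0..<2 * pi}" for x
  proof -
    have "x < 0 \<or> x \<ge> 2 * pi" using that by auto
    then have "\<bar>- L + L * x\<bar> \<ge> L"
    proof
      assume "x < 0"
      then have "L * x < 0" using L by (simp add: mult_pos_neg)
      then show ?thesis using L by linarith
    next
      assume "x \<ge> 2 * pi"
      then have "x \<ge> 2" using pi_gt3 by linarith
      then have "L * x \<ge> L * 2" using L by (intro mult_left_mono) auto
      then show ?thesis using L by linarith
    qed
    then show ?thesis unfolding f1_def by (intro supp) (simp add: L_def)
  qed
  have n1: "(\<integral>x. (cmod (f x))\<^sup>2 \<partial>lborel) = L * (\<integral>x. (cmod (f1 x))\<^sup>2 \<partial>lborel)"
    using lborel_integral_real_affine[of L "\<lambda>x. (cmod (f x))\<^sup>2" "- L"] L by (simp add: f1_def)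
  have ft: "line_ft f k = of_real L * cis (L * k) * line_ft f1 (L * k)" for k
  proof -
    have "line_ft f k = \<bar>L\<bar> *\<^sub>R (\<integral>x. cis (- (k * (- L + L * x))) * f (- L + L * x) \<partial>lborel)"
      unfolding line_ft_def using L by (intro lborel_integral_real_affine) simp
    also have "(\<integral>x. cis (- (k * (- L + L * x))) * f (- L + L * x) \<partial>lborel)
        = (\<integral>x. cis (L * k) * (cis (- (L * k * x)) * f1 x) \<partial>lborel)"
      unfolding f1_def mult.assoc[symmetric] cis_mult by (simp add: algebra_simps)
    also have "\<dots> = cis (L * k) * line_ft f1 (L * k)" unfolding line_ft_def by simp
    finally show ?thesis using L by (simp add: scaleR_conv_of_real mult.assoc)
  qed
  have "(\<integral>\<^sup>+k. ennreal ((cmod (line_ft f k))\<^sup>2) \<partial>lborel)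
      = ennreal (L\<^sup>2) * (\<integral>\<^sup>+k. ennreal ((cmod (line_ft f1 (0 + L * k)))\<^sup>2) \<partial>lborel)"
    unfolding ft using f1
    by (subst nn_integral_cmult[symmetric]) (auto simp: norm_mult power_mult_distrib ennreal_mult)
  also have "\<dots> = ennreal L * (ennreal \<bar>L\<bar> * (\<integral>\<^sup>+k. ennreal ((cmod (line_ft f1 (0 + L * k)))\<^sup>2) \<partial>lborel))"
    using L by (simp add: power2_eq_square ennreal_mult mult.assoc)
  also have "\<dots> = ennreal L * (\<integral>\<^sup>+k. ennreal ((cmod (line_ft f1 k))\<^sup>2) \<partial>lborel)"
    using L f1 by (subst nn_integral_real_affine[where c=L and t=0]) auto
  also have "\<dots> = ennreal (2 * pi * (\<integral>x. (cmod (f x))\<^sup>2 \<partial>lborel))"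
  proof -
    have "(\<integral>\<^sup>+k. ennreal ((cmod (line_ft f1 k))\<^sup>2) \<partial>lborel) = ennreal (2 * pi * (\<integral>x. (cmod (f1 x))\<^sup>2 \<partial>lborel))"
      by (rule line_Plancherel_one_period[OF f1 supp1])
    then show ?thesis unfolding n1 using L by (simp add: ennreal_mult[symmetric] mult_ac)
  qed
  finally have nn: "(\<integral>\<^sup>+k. ennreal ((cmod (line_ft f k))\<^sup>2) \<partial>lborel) = ennreal (2 * pi * (\<integral>x. (cmod (f x))\<^sup>2 \<partial>lborel))" .
  show s: "line_ft f \<in> sqint lborel"
    by (rule sqintI_nn) (simp_all add: nn)
  show "(\<integral>k. (cmod (line_ft f k))\<^sup>2 \<partial>lborel) = 2 * pi * (\<integral>x. (cmod (f x))\<^sup>2 \<partial>lborel)"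
    using nn unfolding sqint_nn_integral[OF s] by (subst (asm) ennreal_inj) auto
qed

subsection \<open>Truncations\<close>

text \<open>The truncations in the definition of the Fourier transform on the line.\<close>

definition truncated :: "nat \<Rightarrow> (real \<Rightarrow> complex) \<Rightarrow> real \<Rightarrow> complex" where
  "truncated n f x = indicator {- real n..real n} x * f x"

lemma truncated_supp: "\<bar>x\<bar> > real n \<Longrightarrow> truncated n f x = 0"
  by (auto simp: truncated_def split: split_indicator)

lemma truncated_sqint:
  assumes "f \<in> sqint M" "sets M = sets borel"
  shows "truncated n f \<in> sqint M"
  unfolding truncated_def[abs_def]
proof (rule sqint_bounded_mult[OF assms(1), where C=1])
  show "(\<lambda>x. indicator {- real n..real n} x) \<in> borel_measurable M"
    using assms(2) by (intro borel_measurable_indicator) auto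
qed (auto split: split_indicator)

lemma truncated_sq_tendsto:
  assumes f: "f \<in> sqint lborel"
  shows "sq_tendsto lborel (\<lambda>n. truncated n f) f"
  unfolding sq_tendsto_def
proof -
  have [measurable]: "f \<in> borel_measurable borel" using f by (rule sqint_lborel_measurable)
  have "(\<lambda>n. \<integral>x. (cmod (truncated n f x - f x))\<^sup>2 \<partial>lborel) \<longlonglongrightarrow> (\<integral>x. 0 \<partial>(lborel :: real measure))"
  proof (rule integral_dominated_convergence[where w="\<lambda>x. (cmod (f x))\<^sup>2"])
    show "AE x in lborel. (\<lambda>n. (cmod (truncated n f x - f x))\<^sup>2) \<longlonglongrightarrow> 0"
    proof (rule AE_I2)
      fix x :: real
      obtain N :: nat where N: "\<bar>x\<bar> \<le> real N" using real_arch_simple by blast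
      have "\<forall>\<^sub>F n in sequentially. (cmod (truncated n f x - f x))\<^sup>2 = 0"
      proof (rule eventually_sequentiallyI[of N])
        fix n assume "n \<ge> N"
        then have "x \<in> {- real n..real n}" using N by (auto simp: abs_le_iff)
        then show "(cmod (truncated n f x - f x))\<^sup>2 = 0" by (simp add: truncated_def)
      qed
      then show "(\<lambda>n. (cmod (truncated n f x - f x))\<^sup>2) \<longlonglongrightarrow> 0" by (rule tendsto_eventually)
    qed
    show "AE x in lborel. norm ((cmod (truncated n f x - f x))\<^sup>2) \<le> (cmod (f x))\<^sup>2" for n
      by (rule AE_I2) (simp add: truncated_def split: split_indicator)
    show "integrable lborel (\<lambda>x. (cmod (f x))\<^sup>2)" by (rule sqint_integrable[OF f])
    show "(\<lambda>x. (cmod (truncated n f x - f x))\<^sup>2) \<in> borel_measurable lborel" for n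
      unfolding truncated_def by measurable
  qed simp
  then show "(\<lambda>n. \<integral>x. (cmod (truncated n f x - f x))\<^sup>2 \<partial>lborel) \<longlonglongrightarrow> 0" by simp
qed

lemma indicator_sqint: "(\<lambda>x. indicator {a..b::real} x :: complex) \<in> sqint lborel"
proof -
  have "integrable lborel (\<lambda>x. indicator {a..b} x *\<^sub>R (1::real))"
    by (intro integrable_indicator) (auto simp: emeasure_lborel_Icc_eq)
  then show ?thesis
    by (intro sqint_bound[where h="\<lambda>x. indicator {a..b} x *\<^sub>R 1"]) (auto split: split_indicator)
qed

lemma truncated_integrable: "f \<in> sqint lborel \<Longrightarrow> integrable lborel (truncated n f)"
  unfolding truncated_def[abs_def] by (intro sqint_mult_integrable indicator_sqint)

lemma line_ft_diff:
  assumes "integrable lborel f" "integrable lborel g"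
  shows "line_ft (\<lambda>x. f x - g x) k = line_ft f k - line_ft g k"
  unfolding line_ft_def right_diff_distrib
  by (intro Bochner_Integration.integral_diff integrable_cis_mult assms) auto

lemma line_ft_truncated_diff:
  assumes f: "f \<in> sqint lborel"
  shows "(\<integral>k. (cmod (line_ft (truncated m f) k - line_ft (truncated n f) k))\<^sup>2 \<partial>lborel)
     = 2 * pi * (\<integral>x. (cmod (truncated m f x - truncated n f x))\<^sup>2 \<partial>lborel)"
proof -
  have "line_ft (truncated m f) k - line_ft (truncated n f) k = line_ft (\<lambda>x. truncated m f x - truncated n f x) k" for k
    by (intro line_ft_diff[symmetric] truncated_integrable f)
  moreover have "(\<lambda>x. truncated m f x - truncated n f x) \<in> sqint lborel"
    by (intro sqint_diff truncated_sqint f) auto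
  moreover have "\<bar>x\<bar> > real (max m n) \<Longrightarrow> truncated m f x - truncated n f x = 0" for x
    by (simp add: truncated_supp)
  ultimately show ?thesis
    using line_Plancherel_compact_support(2)[of "\<lambda>x. truncated m f x - truncated n f x" "max m n"] by simp
qed

lemma line_ft_truncated_sqint: "f \<in> sqint lborel \<Longrightarrow> line_ft (truncated n f) \<in> sqint lborel"
  by (rule line_Plancherel_compact_support(1)[where n=n]) (auto intro: truncated_sqint truncated_supp)

text \<open>The transforms of the truncations form a Cauchy sequence, because Plancherel's formula turns their
  distances into distances of truncations.\<close>

lemma line_ft_limit:
  assumes f: "f \<in> sqint lborel"
  obtains g where "g \<in> sqint lborel" "sq_tendsto lborel (\<lambda>n. line_ft (truncated n f)) g"
proof -
  note cs = truncated_sqint[OF f, simplified]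
  define a where "a n = (\<integral>x. (cmod (truncated n f x - f x))\<^sup>2 \<partial>lborel)" for n
  have a: "a \<longlonglongrightarrow> 0" using truncated_sq_tendsto[OF f] unfolding sq_tendsto_def a_def .
  have le: "(\<integral>k. (cmod (line_ft (truncated m f) k - line_ft (truncated n f) k))\<^sup>2 \<partial>lborel) \<le> 4 * pi * (a m + a n)" for m n
  proof -
    have "(cmod (truncated m f x - truncated n f x))\<^sup>2 \<le> 2 * (cmod (truncated m f x - f x))\<^sup>2 + 2 * (cmod (truncated n f x - f x))\<^sup>2" for x
      using cmod_add_sq[of "truncated m f x - f x" "f x - truncated n f x"] by (simp add: norm_minus_commute)
    then have "(\<integral>x. (cmod (truncated m f x - truncated n f x))\<^sup>2 \<partial>lborel)
        \<le> (\<integral>x. 2 * (cmod (truncated m f x - f x))\<^sup>2 + 2 * (cmod (truncated n f x - f x))\<^sup>2 \<partial>lborel)"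
      by (intro integral_mono Bochner_Integration.integrable_add integrable_mult_right sqint_integrable sqint_diff cs f)
    also have "\<dots> = 2 * a m + 2 * a n"
      unfolding a_def
      by (subst Bochner_Integration.integral_add) (auto intro!: sqint_integrable sqint_diff cs f)
    finally have "2 * pi * (\<integral>x. (cmod (truncated m f x - truncated n f x))\<^sup>2 \<partial>lborel) \<le> 2 * pi * (2 * a m + 2 * a n)"
      by (intro mult_left_mono) auto
    then show ?thesis unfolding line_ft_truncated_diff[OF f] by (simp add: algebra_simps)
  qed
  have "\<exists>N. \<forall>m\<ge>N. \<forall>n\<ge>N. (\<integral>k. (cmod (line_ft (truncated m f) k - line_ft (truncated n f) k))\<^sup>2 \<partial>lborel) < e" if "e > 0" for e
  proof -
    have "e / (8 * pi) > 0" using that by simp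
    from LIMSEQ_D[OF a this] obtain N where N: "\<And>n. n \<ge> N \<Longrightarrow> \<bar>a n\<bar> < e / (8 * pi)"
      unfolding real_norm_def diff_zero by blast
    have "(\<integral>k. (cmod (line_ft (truncated m f) k - line_ft (truncated n f) k))\<^sup>2 \<partial>lborel) < e" if mn: "m \<ge> N" "n \<ge> N" for m n
    proof -
      have "a m + a n < 2 * (e / (8 * pi))" using N[OF mn(1)] N[OF mn(2)] by linarith
      then have "4 * pi * (a m + a n) < 4 * pi * (2 * (e / (8 * pi)))"
        by (intro mult_strict_left_mono) auto
      also have "\<dots> = e" by simp
      finally show ?thesis using le[of m n] by linarith
    qed
    then show ?thesis by (intro exI[of _ N]) simp
  qed
  from sqint_complete[OF line_ft_truncated_sqint[OF f] this] that show ?thesis by blast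
qed

lemma line_ft_multiplication:
  assumes f: "integrable lborel f" and g: "integrable lborel g"
  shows "(\<integral>k. line_ft f k * g k \<partial>lborel) = (\<integral>x. f x * line_ft g x \<partial>lborel)"
proof -
  have [measurable]: "f \<in> borel_measurable borel" "g \<in> borel_measurable borel"
    using f g by auto
  have int: "integrable (lborel \<Otimes>\<^sub>M lborel) (\<lambda>(x, k). cis (- (k * x)) * f x * g k)"
  proof (rule lborel_pair.Fubini_integrable)
    show "integrable lborel (\<lambda>x. \<integral>k. norm (case (x, k) of (x, k) \<Rightarrow> cis (- (k * x)) * f x * g k) \<partial>lborel)"
      using integrable_norm[OF f] by (simp add: norm_mult)
    have "integrable lborel (\<lambda>k. cis (- (k * x)) * (f x * g k))" for x
      using g by (intro integrable_cis_mult) auto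
    then show "AE x in lborel. integrable lborel (\<lambda>k. case (x, k) of (x, k) \<Rightarrow> cis (- (k * x)) * f x * g k)"
      by (simp add: mult.assoc)
  qed measurable
  have "(\<integral>k. line_ft f k * g k \<partial>lborel) = (\<integral>k. (\<integral>x. cis (- (k * x)) * f x * g k \<partial>lborel) \<partial>lborel)"
    unfolding line_ft_def by simp
  also have "\<dots> = (\<integral>x. (\<integral>k. cis (- (k * x)) * f x * g k \<partial>lborel) \<partial>lborel)"
    using lborel_pair.Fubini_integral[OF int] by simp
  also have "\<dots> = (\<integral>x. (\<integral>k. f x * (cis (- (x * k)) * g k) \<partial>lborel) \<partial>lborel)"
    by (simp add: mult_ac)
  also have "\<dots> = (\<integral>x. f x * line_ft g x \<partial>lborel)"
    unfolding line_ft_def by simp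
  finally show ?thesis .
qed

section \<open>The Fourier transform of scalar functions\<close>

abbreviation \<mu> :: "base \<Rightarrow> real measure" where "\<mu> \<equiv> base_measure"

abbreviation \<nu> :: "base \<Rightarrow> real measure" where "\<nu> \<equiv> freq_measure"

definition partial_ft :: "base \<Rightarrow> nat \<Rightarrow> (real \<Rightarrow> complex) \<Rightarrow> real \<Rightarrow> complex" where
  "partial_ft X n f k = (\<integral>x. cis (- (k * x)) * truncated n f x \<partial>\<mu> X)"

text \<open>The scalar counterpart of \<^const>\<open>has_fourier\<close>, phrased with Bochner integrals in place of
  nonnegative integrals.\<close>

definition has_ft :: "base \<Rightarrow> (real \<Rightarrow> complex) \<Rightarrow> (real \<Rightarrow> complex) \<Rightarrow> bool" where
  "has_ft X f g \<longleftrightarrow> f \<in> sqint (\<mu> X) \<and> g \<in> sqint (\<nu> X) \<and>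
     sq_tendsto (\<nu> X) (\<lambda>n. partial_ft X n f) g"

lemma has_ft_sqint: "has_ft X f g \<Longrightarrow> f \<in> sqint (\<mu> X)" "has_ft X f g \<Longrightarrow> g \<in> sqint (\<nu> X)"
  by (auto simp: has_ft_def)

lemma partial_ft_Line: "partial_ft Line n f = line_ft (truncated n f)"
  by (simp add: fun_eq_iff partial_ft_def line_ft_def)

lemma borel_measurable_base: "f \<in> borel_measurable borel \<Longrightarrow> f \<in> borel_measurable (\<mu> X)"
  by (cases X) (simp_all add: borel_measurable_torus)

lemma truncated_sqint_base:
  assumes "f \<in> sqint (\<mu> X)"
  shows "truncated n f \<in> sqint (\<mu> X)"
  unfolding truncated_def[abs_def]
  by (rule sqint_bounded_mult[OF assms borel_measurable_base, where C=1]) (auto split: split_indicator)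

lemma truncated_integrable_base:
  assumes "f \<in> sqint (\<mu> X)"
  shows "integrable (\<mu> X) (truncated n f)"
  using assms
proof (cases X)
  case Line
  then show ?thesis using assms truncated_integrable by simp
next
  case Torus
  then show ?thesis using torus_sqint_integrable truncated_sqint_base[OF assms] by simp
qed

lemma integrable_cis_base:
  "integrable (\<mu> X) f \<Longrightarrow> integrable (\<mu> X) (\<lambda>x. cis (- (k * x)) * f x)"
  by (intro integrable_cis_mult borel_measurable_base) measurable

lemma partial_ft_sqint:
  assumes "f \<in> sqint (\<mu> X)"
  shows "partial_ft X n f \<in> sqint (\<nu> X)"
proof (cases X)
  case Line
  then show ?thesis using assms line_ft_truncated_sqint by (simp add: partial_ft_Line)
next
  case Torus
  then show ?thesis
    using torus_Parseval(1)[of "truncated n f"] truncated_sqint_base[OF assms] by (simp add: partial_ft_def[abs_def])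
qed

text \<open>Since \<open>2 \<pi> < 8\<close>, the truncation at \<open>n \<ge> 8\<close> has no effect on the fundamental domain.\<close>

lemma partial_ft_Torus:
  assumes "n \<ge> 8"
  shows "partial_ft Torus n f k = (\<integral>x. cis (- (k * x)) * f x \<partial>torus_measure)"
proof -
  have "truncated n f x = f x" if "x \<in> space torus_measure" for x
  proof -
    have "0 \<le> x" "x < 8" using that pi_less_4 by (auto simp: space_restrict_space)
    moreover have "real n \<ge> 8" using assms by simp
    ultimately show ?thesis by (simp add: truncated_def)
  qed
  then show ?thesis unfolding partial_ft_def
    by (intro Bochner_Integration.integral_cong) auto
qed

lemma has_ft_Torus:
  assumes "f \<in> sqint torus_measure"
  shows "has_ft Torus f (\<lambda>k. \<integral>x. cis (- (k * x)) * f x \<partial>torus_measure)"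
proof -
  let ?g = "\<lambda>k. \<integral>x. cis (- (k * x)) * f x \<partial>torus_measure"
  have "\<forall>\<^sub>F n in sequentially. (\<integral>k. (cmod (partial_ft Torus n f k - ?g k))\<^sup>2 \<partial>count_space \<int>) = 0"
    by (rule eventually_sequentiallyI[of 8]) (simp add: partial_ft_Torus)
  then have "sq_tendsto (count_space \<int>) (\<lambda>n. partial_ft Torus n f) ?g"
    unfolding sq_tendsto_def by (rule tendsto_eventually)
  then show ?thesis using assms torus_Parseval(1)[OF assms] by (simp add: has_ft_def)
qed

lemma has_ft_exists:
  assumes "f \<in> sqint (\<mu> X)"
  obtains g where "has_ft X f g"
proof (cases X)
  case Line
  then show ?thesis using assms line_ft_limit[of f] that by (auto simp: has_ft_def partial_ft_Line)
next
  case Torus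
  then show ?thesis using assms has_ft_Torus[of f] that by auto
qed

lemma has_ft_unique:
  assumes "has_ft X f g" "has_ft X f h"
  shows "AE k in \<nu> X. g k = h k"
  using assms unfolding has_ft_def by (intro sq_tendsto_unique[where f="\<lambda>n. partial_ft X n f"]) (auto intro: partial_ft_sqint)

lemma partial_ft_cong_AE:
  assumes "f \<in> sqint (\<mu> X)" "f' \<in> sqint (\<mu> X)" "AE x in \<mu> X. f x = f' x"
  shows "partial_ft X n f k = partial_ft X n f' k"
  unfolding partial_ft_def
proof (rule integral_cong_AE)
  show "(\<lambda>x. cis (- (k * x)) * truncated n f x) \<in> borel_measurable (\<mu> X)"
    "(\<lambda>x. cis (- (k * x)) * truncated n f' x) \<in> borel_measurable (\<mu> X)"
    by (intro borel_measurable_integrable integrable_cis_base truncated_integrable_base assms)+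
  show "AE x in \<mu> X. cis (- (k * x)) * truncated n f x = cis (- (k * x)) * truncated n f' x"
    using assms(3) by eventually_elim (simp add: truncated_def)
qed

lemma sq_tendsto_cong_AE:
  assumes "\<And>n. f n \<in> sqint M" "g \<in> sqint M" "g' \<in> sqint M" "AE x in M. g x = g' x" "sq_tendsto M f g"
  shows "sq_tendsto M f g'"
proof -
  have "(\<integral>x. (cmod (f n x - g x))\<^sup>2 \<partial>M) = (\<integral>x. (cmod (f n x - g' x))\<^sup>2 \<partial>M)" for n
  proof (rule integral_cong_AE)
    show "(\<lambda>x. (cmod (f n x - g x))\<^sup>2) \<in> borel_measurable M" "(\<lambda>x. (cmod (f n x - g' x))\<^sup>2) \<in> borel_measurable M"
      by (intro borel_measurable_integrable sqint_integrable sqint_diff assms)+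
    show "AE x in M. (cmod (f n x - g x))\<^sup>2 = (cmod (f n x - g' x))\<^sup>2"
      using assms(4) by eventually_elim simp
  qed
  with assms(5) show ?thesis by (simp add: sq_tendsto_def)
qed

lemma has_ft_cong_AE:
  assumes "has_ft X f g" "f' \<in> borel_measurable (\<mu> X)" "AE x in \<mu> X. f x = f' x"
    "g' \<in> borel_measurable (\<nu> X)" "AE k in \<nu> X. g k = g' k"
  shows "has_ft X f' g'"
proof -
  note fg = has_ft_sqint[OF assms(1)]
  have f': "f' \<in> sqint (\<mu> X)" by (rule sqint_cong_AE[OF fg(1) assms(2,3)])
  have g': "g' \<in> sqint (\<nu> X)" by (rule sqint_cong_AE[OF fg(2) assms(4,5)])
  have "sq_tendsto (\<nu> X) (\<lambda>n. partial_ft X n f) g'"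
    using assms(1) by (intro sq_tendsto_cong_AE[OF partial_ft_sqint[OF fg(1)] fg(2) g' assms(5)]) (simp add: has_ft_def)
  moreover have "partial_ft X n f = partial_ft X n f'" for n
    using partial_ft_cong_AE[OF fg(1) f' assms(3)] by (simp add: fun_eq_iff)
  ultimately show ?thesis using f' g' by (simp add: has_ft_def)
qed

lemma sq_tendsto_add:
  assumes "\<And>n. f n \<in> sqint M" "F \<in> sqint M" "sq_tendsto M f F"
    and "\<And>n. g n \<in> sqint M" "G \<in> sqint M" "sq_tendsto M g G"
  shows "sq_tendsto M (\<lambda>n x. f n x + g n x) (\<lambda>x. F x + G x)"
  unfolding sq_tendsto_def
proof (rule tendsto_sandwich[OF always_eventually _ tendsto_const])
  show "(\<lambda>n. 2 * (\<integral>x. (cmod (f n x - F x))\<^sup>2 \<partial>M) + 2 * (\<integral>x. (cmod (g n x - G x))\<^sup>2 \<partial>M)) \<longlonglongrightarrow> 0"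
    using assms(3,6) unfolding sq_tendsto_def by (auto intro!: tendsto_eq_intros)
  have "(\<integral>x. (cmod (f n x + g n x - (F x + G x)))\<^sup>2 \<partial>M)
     \<le> 2 * (\<integral>x. (cmod (f n x - F x))\<^sup>2 \<partial>M) + 2 * (\<integral>x. (cmod (g n x - G x))\<^sup>2 \<partial>M)" for n
  proof -
    have eq: "f n x + g n x - (F x + G x) = (f n x - F x) + (g n x - G x)" for x by simp
    have "(\<integral>x. (cmod (f n x + g n x - (F x + G x)))\<^sup>2 \<partial>M)
       \<le> (\<integral>x. 2 * (cmod (f n x - F x))\<^sup>2 + 2 * (cmod (g n x - G x))\<^sup>2 \<partial>M)"
      unfolding eq
      by (intro integral_mono cmod_add_sq Bochner_Integration.integrable_add integrable_mult_right
            sqint_integrable sqint_diff sqint_add assms)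
    also have "\<dots> = 2 * (\<integral>x. (cmod (f n x - F x))\<^sup>2 \<partial>M) + 2 * (\<integral>x. (cmod (g n x - G x))\<^sup>2 \<partial>M)"
      by (subst Bochner_Integration.integral_add) (auto intro!: sqint_integrable sqint_diff assms)
    finally show ?thesis .
  qed
  then show "\<forall>\<^sub>F n in sequentially. (\<integral>x. (cmod (f n x + g n x - (F x + G x)))\<^sup>2 \<partial>M)
     \<le> 2 * (\<integral>x. (cmod (f n x - F x))\<^sup>2 \<partial>M) + 2 * (\<integral>x. (cmod (g n x - G x))\<^sup>2 \<partial>M)"
    by (intro always_eventually) simp
qed simp

lemma sq_tendsto_cmult: "sq_tendsto M f F \<Longrightarrow> sq_tendsto M (\<lambda>n x. c * f n x) (\<lambda>x. c * F x)"
  unfolding sq_tendsto_def right_diff_distrib[symmetric] norm_mult power_mult_distrib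
  using tendsto_mult_right_zero[of _ _ "(cmod c)\<^sup>2"] by simp

lemma has_ft_add:
  assumes "has_ft X f F" "has_ft X g G"
  shows "has_ft X (\<lambda>x. f x + g x) (\<lambda>k. F k + G k)"
proof -
  note s = has_ft_sqint[OF assms(1)] has_ft_sqint[OF assms(2)]
  have "partial_ft X n (\<lambda>x. f x + g x) = (\<lambda>k. partial_ft X n f k + partial_ft X n g k)" for n
  proof
    fix k
    have "partial_ft X n (\<lambda>x. f x + g x) k
        = (\<integral>x. cis (- (k * x)) * truncated n f x + cis (- (k * x)) * truncated n g x \<partial>\<mu> X)"
      unfolding partial_ft_def by (simp add: truncated_def algebra_simps)
    also have "\<dots> = partial_ft X n f k + partial_ft X n g k"
      unfolding partial_ft_def
      by (intro Bochner_Integration.integral_add integrable_cis_base truncated_integrable_base s)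
    finally show "partial_ft X n (\<lambda>x. f x + g x) k = partial_ft X n f k + partial_ft X n g k" .
  qed
  moreover have "sq_tendsto (\<nu> X) (\<lambda>n k. partial_ft X n f k + partial_ft X n g k) (\<lambda>k. F k + G k)"
    using assms by (intro sq_tendsto_add partial_ft_sqint s) (auto simp: has_ft_def)
  ultimately show ?thesis using s by (simp add: has_ft_def sqint_add)
qed

lemma has_ft_cmult:
  assumes "has_ft X f F"
  shows "has_ft X (\<lambda>x. c * f x) (\<lambda>k. c * F k)"
proof -
  have "partial_ft X n (\<lambda>x. c * f x) = (\<lambda>k. c * partial_ft X n f k)" for n
  proof
    fix k
    have eq: "cis (- (k * x)) * truncated n (\<lambda>x. c * f x) x = c * (cis (- (k * x)) * truncated n f x)" for x
      by (simp add: truncated_def)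
    show "partial_ft X n (\<lambda>x. c * f x) k = c * partial_ft X n f k"
      unfolding partial_ft_def eq by (rule integral_mult_right_zero)
  qed
  then show ?thesis using assms sq_tendsto_cmult[of "\<nu> X"] by (simp add: has_ft_def sqint_cmult)
qed

lemma has_ft_diff: "has_ft X f F \<Longrightarrow> has_ft X g G \<Longrightarrow> has_ft X (\<lambda>x. f x - g x) (\<lambda>k. F k - G k)"
  using has_ft_add[of X f F "\<lambda>x. (-1) * g x" "\<lambda>k. (-1) * G k"] has_ft_cmult[of X g G "-1"] by simp

lemma has_ft_zero: "has_ft X (\<lambda>x. 0) (\<lambda>k. 0)"
  by (simp add: has_ft_def partial_ft_def truncated_def sq_tendsto_def)

lemma has_ft_norm:
  assumes "has_ft X f F"
  shows "(\<integral>x. (cmod (f x))\<^sup>2 \<partial>\<mu> X) = (\<integral>k. (cmod (F k))\<^sup>2 \<partial>\<nu> X) / (2 * pi)"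
proof (cases X)
  case Line
  then have f: "f \<in> sqint lborel" and F: "F \<in> sqint lborel" "sq_tendsto lborel (\<lambda>n. line_ft (truncated n f)) F"
    using assms by (auto simp: has_ft_def partial_ft_Line)
  have "(\<lambda>n. \<integral>k. (cmod (line_ft (truncated n f) k))\<^sup>2 \<partial>lborel) \<longlonglongrightarrow> (\<integral>k. (cmod (F k))\<^sup>2 \<partial>lborel)"
    by (rule sq_tendsto_norm[OF line_ft_truncated_sqint[OF f] F])
  moreover have "(\<integral>k. (cmod (line_ft (truncated n f) k))\<^sup>2 \<partial>lborel) = 2 * pi * (\<integral>x. (cmod (truncated n f x))\<^sup>2 \<partial>lborel)" for n
    by (rule line_Plancherel_compact_support(2)[where n=n]) (auto intro: truncated_sqint f truncated_supp)
  moreover have "(\<lambda>n. 2 * pi * (\<integral>x. (cmod (truncated n f x))\<^sup>2 \<partial>lborel)) \<longlonglongrightarrow> 2 * pi * (\<integral>x. (cmod (f x))\<^sup>2 \<partial>lborel)"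
    by (intro tendsto_mult_left sq_tendsto_norm truncated_sq_tendsto f truncated_sqint) simp
  ultimately have "(\<integral>k. (cmod (F k))\<^sup>2 \<partial>lborel) = 2 * pi * (\<integral>x. (cmod (f x))\<^sup>2 \<partial>lborel)"
    by (simp only:) (rule LIMSEQ_unique)
  then show ?thesis using Line by simp
next
  case Torus
  then have f: "f \<in> sqint torus_measure" using assms by (auto simp: has_ft_def)
  let ?g = "\<lambda>k. \<integral>x. cis (- (k * x)) * f x \<partial>torus_measure"
  have "AE k in \<nu> X. F k = ?g k"
    using has_ft_unique[OF assms] has_ft_Torus[OF f] Torus by simp
  then have "AE k in \<nu> X. (cmod (F k))\<^sup>2 = (cmod (?g k))\<^sup>2" by eventually_elim simp
  then have "(\<integral>k. (cmod (F k))\<^sup>2 \<partial>\<nu> X) = (\<integral>k. (cmod (?g k))\<^sup>2 \<partial>\<nu> X)"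
    by (intro integral_cong_AE) (simp_all add: Torus)
  then show ?thesis using torus_Parseval(2)[OF f] Torus by simp
qed

lemma complex_polarization:
  "4 * (a * cnj b) = of_real ((cmod (a + b))\<^sup>2) - of_real ((cmod (a + (-1) * b))\<^sup>2)
     + \<i> * of_real ((cmod (a + \<i> * b))\<^sup>2) - \<i> * of_real ((cmod (a + (- \<i>) * b))\<^sup>2)"
  unfolding complex_norm_square by (simp add: algebra_simps)

lemma pairing_polarization:
  assumes f: "f \<in> sqint M" and g: "g \<in> sqint M"
  shows "4 * (\<integral>x. f x * cnj (g x) \<partial>M) = of_real (\<integral>x. (cmod (f x + g x))\<^sup>2 \<partial>M)
     - of_real (\<integral>x. (cmod (f x + (-1) * g x))\<^sup>2 \<partial>M)
     + \<i> * of_real (\<integral>x. (cmod (f x + \<i> * g x))\<^sup>2 \<partial>M) - \<i> * of_real (\<integral>x. (cmod (f x + (- \<i>) * g x))\<^sup>2 \<partial>M)"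
proof -
  have i: "integrable M (\<lambda>x. complex_of_real ((cmod (f x + c * g x))\<^sup>2))" for c
    by (intro integrable_of_real sqint_integrable sqint_add sqint_cmult f g)
  have i1: "integrable M (\<lambda>x. complex_of_real ((cmod (f x + g x))\<^sup>2))"
    by (intro integrable_of_real sqint_integrable sqint_add f g)
  have "4 * (\<integral>x. f x * cnj (g x) \<partial>M) = (\<integral>x. 4 * (f x * cnj (g x)) \<partial>M)"
    by (rule integral_mult_right_zero[symmetric])
  also have "\<dots> = (\<integral>x. of_real ((cmod (f x + g x))\<^sup>2) - of_real ((cmod (f x + (-1) * g x))\<^sup>2)
     + \<i> * of_real ((cmod (f x + \<i> * g x))\<^sup>2) - \<i> * of_real ((cmod (f x + (- \<i>) * g x))\<^sup>2) \<partial>M)"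
    by (intro Bochner_Integration.integral_cong refl complex_polarization)
  also have "\<dots> = (\<integral>x. of_real ((cmod (f x + g x))\<^sup>2) \<partial>M) - (\<integral>x. of_real ((cmod (f x + (-1) * g x))\<^sup>2) \<partial>M)
     + (\<integral>x. \<i> * of_real ((cmod (f x + \<i> * g x))\<^sup>2) \<partial>M) - (\<integral>x. \<i> * of_real ((cmod (f x + (- \<i>) * g x))\<^sup>2) \<partial>M)"
    by (simp only: Bochner_Integration.integral_diff Bochner_Integration.integral_add
          Bochner_Integration.integrable_diff Bochner_Integration.integrable_add integrable_mult_right i i1)
  finally show ?thesis
    by (simp only: integral_complex_of_real integral_mult_right_zero)
qed

text \<open>Polarisation of \<open>has_ft_norm\<close>.\<close>

lemma has_ft_pairing_cnj:
  assumes "has_ft X f F" "has_ft X g G"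
  shows "(\<integral>x. f x * cnj (g x) \<partial>\<mu> X) = (\<integral>k. F k * cnj (G k) \<partial>\<nu> X) / (2 * pi)"
proof -
  note s = has_ft_sqint[OF assms(1)] has_ft_sqint[OF assms(2)]
  have n: "(\<integral>x. (cmod (f x + c * g x))\<^sup>2 \<partial>\<mu> X)
     = (\<integral>k. (cmod (F k + c * G k))\<^sup>2 \<partial>\<nu> X) / (2 * pi)" for c
    by (intro has_ft_norm has_ft_add has_ft_cmult assms)
  have n1: "(\<integral>x. (cmod (f x + g x))\<^sup>2 \<partial>\<mu> X)
     = (\<integral>k. (cmod (F k + G k))\<^sup>2 \<partial>\<nu> X) / (2 * pi)"
    by (intro has_ft_norm has_ft_add assms)
  have "4 * (\<integral>x. f x * cnj (g x) \<partial>\<mu> X) = (4 * (\<integral>k. F k * cnj (G k) \<partial>\<nu> X)) / (2 * pi)"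
    unfolding pairing_polarization[OF s(1,3)] pairing_polarization[OF s(2,4)] n n1
    by (simp add: diff_divide_distrib add_divide_distrib)
  then show ?thesis by (simp add: field_simps)
qed

subsection \<open>Symmetries\<close>

text \<open>Frequencies live on the whole line or on the integers, and their measure is invariant under
  the translations and the reflection that preserve this set.\<close>

lemma freq_shift:
  assumes "l \<in> space (\<nu> X)"
  shows "(\<lambda>k. k - l) \<in> \<nu> X \<rightarrow>\<^sub>M \<nu> X"
    and "distr (\<nu> X) (\<nu> X) (\<lambda>k. k - l) = \<nu> X"
proof -
  have "(\<lambda>k. k - l) \<in> \<nu> X \<rightarrow>\<^sub>M \<nu> X \<and>
    distr (\<nu> X) (\<nu> X) (\<lambda>k. k - l) = \<nu> X"
  proof (cases X)
    case Line
    have "distr lborel lborel (\<lambda>k. k - l) = distr lborel borel ((+) (- l))"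
      by (intro distr_cong) auto
    with Line show ?thesis using lborel_distr_plus[of "- l"] by auto
  next
    case Torus
    then have l: "l \<in> \<int>" using assms by simp
    have "bij_betw (\<lambda>k. k - l) \<int> \<int>"
      by (rule bij_betw_byWitness[where f'="\<lambda>k. k + l"]) (use l in auto)
    with Torus l show ?thesis by (auto intro: distr_bij_count_space)
  qed
  then show "(\<lambda>k. k - l) \<in> \<nu> X \<rightarrow>\<^sub>M \<nu> X"
    and "distr (\<nu> X) (\<nu> X) (\<lambda>k. k - l) = \<nu> X" by auto
qed

lemma freq_uminus:
  "uminus \<in> \<nu> X \<rightarrow>\<^sub>M \<nu> X"
  "distr (\<nu> X) (\<nu> X) uminus = \<nu> X"
proof -
  have "uminus \<in> \<nu> X \<rightarrow>\<^sub>M \<nu> X \<and>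
    distr (\<nu> X) (\<nu> X) uminus = \<nu> X"
  proof (cases X)
    case Line
    have "distr lborel lborel uminus = distr lborel borel (uminus :: real \<Rightarrow> real)"
      by (intro distr_cong) auto
    with Line show ?thesis using lborel_distr_uminus by auto
  next
    case Torus
    have "bij_betw uminus \<int> (\<int> :: real set)"
      by (rule bij_betw_byWitness[where f'=uminus]) auto
    with Torus show ?thesis by (auto intro: distr_bij_count_space)
  qed
  then show "uminus \<in> \<nu> X \<rightarrow>\<^sub>M \<nu> X"
    "distr (\<nu> X) (\<nu> X) uminus = \<nu> X" by auto
qed

lemma sqint_distr:
  assumes "T \<in> M \<rightarrow>\<^sub>M M" "distr M M T = M" "g \<in> sqint M"
  shows "(\<lambda>x. g (T x)) \<in> sqint M"
proof -
  have "integrable M (\<lambda>x. (cmod (g (T x)))\<^sup>2)"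
    using integrable_distr[OF assms(1), of "\<lambda>x. (cmod (g x))\<^sup>2"] sqint_integrable[OF assms(3)] assms(2) by simp
  then show ?thesis
    using measurable_compose[OF assms(1) sqint_measurable[OF assms(3)]] by (simp add: sqint_def)
qed

lemma integral_distr_invariant:
  fixes f :: "_ \<Rightarrow> 'b::{banach, second_countable_topology}"
  assumes "T \<in> M \<rightarrow>\<^sub>M M" "distr M M T = M" "f \<in> borel_measurable M"
  shows "(\<integral>x. f (T x) \<partial>M) = (\<integral>x. f x \<partial>M)"
  using integral_distr[OF assms(1,3)] assms(2) by simp

lemma AE_distr_invariant:
  assumes "T \<in> M \<rightarrow>\<^sub>M M" "distr M M T = M" "AE x in M. P x"
  shows "AE x in M. P (T x)"
proof -
  have "AE x in distr M M T. P x" unfolding assms(2) by (rule assms(3))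
  from AE_distrD[OF assms(1) this] show ?thesis .
qed

lemma sq_tendsto_distr:
  assumes "T \<in> M \<rightarrow>\<^sub>M M" "distr M M T = M" "\<And>n. f n \<in> sqint M" "g \<in> sqint M" "sq_tendsto M f g"
  shows "sq_tendsto M (\<lambda>n x. f n (T x)) (\<lambda>x. g (T x))"
proof -
  have "(\<integral>x. (cmod (f n (T x) - g (T x)))\<^sup>2 \<partial>M) = (\<integral>x. (cmod (f n x - g x))\<^sup>2 \<partial>M)" for n
    by (rule integral_distr_invariant[OF assms(1,2), where f="\<lambda>x. (cmod (f n x - g x))\<^sup>2"])
       (intro borel_measurable_integrable sqint_integrable sqint_diff assms)
  with assms(5) show ?thesis by (simp add: sq_tendsto_def)
qed

lemma has_ft_cnj:
  assumes "has_ft X f F"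
  shows "has_ft X (\<lambda>x. cnj (f x)) (\<lambda>k. cnj (F (- k)))"
proof -
  note s = has_ft_sqint[OF assms]
  have "partial_ft X n (\<lambda>x. cnj (f x)) = (\<lambda>k. cnj (partial_ft X n f (- k)))" for n
  proof
    fix k
    have eq: "cis (- (k * x)) * truncated n (\<lambda>x. cnj (f x)) x = cnj (cis (- (- k * x)) * truncated n f x)" for x
      by (simp add: truncated_def cis_cnj split: split_indicator)
    show "partial_ft X n (\<lambda>x. cnj (f x)) k = cnj (partial_ft X n f (- k))"
      unfolding partial_ft_def eq by (rule Bochner_Integration.integral_cnj)
  qed
  moreover have "sq_tendsto (\<nu> X) (\<lambda>n k. cnj (partial_ft X n f (- k))) (\<lambda>k. cnj (F (- k)))"
    using assms unfolding has_ft_def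
    by (intro sq_tendsto_cnj sq_tendsto_distr[OF freq_uminus] partial_ft_sqint) auto
  ultimately show ?thesis
    using sqint_cnj[OF s(1)] sqint_cnj[OF sqint_distr[OF freq_uminus s(2)]] by (simp add: has_ft_def)
qed

lemma has_ft_modulate:
  assumes "has_ft X f F" and l: "l \<in> space (\<nu> X)"
  shows "has_ft X (\<lambda>x. cis (l * x) * f x) (\<lambda>k. F (k - l))"
proof -
  note s = has_ft_sqint[OF assms(1)]
  have "partial_ft X n (\<lambda>x. cis (l * x) * f x) = (\<lambda>k. partial_ft X n f (k - l))" for n
  proof
    fix k
    have eq: "cis (- (k * x)) * truncated n (\<lambda>x. cis (l * x) * f x) x = cis (- ((k - l) * x)) * truncated n f x" for x
    proof -
      have "cis (- ((k - l) * x)) = cis (- (k * x)) * cis (l * x)" by (simp add: cis_mult algebra_simps)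
      then show ?thesis by (simp add: truncated_def)
    qed
    show "partial_ft X n (\<lambda>x. cis (l * x) * f x) k = partial_ft X n f (k - l)"
      unfolding partial_ft_def eq ..
  qed
  moreover have "sq_tendsto (\<nu> X) (\<lambda>n k. partial_ft X n f (k - l)) (\<lambda>k. F (k - l))"
    using assms unfolding has_ft_def by (intro sq_tendsto_distr[OF freq_shift[OF l]] partial_ft_sqint) auto
  moreover have "(\<lambda>x. cis (l * x) * f x) \<in> sqint (\<mu> X)"
    by (rule sqint_bounded_mult[OF s(1) borel_measurable_base, where C=1]) auto
  ultimately show ?thesis
    using sqint_distr[OF freq_shift[OF l] s(2)] by (simp add: has_ft_def)
qed

text \<open>Parseval's formula without conjugation. In this bilinear form it applies to distributional
  derivatives and, after modulation, to products.\<close>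

lemma has_ft_pairing:
  assumes "has_ft X f F" "has_ft X g G"
  shows "(\<integral>x. f x * g x \<partial>\<mu> X) = (\<integral>k. F k * G (- k) \<partial>\<nu> X) / (2 * pi)"
  using has_ft_pairing_cnj[OF assms(1) has_ft_cnj[OF assms(2)]] by simp

subsection \<open>Surjectivity\<close>

lemma line_has_ft_multiplication:
  assumes "has_ft Line f F" "has_ft Line g G"
  shows "(\<integral>k. F k * g k \<partial>lborel) = (\<integral>x. f x * G x \<partial>lborel)"
proof -
  have f: "f \<in> sqint lborel" "F \<in> sqint lborel" "sq_tendsto lborel (\<lambda>n. line_ft (truncated n f)) F"
    and g: "g \<in> sqint lborel" "G \<in> sqint lborel" "sq_tendsto lborel (\<lambda>n. line_ft (truncated n g)) G"
    using assms by (auto simp: has_ft_def partial_ft_Line)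
  have "(\<lambda>n. \<integral>k. line_ft (truncated n f) k * truncated n g k \<partial>lborel) \<longlonglongrightarrow> (\<integral>k. F k * g k \<partial>lborel)"
    by (intro sq_tendsto_pairing line_ft_truncated_sqint truncated_sqint truncated_sq_tendsto f g) simp
  moreover have "(\<lambda>n. \<integral>x. truncated n f x * line_ft (truncated n g) x \<partial>lborel) \<longlonglongrightarrow> (\<integral>x. f x * G x \<partial>lborel)"
    by (intro sq_tendsto_pairing line_ft_truncated_sqint truncated_sqint truncated_sq_tendsto f g) simp
  moreover have "(\<integral>k. line_ft (truncated n f) k * truncated n g k \<partial>lborel) = (\<integral>x. truncated n f x * line_ft (truncated n g) x \<partial>lborel)" for n
    by (intro line_ft_multiplication truncated_integrable f g)
  ultimately show ?thesis by (simp only:) (rule LIMSEQ_unique)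
qed

text \<open>The transform is an isometry, and by the multiplication formula its adjoint is, up to a reflection, the
  transform itself; therefore it is surjective.\<close>

lemma line_has_ft_inversion:
  assumes "has_ft Line g G"
  shows "has_ft Line (\<lambda>x. G (- x) / (2 * pi)) g"
proof -
  note gG = has_ft_sqint[OF assms, simplified]
  have f: "(\<lambda>x. (1 / (2 * pi)) * G (- x)) \<in> sqint (base_measure Line)"
    using sqint_cmult[OF sqint_distr[OF freq_uminus[of Line] has_ft_sqint(2)[OF assms]], of "1 / (2 * pi)"] by simp
  obtain h where h: "has_ft Line (\<lambda>x. (1 / (2 * pi)) * G (- x)) h" using has_ft_exists[OF f] by blast
  have eq: "(\<integral>k. h k * u k \<partial>lborel) = (\<integral>k. g k * u k \<partial>lborel)" if u: "u \<in> sqint lborel" for u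
  proof -
    obtain U where U: "has_ft Line u U" using has_ft_exists[of u Line] u by auto
    have "(\<integral>k. h k * u k \<partial>lborel) = (\<integral>x. (1 / (2 * pi)) * G (- x) * U x \<partial>lborel)"
      by (rule line_has_ft_multiplication[OF h U])
    also have "\<dots> = (1 / (2 * pi)) * (\<integral>x. U x * G (- x) \<partial>lborel)"
      by (simp add: mult_ac)
    also have "\<dots> = (\<integral>k. u k * g k \<partial>lborel)"
      using has_ft_pairing[OF U assms] by simp
    finally show ?thesis by (simp add: mult.commute)
  qed
  have hs: "h \<in> sqint lborel" using has_ft_sqint(2)[OF h] by simp
  have d: "(\<lambda>k. h k - g k) \<in> sqint lborel" by (intro sqint_diff hs gG)
  have "(\<integral>k. (h k - g k) * cnj (h k - g k) \<partial>lborel) = 0"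
  proof -
    have "(\<integral>k. (h k - g k) * cnj (h k - g k) \<partial>lborel)
        = (\<integral>k. h k * cnj (h k - g k) \<partial>lborel) - (\<integral>k. g k * cnj (h k - g k) \<partial>lborel)"
      unfolding left_diff_distrib
      by (intro Bochner_Integration.integral_diff sqint_mult_integrable sqint_cnj d hs gG)
    then show ?thesis unfolding eq[OF sqint_cnj[OF d]] by simp
  qed
  then have "(\<integral>k. (cmod (h k - g k))\<^sup>2 \<partial>lborel) = 0"
    unfolding sq_cmod_pairing by (simp only: of_real_eq_0_iff)
  then have "AE k in lborel. h k - g k = 0" by (intro sqint_eq_0_AE[OF d]) simp
  then have "AE k in freq_measure Line. h k = g k" unfolding freq_measure.simps by eventually_elim simp
  from has_ft_cong_AE[OF h _ _ _ this, of "\<lambda>x. G (- x) / (2 * pi)"] show ?thesis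
    using sqint_measurable[OF f] gG by simp
qed

lemma has_ft_surj:
  assumes g: "g \<in> sqint (\<nu> X)"
  obtains f where "has_ft X f g"
proof (cases X)
  case Line
  then have "g \<in> sqint (base_measure Line)" using g by simp
  then obtain G where "has_ft Line g G" using has_ft_exists by blast
  from line_has_ft_inversion[OF this] Line that show ?thesis by blast
next
  case Torus
  then have "g \<in> sqint (count_space \<int>)" using g by simp
  then obtain f where f: "f \<in> sqint torus_measure"
    "\<And>k. k \<in> \<int> \<Longrightarrow> (\<integral>x. cis (- (k * x)) * f x \<partial>torus_measure) = g k"
    using torus_Riesz_Fischer by metis
  have "has_ft Torus f g"
    by (rule has_ft_cong_AE[OF has_ft_Torus[OF f(1)]]) (use f sqint_measurable[OF f(1)] in \<open>auto simp: AE_count_space\<close>)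
  with Torus that show ?thesis by blast
qed

lemma has_ft_inj:
  assumes "has_ft X f F" "has_ft X g G" "AE k in \<nu> X. F k = G k"
  shows "AE x in \<mu> X. f x = g x"
proof -
  note d = has_ft_diff[OF assms(1,2)]
  have "(\<integral>k. (cmod (F k - G k))\<^sup>2 \<partial>\<nu> X) = 0"
    by (rule integral_eq_zero_AE) (use assms(3) in eventually_elim, simp)
  then have "AE x in \<mu> X. f x - g x = 0"
    using has_ft_norm[OF d] by (intro sqint_eq_0_AE[OF has_ft_sqint(1)[OF d]]) simp
  then show ?thesis by eventually_elim simp
qed

subsection \<open>Integrable functions and products\<close>

text \<open>For integrable functions the truncated integrals converge at each frequency; Fatou's lemma
  identifies this limit with the limit in the mean.\<close>

lemma has_ft_integrable:
  assumes f: "has_ft X f F" "integrable (\<mu> X) f"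
  shows "AE k in \<nu> X. F k = (\<integral>x. cis (- (k * x)) * f x \<partial>\<mu> X)"
proof -
  let ?h = "\<lambda>k. \<integral>x. cis (- (k * x)) * f x \<partial>\<mu> X"
  let ?p = "\<lambda>n. partial_ft X n f"
  note s = has_ft_sqint[OF f(1)]
  have ps: "?p n \<in> sqint (\<nu> X)" for n by (rule partial_ft_sqint[OF s(1)])
  have [measurable]: "?p n \<in> borel_measurable (\<nu> X)" "F \<in> borel_measurable (\<nu> X)" for n
    using ps s(2) by (auto intro: sqint_measurable)
  have lim: "(\<lambda>n. ?p n k) \<longlonglongrightarrow> ?h k" for k
    unfolding partial_ft_def
  proof (rule integral_dominated_convergence[where w="\<lambda>x. cmod (f x)"])
    show "AE x in \<mu> X. (\<lambda>n. cis (- (k * x)) * truncated n f x) \<longlonglongrightarrow> cis (- (k * x)) * f x"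
    proof (rule AE_I2)
      fix x :: real
      obtain N :: nat where N: "\<bar>x\<bar> \<le> real N" using real_arch_simple by blast
      have "\<forall>\<^sub>F n in sequentially. cis (- (k * x)) * truncated n f x = cis (- (k * x)) * f x"
        by (rule eventually_sequentiallyI[of N]) (use N in \<open>auto simp: truncated_def abs_le_iff split: split_indicator\<close>)
      then show "(\<lambda>n. cis (- (k * x)) * truncated n f x) \<longlonglongrightarrow> cis (- (k * x)) * f x"
        by (rule tendsto_eventually)
    qed
    show "(\<lambda>x. cis (- (k * x)) * truncated n f x) \<in> borel_measurable (\<mu> X)" for n
      by (intro borel_measurable_integrable integrable_cis_base truncated_integrable_base s)
    show "AE x in \<mu> X. norm (cis (- (k * x)) * truncated n f x) \<le> cmod (f x)" for n
      by (rule AE_I2) (auto simp: norm_mult truncated_def split: split_indicator)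
  qed (use f(2) in \<open>auto intro: borel_measurable_integrable integrable_cis_base\<close>)
  have "(\<lambda>n. \<integral>\<^sup>+k. ennreal ((cmod (?p n k - F k))\<^sup>2) \<partial>\<nu> X) \<longlonglongrightarrow> ennreal 0"
    unfolding sqint_nn_integral[OF sqint_diff[OF ps s(2)]]
    using f(1) by (intro tendsto_ennrealI) (simp add: has_ft_def sq_tendsto_def)
  then have l0: "liminf (\<lambda>n. \<integral>\<^sup>+k. ennreal ((cmod (?p n k - F k))\<^sup>2) \<partial>\<nu> X) = 0"
    using lim_imp_Liminf[OF sequentially_bot] by force
  have hm [measurable]: "?h \<in> borel_measurable (\<nu> X)"
    by (rule borel_measurable_LIMSEQ_metric[OF _ lim]) measurable
  have "(\<integral>\<^sup>+k. ennreal ((cmod (?h k - F k))\<^sup>2) \<partial>\<nu> X)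
      = (\<integral>\<^sup>+k. liminf (\<lambda>n. ennreal ((cmod (?p n k - F k))\<^sup>2)) \<partial>\<nu> X)"
  proof (rule nn_integral_cong)
    fix k
    have "(\<lambda>n. ennreal ((cmod (?p n k - F k))\<^sup>2)) \<longlonglongrightarrow> ennreal ((cmod (?h k - F k))\<^sup>2)"
      by (intro tendsto_ennrealI tendsto_power tendsto_norm tendsto_diff tendsto_const lim)
    from lim_imp_Liminf[OF _ this] show "ennreal ((cmod (?h k - F k))\<^sup>2) = liminf (\<lambda>n. ennreal ((cmod (?p n k - F k))\<^sup>2))"
      by simp
  qed
  also have "\<dots> \<le> liminf (\<lambda>n. \<integral>\<^sup>+k. ennreal ((cmod (?p n k - F k))\<^sup>2) \<partial>\<nu> X)"
    by (rule nn_integral_liminf) measurable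
  finally have "(\<integral>\<^sup>+k. ennreal ((cmod (?h k - F k))\<^sup>2) \<partial>\<nu> X) = 0" using l0 by simp
  then have "AE k in \<nu> X. ennreal ((cmod (?h k - F k))\<^sup>2) = 0"
    by (subst (asm) nn_integral_0_iff_AE) measurable
  then show ?thesis by eventually_elim (simp add: ennreal_eq_0_iff)
qed

text \<open>The pairing formula bounds \<open>\<integral> f h\<close> by a constant times the \<open>L\<^sup>1\<close> norm of \<open>h\<close>. Testing with
  the conjugate phase of \<open>f\<close> on the set where \<open>\<bar>f\<bar>\<close> exceeds the constant shows that this set is null.\<close>

lemma has_ft_bounded:
  assumes f: "has_ft X f F" and F: "integrable (\<nu> X) F"
  obtains C where "AE x in \<mu> X. cmod (f x) \<le> C"
proof -
  define M where "M = \<mu> X"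
  define K where "K = (\<integral>k. cmod (F k) \<partial>\<nu> X) / (2 * pi)"
  have K: "K \<ge> 0" by (simp add: K_def)
  define C where "C = K + 1"
  have C: "C > 0" using K by (simp add: C_def)
  have fs: "f \<in> sqint M" using has_ft_sqint[OF f] by (simp add: M_def)
  have [measurable]: "f \<in> borel_measurable M" using fs by (rule sqint_measurable)
  define ind where "ind x = (if cmod (f x) > C then 1 else 0 :: real)" for x
  \<comment> \<open>The phase is chosen such that \<open>f h = \<bar>f\<bar>\<close> on the exceptional set.\<close>
  define h where "h x = cnj (sgn (f x)) * of_real (ind x)" for x
  have cnj_m: "cnj \<in> borel_measurable borel" by (intro borel_measurable_continuous_onI continuous_intros)
  have [measurable]: "ind \<in> borel_measurable M" unfolding ind_def by measurable
  have [measurable]: "h \<in> borel_measurable M"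
    unfolding h_def by (intro borel_measurable_times measurable_compose[OF _ cnj_m]) measurable
  have chi_le: "ind x \<le> (cmod (f x))\<^sup>2 / C\<^sup>2" for x
    using C by (auto simp: ind_def power_mono less_imp_le)
  have chi_int: "integrable M ind"
    by (rule Bochner_Integration.integrable_bound[where f="\<lambda>x. (cmod (f x))\<^sup>2 / C\<^sup>2"])
       (use sqint_integrable[OF fs] chi_le C in \<open>auto simp: ind_def\<close>)
  have hnorm: "cmod (h x) = ind x" for x
    using C by (auto simp: h_def ind_def norm_mult norm_sgn)
  have h_int: "integrable M h"
    by (rule Bochner_Integration.integrable_bound[OF chi_int]) (auto simp: hnorm ind_def)
  have "h \<in> sqint M"
    by (rule sqint_bound[OF _ chi_int]) (auto simp: hnorm ind_def)
  then obtain H where H: "has_ft X h H" using has_ft_exists M_def by blast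
  have Hb: "AE k in \<nu> X. cmod (H k) \<le> (\<integral>x. ind x \<partial>M)"
    using has_ft_integrable[OF H h_int[unfolded M_def]]
  proof eventually_elim
    case (elim k)
    have "cmod (H k) \<le> (\<integral>x. cmod (cis (- (k * x)) * h x) \<partial>M)"
      unfolding elim M_def by (rule integral_norm_bound)
    then show ?case by (simp add: norm_mult hnorm)
  qed
  have fh: "f x * h x = of_real (cmod (f x) * ind x)" for x
  proof -
    have "f x * cnj (sgn (f x)) = of_real (cmod (f x))"
    proof (cases "f x = 0")
      case False
      have "f x * cnj (f x) = of_real (cmod (f x)) * of_real (cmod (f x))"
        using complex_norm_square[of "f x"] by (simp add: power2_eq_square)
      with False show ?thesis by (simp add: sgn_div_norm scaleR_conv_of_real field_simps)
    qed simp
    then show ?thesis by (simp add: h_def flip: mult.assoc)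
  qed
  have fchi_int: "integrable M (\<lambda>x. cmod (f x) * ind x)"
  proof -
    have "integrable M (\<lambda>x. cmod (f x * h x))"
      by (intro integrable_norm sqint_mult_integrable fs \<open>h \<in> sqint M\<close>)
    moreover have "cmod (f x * h x) = cmod (f x) * ind x" for x by (simp add: norm_mult hnorm)
    ultimately show ?thesis by simp
  qed
  have "(\<integral>x. cmod (f x) * ind x \<partial>M) = cmod (\<integral>x. f x * h x \<partial>M)"
    unfolding fh integral_complex_of_real norm_of_real
    by (rule abs_of_nonneg[symmetric], rule integral_nonneg_AE, rule AE_I2) (simp add: ind_def)
  also have "\<dots> = cmod (\<integral>k. F k * H (- k) \<partial>\<nu> X) / (2 * pi)"
    unfolding M_def has_ft_pairing[OF f H] by (simp add: norm_divide)
  also have "\<dots> \<le> (\<integral>k. cmod (F k) * (\<integral>x. ind x \<partial>M) \<partial>\<nu> X) / (2 * pi)"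
  proof (intro divide_right_mono order_trans[OF integral_norm_bound] integral_mono_AE)
    show "integrable (\<nu> X) (\<lambda>k. norm (F k * H (- k)))"
      by (intro integrable_norm sqint_mult_integrable has_ft_sqint[OF f] sqint_distr[OF freq_uminus] has_ft_sqint[OF H])
    show "integrable (\<nu> X) (\<lambda>k. cmod (F k) * (\<integral>x. ind x \<partial>M))"
      using F by simp
    show "AE k in \<nu> X. norm (F k * H (- k)) \<le> cmod (F k) * (\<integral>x. ind x \<partial>M)"
      using AE_distr_invariant[OF freq_uminus Hb]
      by eventually_elim (simp add: norm_mult mult_left_mono)
  qed simp
  also have "\<dots> = K * (\<integral>x. ind x \<partial>M)" by (simp add: K_def)
  finally have up: "(\<integral>x. cmod (f x) * ind x \<partial>M) \<le> K * (\<integral>x. ind x \<partial>M)" .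
  have "(\<integral>x. C * ind x \<partial>M) \<le> (\<integral>x. cmod (f x) * ind x \<partial>M)"
    by (intro integral_mono fchi_int integrable_mult_right chi_int) (auto simp: ind_def)
  then have "C * (\<integral>x. ind x \<partial>M) \<le> K * (\<integral>x. ind x \<partial>M)" using up by simp
  then have le0: "(\<integral>x. ind x \<partial>M) \<le> 0" by (simp add: C_def algebra_simps)
  have chi0: "0 \<le> ind x" for x by (simp add: ind_def)
  have "0 \<le> (\<integral>x. ind x \<partial>M)" by (rule integral_nonneg_AE, rule AE_I2, rule chi0)
  with le0 have "(\<integral>x. ind x \<partial>M) = 0" by linarith
  then have "AE x in M. ind x = 0"
    using integral_nonneg_eq_0_iff_AE[OF chi_int] chi0 by simp
  then have "AE x in \<mu> X. cmod (f x) \<le> C"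
    unfolding M_def by eventually_elim (simp add: ind_def split: if_splits)
  then show ?thesis by (rule that)
qed

section \<open>Weak derivatives and the Fourier transform\<close>

definition has_dx_scalar :: "base \<Rightarrow> (real \<Rightarrow> complex) \<Rightarrow> (real \<Rightarrow> complex) \<Rightarrow> bool" where
  "has_dx_scalar X f g \<longleftrightarrow> f \<in> sqint (\<mu> X) \<and> g \<in> sqint (\<mu> X) \<and>
     (\<forall>\<phi> \<in> test_functions X. (\<integral>x. deriv1 \<phi> x * f x \<partial>\<mu> X) = - (\<integral>x. \<phi> x * g x \<partial>\<mu> X))"

subsection \<open>Test functions\<close>

lemma test_functions_smooth: "\<phi> \<in> test_functions X \<Longrightarrow> smooth \<phi>"
  by (cases X) auto

lemma test_function_derivative:
  assumes "\<phi> \<in> test_functions X"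
  shows "((deriv1 ^^ n) \<phi> has_vector_derivative (deriv1 ^^ Suc n) \<phi> x) (at x)"
proof -
  have "(deriv1 ^^ n) \<phi> differentiable at x"
    using test_functions_smooth[OF assms] by (auto simp: smooth_def)
  then show ?thesis by (simp add: deriv1_def flip: vector_derivative_works)
qed

lemma test_function_continuous:
  assumes "\<phi> \<in> test_functions X"
  shows "continuous_on S ((deriv1 ^^ n) \<phi>)"
  by (intro continuous_at_imp_continuous_on ballI)
     (rule has_vector_derivative_continuous[OF test_function_derivative[OF assms]])

lemma inverse_1_plus_square_integrable: "integrable lborel (\<lambda>x::real. 1 / (1 + x\<^sup>2))"
  using integrable_inverse_1_plus_square unfolding set_integrable_def
  by (simp add: einterval_def inverse_eq_divide)

text \<open>The seminorms with the weights \<open>1\<close> and \<open>x\<^sup>2\<close> together give an integrable bound.\<close>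

lemma schwartz_decay:
  assumes "\<phi> \<in> test_functions Line"
  shows "\<exists>C. \<forall>x. cmod ((deriv1 ^^ n) \<phi> x) \<le> C / (1 + x\<^sup>2)"
proof -
  have bd: "bounded (range (\<lambda>x. x ^ m *\<^sub>R (deriv1 ^^ n) \<phi> x))" for m
    using assms by auto
  obtain A where A: "\<And>x. norm (x ^ 0 *\<^sub>R (deriv1 ^^ n) \<phi> x) \<le> A"
    using bd[of 0] unfolding bounded_iff by blast
  obtain B where B: "\<And>x. norm (x ^ 2 *\<^sub>R (deriv1 ^^ n) \<phi> x) \<le> B"
    using bd[of 2] unfolding bounded_iff by blast
  have "cmod ((deriv1 ^^ n) \<phi> x) \<le> (A + B) / (1 + x\<^sup>2)" for x
  proof -
    have "(1 + x\<^sup>2) * cmod ((deriv1 ^^ n) \<phi> x) \<le> A + B"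
      using A[of x] B[of x] by (simp add: algebra_simps)
    moreover have "1 + x\<^sup>2 > 0" by (simp add: add_pos_nonneg)
    ultimately show ?thesis by (simp add: pos_le_divide_eq mult.commute)
  qed
  then show ?thesis by blast
qed

lemma test_function_integrable:
  assumes "\<phi> \<in> test_functions X"
  shows "integrable (\<mu> X) ((deriv1 ^^ n) \<phi>)" "(deriv1 ^^ n) \<phi> \<in> sqint (\<mu> X)"
    and "\<exists>C. \<forall>x\<in>space (\<mu> X). cmod ((deriv1 ^^ n) \<phi> x) \<le> C"
proof -
  define \<psi> where "\<psi> = (deriv1 ^^ n) \<phi>"
  have [measurable]: "\<psi> \<in> borel_measurable borel"
    unfolding \<psi>_def by (intro borel_measurable_continuous_onI test_function_continuous[OF assms])
  have m: "\<psi> \<in> borel_measurable (\<mu> X)" by (intro borel_measurable_base) measurable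
  have *: "integrable (\<mu> X) \<psi> \<and> (\<exists>C. \<forall>x\<in>space (\<mu> X). cmod (\<psi> x) \<le> C)"
  proof (cases X)
    case Line
    from schwartz_decay[OF assms[unfolded Line], of n] obtain C
      where C': "\<forall>x. cmod (\<psi> x) \<le> C / (1 + x\<^sup>2)" unfolding \<psi>_def ..
    then have C: "cmod (\<psi> x) \<le> C / (1 + x\<^sup>2)" for x by (rule spec)
    have "integrable lborel (\<lambda>x::real. C * (1 / (1 + x\<^sup>2)))"
      by (intro integrable_mult_right inverse_1_plus_square_integrable)
    then have 1: "integrable lborel \<psi>"
    proof (rule Bochner_Integration.integrable_bound)
      have "norm (\<psi> x) \<le> norm (C * (1 / (1 + x\<^sup>2)))" for x
        using order_trans[OF C abs_ge_self, of x] by simp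
      then show "AE x in lborel. norm (\<psi> x) \<le> norm (C * (1 / (1 + x\<^sup>2)))" by (intro AE_I2)
    qed simp
    have "0 \<le> C" using order_trans[OF norm_ge_zero C[of 0]] by simp
    have Cle: "C / (1 + x\<^sup>2) \<le> C / 1" for x :: real
      by (rule divide_left_mono) (use \<open>0 \<le> C\<close> in \<open>simp_all add: add_pos_nonneg\<close>)
    have "cmod (\<psi> x) \<le> C" for x using order_trans[OF C Cle, of x] by simp
    then have "\<exists>C. \<forall>x\<in>space lborel. cmod (\<psi> x) \<le> C" by (intro exI[of _ C]) simp
    with 1 show ?thesis unfolding Line base_measure.simps by (rule conjI)
  next
    case Torus
    have "compact (\<psi> ` {0..2 * pi})"
      unfolding \<psi>_def by (intro compact_continuous_image test_function_continuous[OF assms] compact_Icc)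
    from compact_imp_bounded[OF this] obtain C where "\<forall>y\<in>\<psi> ` {0..2 * pi}. norm y \<le> C"
      unfolding bounded_iff ..
    then have C': "\<forall>x\<in>space torus_measure. cmod (\<psi> x) \<le> C" by (auto simp: space_restrict_space)
    have "integrable torus_measure \<psi>"
      using C' m Torus by (intro torus.integrable_const_bound[where B=C] AE_I2) auto
    with C' show ?thesis unfolding Torus base_measure.simps by (intro conjI exI[of _ C])
  qed
  then obtain C where C: "\<forall>x\<in>space (\<mu> X). cmod (\<psi> x) \<le> C" by blast
  have "\<psi> \<in> sqint (\<mu> X)"
  proof (rule sqint_bound[OF m, where h="\<lambda>x. C * cmod (\<psi> x)"])
    show "integrable (\<mu> X) (\<lambda>x. C * cmod (\<psi> x))" using * by simp
    show "AE x in \<mu> X. (cmod (\<psi> x))\<^sup>2 \<le> C * cmod (\<psi> x)"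
      by (rule AE_I2) (use C in \<open>auto simp: power2_eq_square intro!: mult_right_mono\<close>)
  qed
  then show "(deriv1 ^^ n) \<phi> \<in> sqint (\<mu> X)" unfolding \<psi>_def .
  from * show "integrable (\<mu> X) ((deriv1 ^^ n) \<phi>)"
    "\<exists>C. \<forall>x\<in>space (\<mu> X). cmod ((deriv1 ^^ n) \<phi> x) \<le> C"
    unfolding \<psi>_def by (rule conjunct1, rule conjunct2)
qed

lemma integral_Icc_tendsto:
  fixes f :: "real \<Rightarrow> complex"
  assumes f: "integrable lborel f"
  shows "(\<lambda>n. \<integral>x. indicator {- real n..real n} x *\<^sub>R f x \<partial>lborel) \<longlonglongrightarrow> (\<integral>x. f x \<partial>lborel)"
proof (rule integral_dominated_convergence[where w="\<lambda>x. norm (f x)"])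
  have [measurable]: "f \<in> borel_measurable borel" using f by auto
  show "f \<in> borel_measurable lborel" "(\<lambda>x. indicator {- real n..real n} x *\<^sub>R f x) \<in> borel_measurable lborel" for n
    by measurable
  show "AE x in lborel. (\<lambda>n. indicator {- real n..real n} x *\<^sub>R f x) \<longlonglongrightarrow> f x"
  proof (rule AE_I2)
    fix x :: real
    obtain N :: nat where N: "\<bar>x\<bar> \<le> real N" using real_arch_simple by blast
    have "\<forall>\<^sub>F n in sequentially. indicator {- real n..real n} x *\<^sub>R f x = f x"
      by (rule eventually_sequentiallyI[of N]) (use N in \<open>auto simp: abs_le_iff split: split_indicator\<close>)
    then show "(\<lambda>n. indicator {- real n..real n} x *\<^sub>R f x) \<longlonglongrightarrow> f x"
      by (rule tendsto_eventually)
  qed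
  show "AE x in lborel. norm (indicator {- real n..real n} x *\<^sub>R f x) \<le> norm (f x)" for n
    by (rule AE_I2) (auto split: split_indicator)
qed (use f in auto)

text \<open>The integral of the derivative of \<open>cis (- k x) \<phi> x\<close> vanishes: by decay on the line, by periodicity on
  the torus.\<close>

lemma test_function_by_parts:
  assumes \<phi>: "\<phi> \<in> test_functions X" and k: "k \<in> space (\<nu> X)"
  shows "(\<integral>x. cis (- (k * x)) * deriv1 \<phi> x \<partial>\<mu> X)
     = \<i> * k * (\<integral>x. cis (- (k * x)) * \<phi> x \<partial>\<mu> X)"
proof -
  define d where "d x = cis (- (k * x)) * deriv1 \<phi> x - \<i> * k * (cis (- (k * x)) * \<phi> x)" for x
  have i0: "integrable (\<mu> X) \<phi>" using test_function_integrable(1)[OF \<phi>, of 0] by simp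
  have i1: "integrable (\<mu> X) (deriv1 \<phi>)" using test_function_integrable(1)[OF \<phi>, of 1] by simp
  have id: "integrable (\<mu> X) d"
    unfolding d_def
    by (intro Bochner_Integration.integrable_diff integrable_mult_right integrable_cis_base i0 i1)
  have cont: "continuous_on S d" for S
    using test_function_continuous[OF \<phi>, of S 0] test_function_continuous[OF \<phi>, of S 1]
    unfolding d_def by (auto intro!: continuous_intros)
  have deriv: "((\<lambda>x. cis (- (k * x)) * \<phi> x) has_vector_derivative d x) (at x within S)" for x S
  proof -
    have "((\<lambda>x. cis (- k * x)) has_vector_derivative \<i> * of_real (- k) * cis (- k * x)) (at x within S)"
      by (rule cis_has_vector_derivative)
    moreover have "(\<phi> has_vector_derivative deriv1 \<phi> x) (at x within S)"
      using has_vector_derivative_at_within[OF test_function_derivative[OF \<phi>, of 0 x]] by simp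
    ultimately have "((\<lambda>x. cis (- k * x) * \<phi> x) has_vector_derivative
        cis (- k * x) * deriv1 \<phi> x + \<i> * of_real (- k) * cis (- k * x) * \<phi> x) (at x within S)"
      by (rule has_vector_derivative_mult)
    then show ?thesis by (simp add: d_def algebra_simps)
  qed
  have FTC: "(\<integral>x. indicator {a..b} x *\<^sub>R d x \<partial>lborel) = cis (- (k * b)) * \<phi> b - cis (- (k * a)) * \<phi> a"
    if "a \<le> b" for a b
    by (rule integral_FTC_atLeastAtMost[OF that deriv cont])
  have "(\<integral>x. d x \<partial>\<mu> X) = 0"
  proof (cases X)
    case Line
    from schwartz_decay[OF \<phi>[unfolded Line], of 0] obtain C
      where C': "\<forall>x. cmod ((deriv1 ^^ 0) \<phi> x) \<le> C / (1 + x\<^sup>2)" ..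
    then have C: "cmod (\<phi> x) \<le> C / (1 + x\<^sup>2)" for x by simp
    have z: "(\<lambda>n. C / (1 + (real n)\<^sup>2)) \<longlonglongrightarrow> 0"
    proof (rule tendsto_divide_0[OF tendsto_const filterlim_at_top_imp_at_infinity])
      have "real n \<le> 1 + (real n)\<^sup>2" for n
        using zero_le_power2[of "real n - 1"] by (simp add: power2_diff)
      then show "filterlim (\<lambda>n. 1 + (real n)\<^sup>2) at_top sequentially"
        by (intro filterlim_at_top_mono[OF filterlim_real_sequentially] always_eventually) simp
    qed
    have "(\<lambda>n. cis (- (k * real n)) * \<phi> (real n)) \<longlonglongrightarrow> 0" "(\<lambda>n. cis (- (k * (- real n))) * \<phi> (- real n)) \<longlonglongrightarrow> 0"
      by (rule Lim_null_comparison[OF always_eventually z], rule allI,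
          use C[of "real _"] C[of "- real _"] in \<open>simp add: norm_mult\<close>)+
    from tendsto_diff[OF this] have "(\<lambda>n. \<integral>x. indicator {- real n..real n} x *\<^sub>R d x \<partial>lborel) \<longlonglongrightarrow> 0"
      by (simp add: FTC)
    moreover have "(\<lambda>n. \<integral>x. indicator {- real n..real n} x *\<^sub>R d x \<partial>lborel) \<longlonglongrightarrow> (\<integral>x. d x \<partial>lborel)"
      using id Line by (intro integral_Icc_tendsto) simp
    ultimately have "(\<integral>x. d x \<partial>lborel) = 0" by (rule LIMSEQ_unique[symmetric])
    with Line show ?thesis by simp
  next
    case Torus
    obtain j where j: "k = of_int j" using k Torus by (auto elim: Ints_cases)
    have per: "\<phi> (0 + 2 * pi) = \<phi> 0" using \<phi> unfolding Torus test_functions.simps by blast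
    have "cis (- (k * (2 * pi))) = 1"
      using cis_multiple_2pi[of "of_int (- j)"] by (simp add: j mult.commute)
    moreover have "(\<integral>x. d x \<partial>torus_measure) = (\<integral>x. indicator {0..2 * pi} x *\<^sub>R d x \<partial>lborel)"
      by (rule torus_integral_Icc) (rule borel_measurable_continuous_onI[OF cont])
    ultimately show ?thesis using FTC[of 0 "2 * pi"] per Torus by simp
  qed
  moreover have "(\<integral>x. d x \<partial>\<mu> X) = (\<integral>x. cis (- (k * x)) * deriv1 \<phi> x \<partial>\<mu> X)
     - (\<integral>x. \<i> * k * (cis (- (k * x)) * \<phi> x) \<partial>\<mu> X)"
    unfolding d_def
    by (intro Bochner_Integration.integral_diff integrable_mult_right integrable_cis_base i0 i1)
  ultimately show ?thesis by simp
qed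

lemma has_ft_test_function_derivative:
  assumes \<phi>: "\<phi> \<in> test_functions X" and "has_ft X \<phi> \<Phi>" "has_ft X (deriv1 \<phi>) \<Phi>'"
  shows "AE k in \<nu> X. \<Phi>' k = \<i> * k * \<Phi> k"
proof -
  have i0: "integrable (\<mu> X) \<phi>" using test_function_integrable(1)[OF \<phi>, of 0] by simp
  have i1: "integrable (\<mu> X) (deriv1 \<phi>)" using test_function_integrable(1)[OF \<phi>, of 1] by simp
  from has_ft_integrable[OF assms(2) i0] has_ft_integrable[OF assms(3) i1] AE_space
  show ?thesis by eventually_elim (simp add: test_function_by_parts[OF \<phi>])
qed

text \<open>On the side of the frequencies, integration by parts moves the factor \<open>\<i> k\<close> from one function to the
  other; the sign comes from the reflection in \<open>has_ft_pairing\<close>.\<close>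

lemma has_dx_scalarI_has_ft:
  assumes f: "has_ft X f F" and g: "has_ft X g G" and eq: "AE k in \<nu> X. G k = \<i> * k * F k"
  shows "has_dx_scalar X f g"
  unfolding has_dx_scalar_def
proof (intro conjI ballI has_ft_sqint[OF f] has_ft_sqint[OF g])
  fix \<phi> assume \<phi>: "\<phi> \<in> test_functions X"
  obtain \<Phi> where \<Phi>: "has_ft X \<phi> \<Phi>"
    using has_ft_exists test_function_integrable(2)[OF \<phi>, of 0] by auto
  obtain \<Phi>' where \<Phi>': "has_ft X (deriv1 \<phi>) \<Phi>'"
    using has_ft_exists test_function_integrable(2)[OF \<phi>, of 1] by auto
  have "(\<integral>x. deriv1 \<phi> x * f x \<partial>\<mu> X) = (\<integral>k. \<Phi>' k * F (- k) \<partial>\<nu> X) / (2 * pi)"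
    by (rule has_ft_pairing[OF \<Phi>' f])
  also have "(\<integral>k. \<Phi>' k * F (- k) \<partial>\<nu> X) = (\<integral>k. - (\<Phi> k * G (- k)) \<partial>\<nu> X)"
  proof (rule integral_cong_AE)
    show "AE k in \<nu> X. \<Phi>' k * F (- k) = - (\<Phi> k * G (- k))"
      using has_ft_test_function_derivative[OF \<phi> \<Phi> \<Phi>'] AE_distr_invariant[OF freq_uminus eq]
      by eventually_elim simp
    have Fm: "(\<lambda>k. F (- k)) \<in> sqint (\<nu> X)" "(\<lambda>k. G (- k)) \<in> sqint (\<nu> X)"
      by (intro sqint_distr[OF freq_uminus] has_ft_sqint[OF f] has_ft_sqint[OF g])+
    show "(\<lambda>k. \<Phi>' k * F (- k)) \<in> borel_measurable (\<nu> X)"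
      by (intro borel_measurable_integrable sqint_mult_integrable Fm has_ft_sqint[OF \<Phi>'])
    show "(\<lambda>k. - (\<Phi> k * G (- k))) \<in> borel_measurable (\<nu> X)"
      by (intro borel_measurable_uminus borel_measurable_integrable sqint_mult_integrable Fm has_ft_sqint[OF \<Phi>])
  qed
  also have "(\<integral>k. - (\<Phi> k * G (- k)) \<partial>\<nu> X) / (2 * pi) = - (\<integral>x. \<phi> x * g x \<partial>\<mu> X)"
    unfolding has_ft_pairing[OF \<Phi> g] by simp
  finally show "(\<integral>x. deriv1 \<phi> x * f x \<partial>\<mu> X) = - (\<integral>x. \<phi> x * g x \<partial>\<mu> X)" .
qed

subsection \<open>Gaussians and exponentials as test functions\<close>

lemma deriv1_eqI: "(\<And>x. (\<phi> has_vector_derivative \<phi>' x) (at x)) \<Longrightarrow> deriv1 \<phi> = \<phi>'"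
  by (auto simp: deriv1_def fun_eq_iff intro: vector_derivative_at)

lemma exponential_test_function:
  assumes "k \<in> \<int>"
  shows "(\<lambda>x. cis (- (k * x))) \<in> test_functions Torus"
    and "deriv1 (\<lambda>x. cis (- (k * x))) = (\<lambda>x. - \<i> * k * cis (- (k * x)))"
proof -
  have d: "((\<lambda>x. c * cis (- (k * x))) has_vector_derivative (- \<i> * k * c) * cis (- (k * x))) (at x)" for c x
    using has_vector_derivative_mult_right[OF cis_has_vector_derivative[of "- k" x UNIV], of c]
    by (simp add: algebra_simps)
  then have D: "deriv1 (\<lambda>x. c * cis (- (k * x))) = (\<lambda>x. (- \<i> * k * c) * cis (- (k * x)))" for c
    by (rule deriv1_eqI)
  from D[of 1] show "deriv1 (\<lambda>x. cis (- (k * x))) = (\<lambda>x. - \<i> * k * cis (- (k * x)))" by simp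
  have iter: "(deriv1 ^^ n) (\<lambda>x. cis (- (k * x))) = (\<lambda>x. (- \<i> * k) ^ n * cis (- (k * x)))" for n
    by (induction n) (simp_all add: D)
  have "(deriv1 ^^ n) (\<lambda>x. cis (- (k * x))) differentiable at x" for n x
    unfolding iter using d differentiableI_vector by blast
  moreover have "cis (- (k * (x + 2 * pi))) = cis (- (k * x))" for x
  proof -
    obtain j where j: "k = of_int j" using assms by (auto elim: Ints_cases)
    have "cis (- (k * (x + 2 * pi))) = cis (- (k * x)) * cis (2 * pi * of_int (- j))"
      by (simp add: cis_mult j algebra_simps)
    then show ?thesis using cis_multiple_2pi[of "of_int (- j)"] by simp
  qed
  ultimately show "(\<lambda>x. cis (- (k * x))) \<in> test_functions Torus" by (simp add: smooth_def)
qed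

text \<open>A polynomial times a Gaussian, both centred at \<open>a\<close>. This class is closed under differentiation and
  contains all derivatives of the Gaussian.\<close>

definition poly_gauss :: "real \<Rightarrow> complex poly \<Rightarrow> real \<Rightarrow> complex" where
  "poly_gauss a p x = poly p (of_real (x - a)) * of_real (exp (- ((x - a)\<^sup>2) / 2))"

lemma poly_gauss_derivative:
  "(poly_gauss a p has_vector_derivative poly_gauss a (pderiv p - [:0, 1:] * p) x) (at x)"
proof -
  have e: "complex_of_real (exp (- (y\<^sup>2 / 2))) = exp (- ((of_real y)\<^sup>2 / 2))" for y :: real
    by (simp flip: exp_of_real)
  have "((\<lambda>z. poly p (z - of_real a) * exp (- ((z - of_real a)\<^sup>2) / 2)) has_field_derivative
     poly (pderiv p) (of_real x - of_real a) * exp (- ((of_real x - of_real a)\<^sup>2) / 2)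
     - (of_real x - of_real a) * poly p (of_real x - of_real a) * exp (- ((of_real x - of_real a)\<^sup>2) / 2)) (at (of_real x :: complex))"
    by (auto intro!: derivative_eq_intros simp: field_simps)
  from has_vector_derivative_real_field[OF this, of UNIV] show ?thesis
    by (simp add: poly_gauss_def[abs_def] e algebra_simps)
qed

text \<open>From \<open>(1 + s / m) ^ m \<le> exp s\<close> with \<open>s = y\<^sup>2 / 2\<close>.\<close>

lemma gauss_power_bound:
  fixes y :: real
  shows "\<bar>y\<bar> ^ n * exp (- (y\<^sup>2) / 2) \<le> 1 + (2 * real (Suc n)) ^ Suc n"
proof -
  define m where "m = Suc n"
  have e: "0 < exp (- (y\<^sup>2) / 2)" "exp (- (y\<^sup>2) / 2) \<le> 1" by auto
  have "(y\<^sup>2 / 2 / real m) ^ m \<le> (1 + (y\<^sup>2 / 2) / real m) ^ m"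
    by (intro power_mono) auto
  also have "\<dots> \<le> exp (y\<^sup>2 / 2)"
    by (rule exp_ge_one_plus_x_over_n_power_n) (auto simp: m_def intro: order_trans[of _ 0])
  finally have "(y\<^sup>2) ^ m / (2 * real m) ^ m \<le> exp (y\<^sup>2 / 2)"
    by (simp add: power_divide power_mult_distrib)
  then have "(y\<^sup>2) ^ m \<le> exp (y\<^sup>2 / 2) * (2 * real m) ^ m"
    by (simp add: divide_le_eq m_def)
  then have "(y\<^sup>2) ^ m * exp (- (y\<^sup>2) / 2) \<le> (exp (y\<^sup>2 / 2) * (2 * real m) ^ m) * exp (- (y\<^sup>2) / 2)"
    by (intro mult_right_mono) auto
  also have "\<dots> = (2 * real m) ^ m" by (simp add: exp_minus field_simps)
  finally have 1: "(y\<^sup>2) ^ m * exp (- (y\<^sup>2) / 2) \<le> (2 * real m) ^ m" .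
  have "\<bar>y\<bar> ^ n \<le> 1 + (y\<^sup>2) ^ m"
  proof (cases "\<bar>y\<bar> \<le> 1")
    case True
    then have "\<bar>y\<bar> ^ n \<le> 1" by (simp add: power_le_one)
    then show ?thesis by (simp add: add_increasing2)
  next
    case False
    have "\<bar>y\<bar> ^ n \<le> \<bar>y\<bar> ^ (2 * m)" using False by (intro power_increasing) (auto simp: m_def)
    also have "\<bar>y\<bar> ^ (2 * m) = (y\<^sup>2) ^ m" by (simp add: power_mult)
    finally show ?thesis by simp
  qed
  then have "\<bar>y\<bar> ^ n * exp (- (y\<^sup>2) / 2) \<le> (1 + (y\<^sup>2) ^ m) * exp (- (y\<^sup>2) / 2)"
    by (intro mult_right_mono) auto
  also have "\<dots> \<le> 1 + (2 * real m) ^ m" using 1 e unfolding distrib_right by linarith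
  finally show ?thesis by (simp add: m_def)
qed

text \<open>The extra power of \<open>x - a\<close> makes the induction over the coefficients go through.\<close>

lemma poly_gauss_bounded: "\<exists>C. \<forall>x. cmod (of_real (x - a) ^ m * poly_gauss a p x) \<le> C"
proof (induction p arbitrary: m)
  case 0
  show ?case by (intro exI[of _ 0]) (simp add: poly_gauss_def)
next
  case (pCons c p)
  obtain C where C: "\<And>x. cmod (of_real (x - a) ^ Suc m * poly_gauss a p x) \<le> C" using pCons.IH by blast
  have "cmod (of_real (x - a) ^ m * poly_gauss a (pCons c p) x) \<le> cmod c * (1 + (2 * real (Suc m)) ^ Suc m) + C" for x
  proof -
    define y where "y = x - a"
    have eq: "of_real y ^ m * poly_gauss a (pCons c p) x
       = c * of_real (y ^ m * exp (- (y\<^sup>2) / 2)) + of_real y ^ Suc m * poly_gauss a p x"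
      by (simp add: poly_gauss_def y_def algebra_simps)
    have "cmod (c * of_real (y ^ m * exp (- (y\<^sup>2) / 2))) = cmod c * (\<bar>y\<bar> ^ m * exp (- (y\<^sup>2) / 2))"
      by (simp add: norm_mult abs_mult power_abs del: of_real_mult of_real_power)
    also have "\<dots> \<le> cmod c * (1 + (2 * real (Suc m)) ^ Suc m)"
      by (intro mult_left_mono gauss_power_bound) auto
    finally show ?thesis
      unfolding y_def[symmetric] eq using C[of x] unfolding y_def[symmetric]
      by (intro norm_triangle_mono)
  qed
  then show ?case by blast
qed

lemma gauss_test_function: "poly_gauss a 1 \<in> test_functions Line"
proof -
  have D: "deriv1 (poly_gauss a p) = poly_gauss a (pderiv p - [:0, 1:] * p)" for p
    by (rule deriv1_eqI) (rule poly_gauss_derivative)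
  have iter: "\<exists>q. (deriv1 ^^ n) (poly_gauss a p) = poly_gauss a q" for n p
  proof (induction n)
    case 0
    show ?case by (rule exI[of _ p]) simp
  next
    case (Suc n)
    then obtain q where "(deriv1 ^^ n) (poly_gauss a p) = poly_gauss a q" by blast
    then show ?case by (intro exI) (simp add: D)
  qed
  have bd: "bounded (range (\<lambda>x. x ^ m *\<^sub>R poly_gauss a q x))" for m q
  proof -
    obtain C where C: "\<And>x. cmod (of_real (x - a) ^ 0 * poly_gauss a ([:of_real a, 1:] ^ m * q) x) \<le> C"
      using poly_gauss_bounded by blast
    have "x ^ m *\<^sub>R poly_gauss a q x = poly_gauss a ([:of_real a, 1:] ^ m * q) x" for x
      by (simp add: poly_gauss_def scaleR_conv_of_real poly_power)
    then show ?thesis using C unfolding bounded_iff by auto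
  qed
  have "(deriv1 ^^ n) (poly_gauss a 1) differentiable at x" for n x
    using iter[of n 1] poly_gauss_derivative[of a _ x] differentiableI_vector by metis
  moreover have "bounded (range (\<lambda>x. x ^ m *\<^sub>R (deriv1 ^^ n) (poly_gauss a 1) x))" for m n
    using iter[of n 1] bd by metis
  ultimately show ?thesis by (simp add: smooth_def)
qed

lemma gauss_transform:
  "(\<integral>x. cis (- (k * x)) * poly_gauss a 1 x \<partial>lborel) = cis (- (k * a)) * of_real (sqrt (2 * pi) * exp (- (k\<^sup>2) / 2))"
proof -
  have "(\<integral>x. cis (- (k * x)) * poly_gauss a 1 x \<partial>lborel)
     = \<bar>1\<bar> *\<^sub>R (\<integral>x. cis (- (k * (a + 1 * x))) * poly_gauss a 1 (a + 1 * x) \<partial>lborel)"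
    by (rule lborel_integral_real_affine) simp
  also have "\<dots> = (\<integral>x. cis (- (k * a)) * (sqrt (2 * pi) * (std_normal_density x *\<^sub>R iexp (- k * x))) \<partial>lborel)"
  proof -
    have "cis (- (k * (a + x))) * poly_gauss a 1 (a + x)
       = cis (- (k * a)) * (sqrt (2 * pi) * (std_normal_density x *\<^sub>R iexp (- k * x)))" for x
    proof -
      have "cis (- (k * (a + x))) = cis (- (k * a)) * iexp (- k * x)"
        by (simp add: cis_conv_exp algebra_simps flip: exp_add)
      then show ?thesis
        by (simp add: poly_gauss_def normal_density_def scaleR_conv_of_real real_sqrt_mult)
    qed
    then show ?thesis by simp
  qed
  also have "\<dots> = cis (- (k * a)) * (sqrt (2 * pi) * (\<integral>x. std_normal_density x *\<^sub>R iexp (- k * x) \<partial>lborel))"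
    by (simp only: integral_mult_right_zero)
  also have "(\<integral>x. std_normal_density x *\<^sub>R iexp (- k * x) \<partial>lborel) = char std_normal_distribution (- k)"
    unfolding char_def by (subst integral_density) (auto simp: normal_density_nonneg)
  also have "\<dots> = exp (- (k\<^sup>2) / 2)"
    by (simp add: char_std_normal_distribution)
  finally show ?thesis by (simp add: exp_of_real)
qed

text \<open>On the torus the exponentials are test functions. On the line the test functions are Gaussians centred
  at \<open>a\<close>: the weak derivative says that the Fourier transform at \<open>a\<close> of \<open>(\<i> k F (- k) + G (- k)) \<gamma> k\<close>
  vanishes, where \<open>\<gamma>\<close> is the nowhere vanishing transform of the centred Gaussian.\<close>

lemma has_dx_scalarD_has_ft:
  assumes dx: "has_dx_scalar X f g" and f: "has_ft X f F" and g: "has_ft X g G"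
  shows "AE k in \<nu> X. G k = \<i> * k * F k"
proof (cases X)
  case Torus
  have fs: "f \<in> sqint torus_measure" "g \<in> sqint torus_measure"
    using has_ft_sqint(1)[OF f] has_ft_sqint(1)[OF g] Torus by auto
  have "AE k in \<nu> X. F k = (\<integral>x. cis (- (k * x)) * f x \<partial>\<mu> X)"
    "AE k in \<nu> X. G k = (\<integral>x. cis (- (k * x)) * g x \<partial>\<mu> X)"
    using has_ft_integrable[OF f] has_ft_integrable[OF g] torus_sqint_integrable fs Torus by auto
  with AE_space show ?thesis
  proof eventually_elim
    case (elim k)
    then have k: "k \<in> \<int>" using Torus by simp
    have "(\<integral>x. (- \<i> * k) * (cis (- (k * x)) * f x) \<partial>\<mu> X) = - (\<integral>x. cis (- (k * x)) * g x \<partial>\<mu> X)"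
      using dx exponential_test_function[OF k] unfolding has_dx_scalar_def Torus by (auto simp: mult.assoc)
    then show ?case unfolding elim by (simp only: integral_mult_right_zero) simp
  qed
next
  case Line
  note fs = has_ft_sqint[OF f] and gs = has_ft_sqint[OF g]
  \<comment> \<open>The transform of the Gaussian centred at the origin; moving the centre to \<open>a\<close> only adds a phase.\<close>
  define \<gamma> where "\<gamma> k = complex_of_real (sqrt (2 * pi) * exp (- (k\<^sup>2) / 2))" for k :: real
  have [measurable]: "\<gamma> \<in> borel_measurable borel" unfolding \<gamma>_def by measurable
  have [measurable]: "F \<in> borel_measurable borel" "G \<in> borel_measurable borel"
    using fs(2) gs(2) Line by auto
  define W where "W k = \<i> * k * \<gamma> k * F (- k) + \<gamma> k * G (- k)" for k
  have gb: "cmod (\<gamma> k) \<le> sqrt (2 * pi)" for k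
    unfolding \<gamma>_def norm_of_real by (simp add: abs_mult mult_left_le)
  have kgb: "cmod (\<i> * k * \<gamma> k) \<le> sqrt (2 * pi) * (1 + (2 * real (Suc 1)) ^ Suc 1)" for k
  proof -
    have "cmod (\<i> * k * \<gamma> k) = sqrt (2 * pi) * (\<bar>k\<bar> ^ 1 * exp (- (k\<^sup>2) / 2))"
      unfolding \<gamma>_def norm_mult norm_of_real by (simp add: abs_mult)
    also have "\<dots> \<le> sqrt (2 * pi) * (1 + (2 * real (Suc 1)) ^ Suc 1)"
      by (intro mult_left_mono gauss_power_bound) auto
    finally show ?thesis .
  qed
  have Fm: "(\<lambda>k. F (- k)) \<in> sqint lborel" "(\<lambda>k. G (- k)) \<in> sqint lborel"
    using sqint_distr[OF freq_uminus[of Line]] fs(2) gs(2) Line by auto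
  have gT: "has_ft Line (poly_gauss a 1) (\<lambda>k. cis (- (k * a)) * \<gamma> k)"
    "has_ft Line (deriv1 (poly_gauss a 1)) (\<lambda>k. \<i> * k * (cis (- (k * a)) * \<gamma> k))" for a
  proof -
    note t = gauss_test_function[of a]
    have i0: "integrable (base_measure Line) (poly_gauss a 1)" "poly_gauss a 1 \<in> sqint (base_measure Line)"
      using test_function_integrable(1,2)[OF t, of 0] by simp_all
    have i1: "deriv1 (poly_gauss a 1) \<in> sqint (base_measure Line)"
      using test_function_integrable(2)[OF t, of 1] by simp
    obtain \<Phi> where \<Phi>: "has_ft Line (poly_gauss a 1) \<Phi>" using has_ft_exists[OF i0(2)] by blast
    obtain \<Phi>' where \<Phi>': "has_ft Line (deriv1 (poly_gauss a 1)) \<Phi>'" using has_ft_exists[OF i1] by blast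
    have e: "AE k in freq_measure Line. \<Phi> k = cis (- (k * a)) * \<gamma> k"
      using has_ft_integrable[OF \<Phi> i0(1)] unfolding \<gamma>_def base_measure.simps gauss_transform .
    show "has_ft Line (poly_gauss a 1) (\<lambda>k. cis (- (k * a)) * \<gamma> k)"
      by (rule has_ft_cong_AE[OF \<Phi> sqint_measurable[OF i0(2)] _ _ e]) (auto simp: AE_I2)
    have "AE k in freq_measure Line. \<Phi>' k = \<i> * k * (cis (- (k * a)) * \<gamma> k)"
      using has_ft_test_function_derivative[OF t \<Phi> \<Phi>'] e by eventually_elim simp
    from has_ft_cong_AE[OF \<Phi>' sqint_measurable[OF i1] _ _ this]
    show "has_ft Line (deriv1 (poly_gauss a 1)) (\<lambda>k. \<i> * k * (cis (- (k * a)) * \<gamma> k))"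
      by (auto simp: AE_I2)
  qed
  have gs2: "\<gamma> \<in> sqint lborel" "(\<lambda>k. \<i> * k * \<gamma> k) \<in> sqint lborel"
    using has_ft_sqint(2)[OF gT(1)[of 0]] has_ft_sqint(2)[OF gT(2)[of 0]] by simp_all
  have i: "integrable lborel (\<lambda>k. \<i> * k * \<gamma> k * F (- k))" "integrable lborel (\<lambda>k. \<gamma> k * G (- k))"
    by (intro sqint_mult_integrable gs2 Fm)+
  have Wi: "integrable lborel W" unfolding W_def by (intro Bochner_Integration.integrable_add i)
  have Ws: "W \<in> sqint lborel"
    unfolding W_def
    by (intro sqint_add sqint_bounded_mult[OF Fm(1) _ AE_I2[OF kgb]] sqint_bounded_mult[OF Fm(2) _ AE_I2[OF gb]]) simp_all
  have zero: "(\<integral>k. cis (- (a * k)) * W k \<partial>lborel) = 0" for a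
  proof -
    have f': "has_ft Line f F" and g': "has_ft Line g G" using f g Line by auto
    have "(\<integral>x. deriv1 (poly_gauss a 1) x * f x \<partial>lborel) = - (\<integral>x. poly_gauss a 1 x * g x \<partial>lborel)"
      using dx gauss_test_function[of a] unfolding has_dx_scalar_def Line by simp
    then have "(\<integral>k. \<i> * k * (cis (- (k * a)) * \<gamma> k) * F (- k) \<partial>lborel) / (2 * pi)
        = (- (\<integral>k. cis (- (k * a)) * \<gamma> k * G (- k) \<partial>lborel)) / (2 * pi)"
      using has_ft_pairing[OF gT(2)[of a] f'] has_ft_pairing[OF gT(1)[of a] g'] by simp
    then have "(\<integral>k. \<i> * k * (cis (- (k * a)) * \<gamma> k) * F (- k) \<partial>lborel) = - (\<integral>k. cis (- (k * a)) * \<gamma> k * G (- k) \<partial>lborel)"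
      unfolding divide_cancel_right by simp
    moreover have "(\<integral>k. cis (- (a * k)) * W k \<partial>lborel)
        = (\<integral>k. cis (- (a * k)) * (\<i> * k * \<gamma> k * F (- k)) \<partial>lborel) + (\<integral>k. cis (- (a * k)) * (\<gamma> k * G (- k)) \<partial>lborel)"
      unfolding W_def distrib_left
      by (intro Bochner_Integration.integral_add integrable_cis_mult i) measurable
    ultimately show ?thesis by (simp add: mult_ac)
  qed
  obtain V where V: "has_ft Line W V" using has_ft_exists[of W Line] Ws by auto
  have "AE a in freq_measure Line. V a = 0"
    using has_ft_integrable[OF V] Wi zero by simp
  from has_ft_inj[OF V has_ft_zero this] have "AE k in \<nu> X. W k = 0"
    unfolding Line base_measure.simps freq_measure.simps .
  from AE_distr_invariant[OF freq_uminus this] show ?thesis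
  proof eventually_elim
    case (elim k)
    have "\<gamma> (- k) * (G k - \<i> * k * F k) = 0" using elim by (simp add: W_def algebra_simps)
    moreover have "\<gamma> (- k) \<noteq> 0" by (simp add: \<gamma>_def)
    ultimately show ?case by simp
  qed
qed

section \<open>Matrix valued functions\<close>

abbreviation entry :: "'d::finite field \<Rightarrow> 'd \<Rightarrow> 'd \<Rightarrow> real \<Rightarrow> complex" where
  "entry F i j \<equiv> \<lambda>x. F x $ i $ j"

lemma cscale_nth [simp]: "(c *\<^sub>c A) $ i $ j = c * A $ i $ j"
  by (simp add: cscale_def map_matrix_def)

lemma matrix_eqI: "(\<And>i j. (A :: 'd::finite cmat) $ i $ j = B $ i $ j) \<Longrightarrow> A = B"
  by (simp add: vec_eq_iff)

lemma matrix_mult_nth: "((A :: 'd::finite cmat) ** B) $ i $ j = (\<Sum>l\<in>UNIV. A $ i $ l * B $ l $ j)"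
  by (simp add: matrix_matrix_mult_def)

lemma norm_cmat_sq: "(norm (A :: 'd::finite cmat))\<^sup>2 = (\<Sum>i\<in>UNIV. \<Sum>j\<in>UNIV. (cmod (A $ i $ j))\<^sup>2)"
  by (simp add: norm_vec_def L2_set_def sum_nonneg)

lemma norm_entry_le: "cmod ((A :: 'd::finite cmat) $ i $ j) \<le> norm A"
  by (rule order_trans[OF Finite_Cartesian_Product.norm_nth_le Finite_Cartesian_Product.norm_nth_le])

lemma bounded_linear_entry: "bounded_linear (\<lambda>A :: 'd::finite cmat. A $ i $ j)"
  by (intro bounded_linear_compose[OF bounded_linear_vec_nth bounded_linear_vec_nth])

lemma bounded_linear_unit: "bounded_linear (\<lambda>z :: complex. axis i (axis j z) :: 'd::finite cmat)"
proof (rule bounded_linear_intro[where K=1])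
  fix z :: complex
  have "(norm (axis i (axis j z) :: 'd cmat))\<^sup>2 = (\<Sum>a\<in>UNIV. \<Sum>b\<in>UNIV. if a = i \<and> b = j then (cmod z)\<^sup>2 else 0)"
    unfolding norm_cmat_sq by (intro sum.cong refl) (auto simp: axis_def)
  also have "\<dots> = (\<Sum>a\<in>UNIV. if a = i then (cmod z)\<^sup>2 else 0)"
    by (intro sum.cong refl) (auto simp: sum.delta)
  also have "\<dots> = (cmod z)\<^sup>2" by simp
  finally show "norm (axis i (axis j z) :: 'd cmat) \<le> norm z * 1" by (simp add: power2_eq_iff_nonneg)
qed (auto simp: vec_eq_iff axis_def)

text \<open>Reduces measurability and integrability of matrix valued functions to their entries.\<close>

lemma cmat_expand: "(A :: 'd::finite cmat) = (\<Sum>i\<in>UNIV. \<Sum>j\<in>UNIV. axis i (axis j (A $ i $ j)))"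
proof (rule matrix_eqI)
  fix a b
  have "(\<Sum>i\<in>UNIV. \<Sum>j\<in>UNIV. axis i (axis j (A $ i $ j)) :: 'd cmat) $ a $ b
     = (\<Sum>i\<in>UNIV. \<Sum>j\<in>UNIV. if i = a \<and> j = b then A $ a $ b else 0)"
    unfolding sum_component by (intro sum.cong refl) (auto simp: axis_def)
  also have "\<dots> = (\<Sum>i\<in>UNIV. if i = a then A $ a $ b else 0)"
    by (intro sum.cong refl) (auto simp: sum.delta)
  finally show "A $ a $ b = (\<Sum>i\<in>UNIV. \<Sum>j\<in>UNIV. axis i (axis j (A $ i $ j)) :: 'd cmat) $ a $ b"
    by simp
qed

lemma measurable_entry:
  fixes F :: "'a \<Rightarrow> 'd::finite cmat"
  shows "F \<in> borel_measurable M \<Longrightarrow> (\<lambda>x. F x $ i $ j) \<in> borel_measurable M"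
  by (rule measurable_compose[OF _ borel_measurable_continuous_onI[OF linear_continuous_on[OF bounded_linear_entry]]])

lemma measurable_cmat_iff:
  fixes F :: "'a \<Rightarrow> 'd::finite cmat"
  shows "F \<in> borel_measurable M \<longleftrightarrow> (\<forall>i j. (\<lambda>x. F x $ i $ j) \<in> borel_measurable M)"
proof
  assume *: "\<forall>i j. (\<lambda>x. F x $ i $ j) \<in> borel_measurable M"
  have "(\<lambda>x. \<Sum>i\<in>UNIV. \<Sum>j\<in>UNIV. axis i (axis j (F x $ i $ j)) :: 'd cmat) \<in> borel_measurable M"
    by (intro borel_measurable_sum
        measurable_compose[OF *[rule_format] borel_measurable_continuous_onI[OF linear_continuous_on[OF bounded_linear_unit]]])
  then show "F \<in> borel_measurable M" by (simp flip: cmat_expand)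
qed (auto intro: measurable_entry)

lemma integrable_cmat_iff:
  fixes F :: "'a \<Rightarrow> 'd::finite cmat"
  shows "integrable M F \<longleftrightarrow> (\<forall>i j. integrable M (\<lambda>x. F x $ i $ j))"
proof
  assume "integrable M F"
  then show "\<forall>i j. integrable M (\<lambda>x. F x $ i $ j)"
    using integrable_bounded_linear[OF bounded_linear_entry] by blast
next
  assume *: "\<forall>i j. integrable M (\<lambda>x. F x $ i $ j)"
  have "integrable M (\<lambda>x. \<Sum>i\<in>UNIV. \<Sum>j\<in>UNIV. axis i (axis j (F x $ i $ j)) :: 'd cmat)"
    by (intro Bochner_Integration.integrable_sum integrable_bounded_linear[OF bounded_linear_unit] *[rule_format])
  then show "integrable M F" by (simp flip: cmat_expand)
qed

lemma integral_entry:
  fixes F :: "'a \<Rightarrow> 'd::finite cmat"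
  assumes "integrable M F"
  shows "(\<integral>x. F x \<partial>M) $ i $ j = (\<integral>x. F x $ i $ j \<partial>M)"
  using integral_bounded_linear[OF bounded_linear_entry assms] by simp

lemma L2_iff: "F \<in> L2 M \<longleftrightarrow> (\<forall>i j. entry F i j \<in> sqint M)"
proof
  assume F: "F \<in> L2 M"
  show "\<forall>i j. entry F i j \<in> sqint M"
  proof (intro allI)
    fix i j
    show "entry F i j \<in> sqint M"
      using F by (intro sqint_bound[where h="\<lambda>x. (norm (F x))\<^sup>2"] AE_I2 power_mono norm_entry_le measurable_entry)
        (auto simp: L2_def)
  qed
next
  assume *: "\<forall>i j. entry F i j \<in> sqint M"
  have "integrable M (\<lambda>x. \<Sum>i\<in>UNIV. \<Sum>j\<in>UNIV. (cmod (F x $ i $ j))\<^sup>2)"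
    by (intro Bochner_Integration.integrable_sum sqint_integrable *[rule_format])
  moreover have "F \<in> borel_measurable M"
    unfolding measurable_cmat_iff using * sqint_measurable by blast
  ultimately show "F \<in> L2 M" by (simp add: L2_def norm_cmat_sq)
qed

lemma L2_entry: "F \<in> L2 M \<Longrightarrow> entry F i j \<in> sqint M"
  by (simp add: L2_iff)

lemma L2_measurable: "F \<in> L2 M \<Longrightarrow> F \<in> borel_measurable M"
  by (simp add: L2_def)

lemma L2_add: "F \<in> L2 M \<Longrightarrow> G \<in> L2 M \<Longrightarrow> (\<lambda>x. F x + G x) \<in> L2 M"
  and L2_diff: "F \<in> L2 M \<Longrightarrow> G \<in> L2 M \<Longrightarrow> (\<lambda>x. F x - G x) \<in> L2 M"
  and L2_cscale: "F \<in> L2 M \<Longrightarrow> (\<lambda>x. c *\<^sub>c F x) \<in> L2 M"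
  by (simp_all add: L2_iff sqint_add sqint_diff sqint_cmult)

lemma L2_cong_AE:
  assumes "F \<in> L2 M" "G \<in> borel_measurable M" "AE x in M. F x = G x"
  shows "G \<in> L2 M"
  unfolding L2_iff
proof (intro allI)
  fix i j
  have "AE x in M. F x $ i $ j = G x $ i $ j" using assms(3) by eventually_elim simp
  from sqint_cong_AE[OF L2_entry[OF assms(1)] measurable_entry[OF assms(2)] this]
  show "entry G i j \<in> sqint M" .
qed

lemma AE_entry_iff:
  fixes F G :: "'a \<Rightarrow> 'd::finite cmat"
  shows "(AE x in M. F x = G x) \<longleftrightarrow> (\<forall>i j. AE x in M. F x $ i $ j = G x $ i $ j)"
  by (simp add: vec_eq_iff AE_all_countable)

subsection \<open>The Fourier transform entry by entry\<close>

lemma L2_tendsto_iff: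
  assumes "\<And>n. F n \<in> L2 M" "G \<in> L2 M"
  shows "L2_tendsto M F G sequentially \<longleftrightarrow> (\<forall>i j. sq_tendsto M (\<lambda>n. entry (F n) i j) (entry G i j))"
proof -
  define q where "q i j n = (\<integral>x. (cmod (F n x $ i $ j - G x $ i $ j))\<^sup>2 \<partial>M)" for i j n
  have q0: "0 \<le> q i j n" for i j n by (simp add: q_def)
  have nn: "(\<integral>\<^sup>+x. ennreal ((norm (F n x - G x))\<^sup>2) \<partial>M) = ennreal (\<Sum>i\<in>UNIV. \<Sum>j\<in>UNIV. q i j n)" for n
  proof -
    have i: "integrable M (\<lambda>x. (cmod (F n x $ i $ j - G x $ i $ j))\<^sup>2)" for i j
      by (intro sqint_integrable sqint_diff L2_entry assms)
    have "(\<integral>\<^sup>+x. ennreal ((norm (F n x - G x))\<^sup>2) \<partial>M) = ennreal (\<integral>x. (norm (F n x - G x))\<^sup>2 \<partial>M)"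
      using L2_diff[OF assms(1)[of n] assms(2)] by (intro nn_integral_eq_integral) (auto simp: L2_def)
    also have "(\<integral>x. (norm (F n x - G x))\<^sup>2 \<partial>M) = (\<Sum>i\<in>UNIV. \<Sum>j\<in>UNIV. q i j n)"
      unfolding norm_cmat_sq q_def using i by (simp add: Bochner_Integration.integral_sum)
    finally show ?thesis .
  qed
  have "L2_tendsto M F G sequentially \<longleftrightarrow> (\<lambda>n. \<Sum>i\<in>UNIV. \<Sum>j\<in>UNIV. q i j n) \<longlonglongrightarrow> 0"
    unfolding L2_tendsto_def nn ennreal_0[symmetric]
    by (subst tendsto_ennreal_iff) (auto intro!: always_eventually sum_nonneg q0)
  also have "\<dots> \<longleftrightarrow> (\<forall>i j. q i j \<longlonglongrightarrow> 0)"
  proof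
    assume L: "(\<lambda>n. \<Sum>i\<in>UNIV. \<Sum>j\<in>UNIV. q i j n) \<longlonglongrightarrow> 0"
    show "\<forall>i j. q i j \<longlonglongrightarrow> 0"
    proof (intro allI)
      fix i j
      have "q i j n \<le> (\<Sum>i\<in>UNIV. \<Sum>j\<in>UNIV. q i j n)" for n
      proof -
        have "q i j n \<le> (\<Sum>j\<in>UNIV. q i j n)" by (rule member_le_sum) (auto intro: q0)
        also have "\<dots> \<le> (\<Sum>i\<in>UNIV. \<Sum>j\<in>UNIV. q i j n)"
          by (rule member_le_sum[where f="\<lambda>i. \<Sum>j\<in>UNIV. q i j n"]) (auto intro: q0 sum_nonneg)
        finally show ?thesis .
      qed
      then show "q i j \<longlonglongrightarrow> 0"
        using q0 by (intro tendsto_sandwich[OF _ _ tendsto_const L] always_eventually) simp_all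
    qed
  next
    assume "\<forall>i j. q i j \<longlonglongrightarrow> 0"
    then show "(\<lambda>n. \<Sum>i\<in>UNIV. \<Sum>j\<in>UNIV. q i j n) \<longlonglongrightarrow> 0"
      by (intro tendsto_null_sum) simp
  qed
  finally show ?thesis by (simp add: sq_tendsto_def q_def[abs_def])
qed

lemma partial_ft_entry:
  assumes "F \<in> L2 (\<mu> X)"
  shows "(LINT x : {- real n .. real n} | \<mu> X. cis (- (k * x)) *\<^sub>c F x) $ i $ j
    = partial_ft X n (entry F i j) k"
proof -
  have eq: "(indicat_real {- real n..real n} x *\<^sub>R (cis (- (k * x)) *\<^sub>c F x)) $ a $ b
     = cis (- (k * x)) * truncated n (entry F a b) x" for x a b
    by (simp add: truncated_def scaleR_conv_of_real indicator_def)
  have "integrable (\<mu> X) (\<lambda>x. indicat_real {- real n..real n} x *\<^sub>R (cis (- (k * x)) *\<^sub>c F x))"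
    unfolding integrable_cmat_iff eq by (intro allI integrable_cis_base truncated_integrable_base L2_entry assms)
  then show ?thesis
    unfolding set_lebesgue_integral_def partial_ft_def by (simp only: integral_entry eq)
qed

lemma has_fourier_iff: "has_fourier X F G \<longleftrightarrow> (\<forall>i j. has_ft X (entry F i j) (entry G i j))"
proof (cases "F \<in> L2 (\<mu> X) \<and> G \<in> L2 (\<nu> X)")
  case True
  define P where "P n k = (LINT x : {- real n .. real n} | \<mu> X. cis (- (k * x)) *\<^sub>c F x)" for n k
  have P: "entry (P n) i j = partial_ft X n (entry F i j)" for n i j
    unfolding P_def using partial_ft_entry True by blast
  have "P n \<in> L2 (\<nu> X)" for n
    unfolding L2_iff P using True by (intro allI partial_ft_sqint L2_entry) simp
  from L2_tendsto_iff[OF this] True show ?thesis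
    by (simp add: has_fourier_def has_ft_def P P_def[symmetric] L2_entry)
next
  case False
  then show ?thesis unfolding has_fourier_def L2_iff has_ft_def by blast
qed

lemma has_fourier_fourier:
  assumes "F \<in> L2 (\<mu> X)"
  shows "has_fourier X F (fourier X F)"
proof -
  have "\<forall>i j. \<exists>g. has_ft X (entry F i j) g" using has_ft_exists[OF L2_entry[OF assms]] by blast
  then obtain g where g: "\<And>i j. has_ft X (entry F i j) (g i j)" by metis
  have "has_fourier X F (\<lambda>k. \<chi> i j. g i j k)" unfolding has_fourier_iff using g by simp
  then show ?thesis unfolding fourier_def by (rule someI[of "has_fourier X F"])
qed

lemma has_ft_entry: "F \<in> L2 (\<mu> X) \<Longrightarrow> has_ft X (entry F i j) (entry (fourier X F) i j)"
  using has_fourier_fourier has_fourier_iff by blast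

lemma fourier_L2: "F \<in> L2 (\<mu> X) \<Longrightarrow> fourier X F \<in> L2 (\<nu> X)"
  using has_fourier_fourier has_fourier_def by blast

lemma fourier_AE_eqI:
  assumes "\<And>i j. has_ft X (entry F i j) (entry G i j)"
  shows "AE k in \<nu> X. fourier X F k = G k"
proof -
  have "F \<in> L2 (\<mu> X)" unfolding L2_iff using assms has_ft_sqint by blast
  then show ?thesis unfolding AE_entry_iff using has_ft_unique[OF has_ft_entry assms] by blast
qed

lemma fourier_surj:
  assumes "G \<in> L2 (\<nu> X)"
  obtains F where "F \<in> L2 (\<mu> X)" "AE k in \<nu> X. fourier X F k = G k"
proof -
  have "\<forall>i j. \<exists>f. has_ft X f (entry G i j)" using has_ft_surj[OF L2_entry[OF assms]] by blast
  then obtain f where f: "\<And>i j. has_ft X (f i j) (entry G i j)" by metis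
  define F where "F x = (\<chi> i j. f i j x)" for x
  have F: "has_ft X (entry F i j) (entry G i j)" for i j using f by (simp add: F_def)
  then have "F \<in> L2 (\<mu> X)" unfolding L2_iff using has_ft_sqint by blast
  then show ?thesis using fourier_AE_eqI[OF F] by (rule that)
qed

lemma fourier_inj:
  assumes "F \<in> L2 (\<mu> X)" "G \<in> L2 (\<mu> X)"
    "AE k in \<nu> X. fourier X F k = fourier X G k"
  shows "AE x in \<mu> X. F x = G x"
  unfolding AE_entry_iff
proof (intro allI)
  fix i j
  have "AE k in \<nu> X. fourier X F k $ i $ j = fourier X G k $ i $ j"
    using assms(3) by eventually_elim simp
  from has_ft_inj[OF has_ft_entry[OF assms(1)] has_ft_entry[OF assms(2)] this]
  show "AE x in \<mu> X. F x $ i $ j = G x $ i $ j" .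
qed

lemma fourier_cong:
  assumes "F \<in> L2 (\<mu> X)" "G \<in> L2 (\<mu> X)" "AE x in \<mu> X. F x = G x"
  shows "AE k in \<nu> X. fourier X F k = fourier X G k"
proof (rule fourier_AE_eqI)
  fix i j
  have e: "AE x in \<mu> X. G x $ i $ j = F x $ i $ j" using assms(3) by eventually_elim simp
  show "has_ft X (entry F i j) (entry (fourier X G) i j)"
    by (rule has_ft_cong_AE[OF has_ft_entry[OF assms(2)] _ e])
       (auto intro!: measurable_entry L2_measurable fourier_L2 assms)
qed

lemma fourier_add:
  assumes "F \<in> L2 (\<mu> X)" "G \<in> L2 (\<mu> X)"
  shows "AE k in \<nu> X. fourier X (\<lambda>x. F x + G x) k = fourier X F k + fourier X G k"
  by (rule fourier_AE_eqI) (use assms in \<open>simp add: has_ft_add has_ft_entry\<close>)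

lemma fourier_diff:
  assumes "F \<in> L2 (\<mu> X)" "G \<in> L2 (\<mu> X)"
  shows "AE k in \<nu> X. fourier X (\<lambda>x. F x - G x) k = fourier X F k - fourier X G k"
  by (rule fourier_AE_eqI) (use assms in \<open>simp add: has_ft_diff has_ft_entry\<close>)

lemma fourier_cscale:
  assumes "F \<in> L2 (\<mu> X)"
  shows "AE k in \<nu> X. fourier X (\<lambda>x. c *\<^sub>c F x) k = c *\<^sub>c fourier X F k"
  by (rule fourier_AE_eqI) (use assms in \<open>simp add: has_ft_cmult has_ft_entry\<close>)

lemma L2_inner_eq:
  assumes "F \<in> L2 (\<mu> X)" "G \<in> L2 (\<mu> X)"
  shows "L2_inner X F G = (\<Sum>i\<in>UNIV. \<Sum>j\<in>UNIV. \<integral>x. F x $ i $ j * cnj (G x $ i $ j) \<partial>\<mu> X)"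
proof -
  have "trace (F x ** adjoint_mat (G x)) = (\<Sum>i\<in>UNIV. \<Sum>j\<in>UNIV. F x $ i $ j * cnj (G x $ i $ j))" for x
    by (simp add: trace_def matrix_mult_nth adjoint_mat_def map_matrix_def transpose_def)
  moreover have "integrable (\<mu> X) (\<lambda>x. F x $ i $ j * cnj (G x $ i $ j))" for i j
    by (intro sqint_mult_integrable sqint_cnj L2_entry assms)
  ultimately show ?thesis unfolding L2_inner_def by (simp add: Bochner_Integration.integral_sum)
qed

lemma has_dx_iff: "has_dx X F G \<longleftrightarrow> (\<forall>i j. has_dx_scalar X (entry F i j) (entry G i j))"
proof (cases "F \<in> L2 (\<mu> X) \<and> G \<in> L2 (\<mu> X)")
  case True
  have "((\<integral>x. deriv1 \<phi> x *\<^sub>c F x \<partial>\<mu> X) = - (\<integral>x. \<phi> x *\<^sub>c G x \<partial>\<mu> X))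
     \<longleftrightarrow> (\<forall>i j. (\<integral>x. deriv1 \<phi> x * F x $ i $ j \<partial>\<mu> X) = - (\<integral>x. \<phi> x * G x $ i $ j \<partial>\<mu> X))"
    if \<phi>: "\<phi> \<in> test_functions X" for \<phi>
  proof -
    have s: "\<phi> \<in> sqint (\<mu> X)" "deriv1 \<phi> \<in> sqint (\<mu> X)"
      using test_function_integrable(2)[OF \<phi>, of 0] test_function_integrable(2)[OF \<phi>, of 1] by simp_all
    have i: "integrable (\<mu> X) (\<lambda>x. deriv1 \<phi> x *\<^sub>c F x)" "integrable (\<mu> X) (\<lambda>x. \<phi> x *\<^sub>c G x)"
      unfolding integrable_cmat_iff cscale_nth using True by (auto intro!: sqint_mult_integrable s L2_entry)
    show ?thesis unfolding vec_eq_iff by (simp add: integral_entry[OF i(1)] integral_entry[OF i(2)])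
  qed
  then show ?thesis unfolding has_dx_def has_dx_scalar_def using True by (auto simp: L2_entry)
next
  case False
  then show ?thesis unfolding has_dx_def has_dx_scalar_def L2_iff by blast
qed

subsection \<open>Matrix algebra\<close>

lemma cscale_add: "c *\<^sub>c (A + B) = c *\<^sub>c A + c *\<^sub>c (B :: 'd::finite cmat)"
  and cscale_diff: "c *\<^sub>c (A - B) = c *\<^sub>c A - c *\<^sub>c (B :: 'd::finite cmat)"
  and cscale_cscale: "c *\<^sub>c e *\<^sub>c A = (c * e) *\<^sub>c (A :: 'd::finite cmat)"
  and cscale_zero: "c *\<^sub>c 0 = (0 :: 'd::finite cmat)" "0 *\<^sub>c A = 0"
  and cscale_one: "1 *\<^sub>c A = A"
  and cscale_minus_one: "(-1) *\<^sub>c A = - A"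
  by (rule matrix_eqI; simp add: algebra_simps)+

lemma scaleR_cscale: "r *\<^sub>R A = of_real r *\<^sub>c (A :: 'd::finite cmat)"
  by (rule matrix_eqI, unfold vector_scaleR_component cscale_nth, rule scaleR_conv_of_real)

lemma cscale_mult_left: "(c *\<^sub>c A) ** B = c *\<^sub>c (A ** (B :: 'd::finite cmat))"
  and cscale_mult_right: "A ** (c *\<^sub>c B) = c *\<^sub>c (A ** (B :: 'd::finite cmat))"
  by (rule matrix_eqI; simp add: matrix_mult_nth sum_distrib_left mult_ac)+

lemma matrix_mult_diff: "(A :: 'd::finite cmat) ** (B - C) = A ** B - A ** (C :: 'd cmat)"
  "((B :: 'd cmat) - C) ** A = B ** A - C ** (A :: 'd cmat)"
  by (rule matrix_eqI; simp add: matrix_mult_nth algebra_simps sum_subtractf)+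

lemma matrix_mult_add: "(A :: 'd::finite cmat) ** (B + C) = A ** B + A ** (C :: 'd cmat)"
  "((B :: 'd cmat) + C) ** A = B ** A + C ** (A :: 'd cmat)"
  by (rule matrix_eqI; simp add: matrix_mult_nth algebra_simps sum.distrib)+

lemma norm_matrix_mult_le: "norm ((A :: 'd::finite cmat) ** B) \<le> norm A * norm (B :: 'd cmat)"
proof -
  have "(cmod ((A ** B) $ i $ j))\<^sup>2 \<le> (\<Sum>l\<in>UNIV. (cmod (A $ i $ l))\<^sup>2) * (\<Sum>l\<in>UNIV. (cmod (B $ l $ j))\<^sup>2)" for i j
  proof -
    have "cmod ((A ** B) $ i $ j) \<le> (\<Sum>l\<in>UNIV. cmod (A $ i $ l) * cmod (B $ l $ j))"
      unfolding matrix_mult_nth by (rule order_trans[OF norm_sum]) (simp add: norm_mult)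
    then have "(cmod ((A ** B) $ i $ j))\<^sup>2 \<le> (\<Sum>l\<in>UNIV. cmod (A $ i $ l) * cmod (B $ l $ j))\<^sup>2"
      by (rule power_mono) simp
    also have "\<dots> \<le> (\<Sum>l\<in>UNIV. (cmod (A $ i $ l))\<^sup>2) * (\<Sum>l\<in>UNIV. (cmod (B $ l $ j))\<^sup>2)"
      by (rule Cauchy_Schwarz_ineq_sum)
    finally show ?thesis .
  qed
  then have "(norm (A ** B))\<^sup>2 \<le> (\<Sum>i\<in>UNIV. \<Sum>j\<in>UNIV. (\<Sum>l\<in>UNIV. (cmod (A $ i $ l))\<^sup>2) * (\<Sum>l\<in>UNIV. (cmod (B $ l $ j))\<^sup>2))"
    unfolding norm_cmat_sq by (intro sum_mono)
  also have "\<dots> = (\<Sum>i\<in>UNIV. \<Sum>l\<in>UNIV. (cmod (A $ i $ l))\<^sup>2) * (\<Sum>j\<in>UNIV. \<Sum>l\<in>UNIV. (cmod (B $ l $ j))\<^sup>2)"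
    by (simp add: sum_product)
  also have "\<dots> = (norm A * norm B)\<^sup>2"
    unfolding power_mult_distrib norm_cmat_sq by (subst (2) sum.swap) simp
  finally show ?thesis by (rule power2_le_imp_le) simp
qed

section \<open>Fourier multipliers\<close>

text \<open>\<open>G\<close> is the image of \<open>F\<close> under the multiplier with symbol \<open>m\<close>. This is a relation, not an
  operator, since elements of \<open>L\<^sup>2\<close> are given by representatives and most symbols are unbounded.\<close>

definition fmult :: "base \<Rightarrow> (real \<Rightarrow> complex) \<Rightarrow> 'd::finite field \<Rightarrow> 'd field \<Rightarrow> bool" where
  "fmult X m F G \<longleftrightarrow> F \<in> L2 (\<mu> X) \<and> G \<in> L2 (\<mu> X) \<and>
     (AE k in \<nu> X. fourier X G k = m k *\<^sub>c fourier X F k)"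

lemma fmult_L2: "fmult X m F G \<Longrightarrow> F \<in> L2 (\<mu> X)" "fmult X m F G \<Longrightarrow> G \<in> L2 (\<mu> X)"
  and fmult_AE: "fmult X m F G \<Longrightarrow> AE k in \<nu> X. fourier X G k = m k *\<^sub>c fourier X F k"
  by (auto simp: fmult_def)

lemma fmult_unique:
  assumes "fmult X m F G" "fmult X m F' G'" "AE x in \<mu> X. F x = F' x"
  shows "AE x in \<mu> X. G x = G' x"
proof (rule fourier_inj[OF fmult_L2(2)[OF assms(1)] fmult_L2(2)[OF assms(2)]])
  show "AE k in \<nu> X. fourier X G k = fourier X G' k"
    using fmult_AE[OF assms(1)] fmult_AE[OF assms(2)]
      fourier_cong[OF fmult_L2(1)[OF assms(1)] fmult_L2(1)[OF assms(2)] assms(3)]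
    by eventually_elim simp
qed

lemma fmult_cong:
  assumes "fmult X m F G" "F' \<in> borel_measurable (\<mu> X)" "AE x in \<mu> X. F x = F' x"
    "G' \<in> borel_measurable (\<mu> X)" "AE x in \<mu> X. G x = G' x"
  shows "fmult X m F' G'"
proof -
  note L = fmult_L2[OF assms(1)]
  have F': "F' \<in> L2 (\<mu> X)" by (rule L2_cong_AE[OF L(1) assms(2,3)])
  have G': "G' \<in> L2 (\<mu> X)" by (rule L2_cong_AE[OF L(2) assms(4,5)])
  have "AE k in \<nu> X. fourier X G' k = m k *\<^sub>c fourier X F' k"
    using fmult_AE[OF assms(1)] fourier_cong[OF L(1) F' assms(3)] fourier_cong[OF L(2) G' assms(5)]
    by eventually_elim simp
  then show ?thesis using F' G' by (simp add: fmult_def)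
qed

lemma fmult_add:
  assumes "fmult X m F G" "fmult X m F' G'"
  shows "fmult X m (\<lambda>x. F x + F' x) (\<lambda>x. G x + G' x)"
proof -
  note L = fmult_L2[OF assms(1)] fmult_L2[OF assms(2)]
  have "AE k in \<nu> X. fourier X (\<lambda>x. G x + G' x) k = m k *\<^sub>c fourier X (\<lambda>x. F x + F' x) k"
    using fmult_AE[OF assms(1)] fmult_AE[OF assms(2)] fourier_add[OF L(1,3)] fourier_add[OF L(2,4)]
    by eventually_elim (simp add: cscale_add)
  then show ?thesis using L by (simp add: fmult_def L2_add)
qed

lemma fmult_cscale:
  assumes "fmult X m F G"
  shows "fmult X m (\<lambda>x. c *\<^sub>c F x) (\<lambda>x. c *\<^sub>c G x)"
proof -
  note L = fmult_L2[OF assms(1)]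
  have "AE k in \<nu> X. fourier X (\<lambda>x. c *\<^sub>c G x) k = m k *\<^sub>c fourier X (\<lambda>x. c *\<^sub>c F x) k"
    using fmult_AE[OF assms(1)] fourier_cscale[OF L(1), of c] fourier_cscale[OF L(2), of c]
    by eventually_elim (simp add: cscale_cscale mult.commute)
  then show ?thesis using L by (simp add: fmult_def L2_cscale)
qed

lemma fmult_diff:
  assumes "fmult X m F G" "fmult X m F' G'"
  shows "fmult X m (\<lambda>x. F x - F' x) (\<lambda>x. G x - G' x)"
  using fmult_add[OF assms(1) fmult_cscale[OF assms(2), of "-1"]] by (simp add: cscale_minus_one)

lemma fmult_smult:
  assumes "fmult X m F G"
  shows "fmult X (\<lambda>k. c * m k) F (\<lambda>x. c *\<^sub>c G x)"
proof -
  note L = fmult_L2[OF assms(1)]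
  have "AE k in \<nu> X. fourier X (\<lambda>x. c *\<^sub>c G x) k = (c * m k) *\<^sub>c fourier X F k"
    using fmult_AE[OF assms(1)] fourier_cscale[OF L(2), of c]
    by eventually_elim (simp add: cscale_cscale)
  then show ?thesis using L by (simp add: fmult_def L2_cscale)
qed

text \<open>Symbols commute.\<close>

lemma fmult_commute:
  assumes "fmult X m F G" "fmult X n F H" "fmult X m H K"
  shows "fmult X n G K"
proof -
  have "AE k in \<nu> X. fourier X K k = n k *\<^sub>c fourier X G k"
    using fmult_AE[OF assms(1)] fmult_AE[OF assms(2)] fmult_AE[OF assms(3)]
    by eventually_elim (simp add: cscale_cscale mult.commute)
  then show ?thesis using fmult_L2[OF assms(1)] fmult_L2[OF assms(3)] by (simp add: fmult_def)
qed

lemma fmult_exists: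
  assumes F: "F \<in> L2 (\<mu> X)" and m: "(\<lambda>k. m k *\<^sub>c fourier X F k) \<in> L2 (\<nu> X)"
  obtains G where "fmult X m F G"
proof -
  from fourier_surj[OF m] obtain G where "G \<in> L2 (\<mu> X)"
    "AE k in \<nu> X. fourier X G k = m k *\<^sub>c fourier X F k" by blast
  with F show ?thesis by (intro that) (simp add: fmult_def)
qed

lemma L2_cscale_dominated:
  assumes F: "(\<lambda>k. w k *\<^sub>c F k) \<in> L2 N" "F \<in> L2 N" and m: "m \<in> borel_measurable N"
    and le: "\<And>k. cmod (m k) \<le> cmod (w k)"
  shows "(\<lambda>k. m k *\<^sub>c F k) \<in> L2 N"
  unfolding L2_iff cscale_nth
proof (intro allI)
  fix i j
  have "(\<lambda>k. w k * F k $ i $ j) \<in> sqint N" using L2_entry[OF F(1)] by simp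
  note w = sqint_integrable[OF this]
  show "(\<lambda>k. m k * F k $ i $ j) \<in> sqint N"
  proof (rule sqint_bound[OF _ w])
    show "(\<lambda>k. m k * F k $ i $ j) \<in> borel_measurable N"
      by (rule borel_measurable_times[OF m sqint_measurable[OF L2_entry[OF F(2)]]])
    have "cmod (m k * F k $ i $ j) \<le> cmod (w k * F k $ i $ j)" for k
      unfolding norm_mult by (rule mult_right_mono[OF le]) simp
    then show "AE k in N. (cmod (m k * F k $ i $ j))\<^sup>2 \<le> (cmod (w k * F k $ i $ j))\<^sup>2"
      by (intro AE_I2 power_mono) simp_all
  qed
qed

lemma borel_measurable_freq: "m \<in> borel_measurable borel \<Longrightarrow> m \<in> borel_measurable (\<nu> X)"
  by (cases X) auto

subsection \<open>Functions with restricted spectrum\<close>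

definition spec_in :: "base \<Rightarrow> real set \<Rightarrow> 'd::finite field \<Rightarrow> bool" where
  "spec_in X S F \<longleftrightarrow> F \<in> L2 (\<mu> X) \<and> (AE k in \<nu> X. k \<notin> S \<longrightarrow> fourier X F k = 0)"

lemma hardy_eq_spec_in: "hardy X = Collect (spec_in X {0..})"
  by (auto simp: hardy_def spec_in_def not_le)

lemma spec_in_L2: "spec_in X S F \<Longrightarrow> F \<in> L2 (\<mu> X)"
  by (simp add: spec_in_def)

lemma spec_in_diff:
  assumes "spec_in X S F" "spec_in X S G"
  shows "spec_in X S (\<lambda>x. F x - G x)"
proof -
  have "AE k in \<nu> X. k \<notin> S \<longrightarrow> fourier X (\<lambda>x. F x - G x) k = 0"
    using fourier_diff[OF spec_in_L2[OF assms(1)] spec_in_L2[OF assms(2)]]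
      conjunct2[OF assms(1)[unfolded spec_in_def]] conjunct2[OF assms(2)[unfolded spec_in_def]]
    by eventually_elim auto
  then show ?thesis using assms by (simp add: spec_in_def L2_diff)
qed

lemma fmult_spec_in:
  assumes "fmult X m F G" "spec_in X S F"
  shows "spec_in X S G"
proof -
  have "AE k in \<nu> X. k \<notin> S \<longrightarrow> fourier X G k = 0"
    using fmult_AE[OF assms(1)] conjunct2[OF assms(2)[unfolded spec_in_def]]
    by eventually_elim (auto simp: cscale_zero)
  then show ?thesis using fmult_L2[OF assms(1)] by (simp add: spec_in_def)
qed

lemma fmult_support:
  assumes "fmult X m F G" "\<And>k. k \<notin> S \<Longrightarrow> m k = 0"
  shows "spec_in X S G"
proof -
  have "AE k in \<nu> X. k \<notin> S \<longrightarrow> fourier X G k = 0"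
    using fmult_AE[OF assms(1)] by eventually_elim (auto simp: cscale_zero assms(2))
  then show ?thesis using fmult_L2[OF assms(1)] by (simp add: spec_in_def)
qed

text \<open>For fixed \<open>k\<close>, the function \<open>cis (- k x) g x\<close> has the transform \<open>l \<mapsto> G (l + k)\<close>, and the pairing
  formula applies to it and \<open>f\<close>.\<close>

lemma has_ft_product_integral:
  assumes f: "has_ft X f F" and g: "has_ft X g G" and k: "k \<in> space (\<nu> X)"
  shows "(\<integral>x. cis (- (k * x)) * (f x * g x) \<partial>\<mu> X) = (\<integral>l. F l * G (k - l) \<partial>\<nu> X) / (2 * pi)"
proof -
  have "- k \<in> space (\<nu> X)" using k by (cases X) auto
  from has_ft_modulate[OF g this] have "has_ft X (\<lambda>x. cis (- k * x) * g x) (\<lambda>l. G (l + k))" by simp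
  from has_ft_pairing[OF f this] show ?thesis by (simp add: mult.left_commute)
qed

text \<open>The products of single entries are integrable, and the formula for their integrals against characters is
  summed over the inner index.\<close>

lemma fourier_product:
  assumes F: "F \<in> L2 (\<mu> X)" and G: "G \<in> L2 (\<mu> X)"
    and P: "(\<lambda>x. F x ** G x) \<in> L2 (\<mu> X)"
  shows "AE k in \<nu> X. \<forall>i j. fourier X (\<lambda>x. F x ** G x) k $ i $ j
    = (\<Sum>l\<in>UNIV. \<integral>t. fourier X F t $ i $ l * fourier X G (k - t) $ l $ j \<partial>\<nu> X) / (2 * pi)"
  unfolding AE_all_countable
proof (intro allI)
  fix i j
  have int: "integrable (\<mu> X) (\<lambda>x. F x $ i $ l * G x $ l $ j)" for l
    by (intro sqint_mult_integrable L2_entry F G)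
  have "integrable (\<mu> X) (entry (\<lambda>x. F x ** G x) i j)"
    unfolding matrix_mult_nth by (intro Bochner_Integration.integrable_sum int)
  from has_ft_integrable[OF has_ft_entry[OF P] this] AE_space
  show "AE k in \<nu> X. fourier X (\<lambda>x. F x ** G x) k $ i $ j
    = (\<Sum>l\<in>UNIV. \<integral>t. fourier X F t $ i $ l * fourier X G (k - t) $ l $ j \<partial>\<nu> X) / (2 * pi)"
  proof eventually_elim
    case (elim k)
    have "(\<integral>x. cis (- (k * x)) * (F x ** G x) $ i $ j \<partial>\<mu> X)
       = (\<Sum>l\<in>UNIV. \<integral>x. cis (- (k * x)) * (F x $ i $ l * G x $ l $ j) \<partial>\<mu> X)"
      unfolding matrix_mult_nth sum_distrib_left
      by (intro Bochner_Integration.integral_sum integrable_cis_base int)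
    also have "\<dots> = (\<Sum>l\<in>UNIV. (\<integral>t. fourier X F t $ i $ l * fourier X G (k - t) $ l $ j \<partial>\<nu> X) / (2 * pi))"
      by (intro sum.cong refl has_ft_product_integral has_ft_entry F G elim(2))
    finally show ?case unfolding elim(1) by (simp only: sum_divide_distrib)
  qed
qed

lemma freq_reflect:
  assumes "k \<in> space (\<nu> X)"
  shows "(\<lambda>t. k - t) \<in> \<nu> X \<rightarrow>\<^sub>M \<nu> X"
    and "distr (\<nu> X) (\<nu> X) (\<lambda>t. k - t) = \<nu> X"
proof -
  have eq: "(\<lambda>t. k - t) = uminus \<circ> (\<lambda>t. t - k)" by auto
  show "(\<lambda>t. k - t) \<in> \<nu> X \<rightarrow>\<^sub>M \<nu> X"
    unfolding eq by (rule measurable_comp[OF freq_shift(1)[OF assms] freq_uminus(1)])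
  show "distr (\<nu> X) (\<nu> X) (\<lambda>t. k - t) = \<nu> X"
    unfolding eq distr_distr[OF freq_uminus(1) freq_shift(1)[OF assms], symmetric]
      freq_shift(2)[OF assms] by (rule freq_uminus(2))
qed

text \<open>If \<open>k\<close> is not in \<open>S\<close>, then for each \<open>t\<close> one of \<open>t\<close> and \<open>k - t\<close> is not in \<open>S\<close>, and the
  integrand of the convolution vanishes. The two cases of interest are the nonnegative and the negative
  frequencies.\<close>

lemma spec_in_product:
  assumes F: "spec_in X S F" and G: "spec_in X S G" and S: "\<And>a b. a \<in> S \<Longrightarrow> b \<in> S \<Longrightarrow> a + b \<in> S"
    and P: "(\<lambda>x. F x ** G x) \<in> L2 (\<mu> X)"
  shows "spec_in X S (\<lambda>x. F x ** G x)"
proof -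
  have "AE k in \<nu> X. k \<notin> S \<longrightarrow> fourier X (\<lambda>x. F x ** G x) k = 0"
    using fourier_product[OF spec_in_L2[OF F] spec_in_L2[OF G] P] AE_space
  proof eventually_elim
    case (elim k)
    show ?case
    proof
      assume k: "k \<notin> S"
      have "AE t in \<nu> X. fourier X F t $ i $ l * fourier X G (k - t) $ l $ j = 0" for i l j
        using conjunct2[OF F[unfolded spec_in_def]]
          AE_distr_invariant[OF freq_reflect[OF elim(2)] conjunct2[OF G[unfolded spec_in_def]]]
      proof eventually_elim
        case (elim t)
        have "t \<notin> S \<or> k - t \<notin> S" using S[of t "k - t"] k by auto
        with elim show ?case by auto
      qed
      then have "(\<integral>t. fourier X F t $ i $ l * fourier X G (k - t) $ l $ j \<partial>\<nu> X) = 0" for i l j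
        by (rule integral_eq_zero_AE)
      then show "fourier X (\<lambda>x. F x ** G x) k = 0"
        using elim(1) by (intro matrix_eqI) simp
    qed
  qed
  then show ?thesis using P by (simp add: spec_in_def)
qed

subsection \<open>Derivatives\<close>

abbreviation is_D :: "base \<Rightarrow> 'd::finite field \<Rightarrow> 'd field \<Rightarrow> bool" where
  "is_D X F G \<equiv> fmult X complex_of_real F G"

lemma has_dx_iff_fmult: "has_dx X F G \<longleftrightarrow> fmult X (\<lambda>k. \<i> * k) F G"
proof (cases "F \<in> L2 (\<mu> X) \<and> G \<in> L2 (\<mu> X)")
  case True
  have "has_dx_scalar X (entry F i j) (entry G i j)
     \<longleftrightarrow> (AE k in \<nu> X. fourier X G k $ i $ j = \<i> * k * fourier X F k $ i $ j)" for i j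
    using has_dx_scalarI_has_ft[OF has_ft_entry has_ft_entry] has_dx_scalarD_has_ft[OF _ has_ft_entry has_ft_entry] True by blast
  then show ?thesis using True unfolding has_dx_iff fmult_def AE_entry_iff by simp
next
  case False
  then show ?thesis unfolding has_dx_def fmult_def by blast
qed

lemma has_dx_iff_is_D: "has_dx X F (\<lambda>x. \<i> *\<^sub>c G x) \<longleftrightarrow> is_D X F G"
proof
  assume "has_dx X F (\<lambda>x. \<i> *\<^sub>c G x)"
  then have "fmult X (\<lambda>k. \<i> * k) F (\<lambda>x. \<i> *\<^sub>c G x)" by (simp add: has_dx_iff_fmult)
  from fmult_smult[OF this, of "- \<i>"] show "is_D X F G"
    by (simp add: cscale_cscale cscale_one flip: mult.assoc)
next
  assume "is_D X F G"
  from fmult_smult[OF this, of \<i>] show "has_dx X F (\<lambda>x. \<i> *\<^sub>c G x)"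
    by (simp add: has_dx_iff_fmult)
qed

lemma is_D_D_op:
  assumes "is_D X F G"
  shows "is_D X F (D_op X F)"
  unfolding D_op_def has_dx_iff_is_D using assms by (rule someI[of "is_D X F"])

lemma lax_dom_iff: "F \<in> lax_dom X \<longleftrightarrow> F \<in> hardy X \<and> (\<exists>G. is_D X F G)"
  unfolding lax_dom_def has_dx_iff_is_D hardy_eq_spec_in using fmult_spec_in by blast

text \<open>Under the integral of the convolution, \<open>k = t + (k - t)\<close>.\<close>

lemma Leibniz:
  assumes F: "is_D X F F'" and G: "is_D X G G'"
    and L: "(\<lambda>x. F x ** G x) \<in> L2 (\<mu> X)" "(\<lambda>x. F' x ** G x) \<in> L2 (\<mu> X)"
      "(\<lambda>x. F x ** G' x) \<in> L2 (\<mu> X)"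
  shows "is_D X (\<lambda>x. F x ** G x) (\<lambda>x. F' x ** G x + F x ** G' x)"
proof -
  note FL = fmult_L2[OF F] and GL = fmult_L2[OF G]
  have "AE k in \<nu> X. fourier X (\<lambda>x. F' x ** G x + F x ** G' x) k = of_real k *\<^sub>c fourier X (\<lambda>x. F x ** G x) k"
    using fourier_product[OF FL(1) GL(1) L(1)] fourier_product[OF FL(2) GL(1) L(2)]
      fourier_product[OF FL(1) GL(2) L(3)] fourier_add[OF L(2,3)] AE_space
  proof eventually_elim
    case (elim k)
    note R = freq_reflect[OF elim(5)]
    define a where "a i l j t = fourier X F t $ i $ l * fourier X G (k - t) $ l $ j" for i l j t
    define b where "b i l j t = fourier X F' t $ i $ l * fourier X G (k - t) $ l $ j" for i l j t
    define c where "c i l j t = fourier X F t $ i $ l * fourier X G' (k - t) $ l $ j" for i l j t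
    have int: "integrable (\<nu> X) (a i l j)" "integrable (\<nu> X) (b i l j)"
      "integrable (\<nu> X) (c i l j)" for i l j
    proof -
      have s: "(\<lambda>t. fourier X H (k - t) $ l $ j) \<in> sqint (\<nu> X)" if "H \<in> L2 (\<mu> X)" for H l j
        using sqint_distr[OF R L2_entry[OF fourier_L2[OF that]]] .
      have f: "(\<lambda>t. fourier X H t $ i $ l) \<in> sqint (\<nu> X)" if "H \<in> L2 (\<mu> X)" for H i l
        by (rule L2_entry[OF fourier_L2[OF that]])
      show "integrable (\<nu> X) (a i l j)"
        unfolding a_def by (rule sqint_mult_integrable[OF f[OF FL(1)] s[OF GL(1)]])
      show "integrable (\<nu> X) (b i l j)"
        unfolding b_def by (rule sqint_mult_integrable[OF f[OF FL(2)] s[OF GL(1)]])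
      show "integrable (\<nu> X) (c i l j)"
        unfolding c_def by (rule sqint_mult_integrable[OF f[OF FL(1)] s[OF GL(2)]])
    qed
    have "(\<integral>t. b i l j t \<partial>\<nu> X) + (\<integral>t. c i l j t \<partial>\<nu> X) = k * (\<integral>t. a i l j t \<partial>\<nu> X)" for i l j
    proof -
      have "AE t in \<nu> X. b i l j t + c i l j t = k * a i l j t"
        using fmult_AE[OF F] AE_distr_invariant[OF R fmult_AE[OF G]]
        by eventually_elim (simp add: a_def b_def c_def algebra_simps)
      then have "(\<integral>t. b i l j t + c i l j t \<partial>\<nu> X) = (\<integral>t. k * a i l j t \<partial>\<nu> X)"
        by (intro integral_cong_AE borel_measurable_integrable Bochner_Integration.integrable_add integrable_mult_right int)
      then show ?thesis using int by simp
    qed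
    note bc = this
    show ?case
    proof (rule matrix_eqI)
      fix i j
      have "fourier X (\<lambda>x. F' x ** G x + F x ** G' x) k $ i $ j
         = (\<Sum>l\<in>UNIV. \<integral>t. b i l j t \<partial>\<nu> X) / (2 * pi) + (\<Sum>l\<in>UNIV. \<integral>t. c i l j t \<partial>\<nu> X) / (2 * pi)"
        by (simp only: elim(4) vector_add_component elim(2)[rule_format] elim(3)[rule_format] b_def c_def)
      also have "\<dots> = (\<Sum>l\<in>UNIV. k * (\<integral>t. a i l j t \<partial>\<nu> X)) / (2 * pi)"
        by (simp only: add_divide_distrib[symmetric] sum.distrib[symmetric] bc)
      also have "\<dots> = k * ((\<Sum>l\<in>UNIV. \<integral>t. a i l j t \<partial>\<nu> X) / (2 * pi))"
        by (simp only: sum_distrib_left[symmetric] times_divide_eq_right)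
      also have "\<dots> = (of_real k *\<^sub>c fourier X (\<lambda>x. F x ** G x) k) $ i $ j"
        by (simp only: cscale_nth a_def elim(1)[rule_format])
      finally show "fourier X (\<lambda>x. F' x ** G x + F x ** G' x) k $ i $ j = (of_real k *\<^sub>c fourier X (\<lambda>x. F x ** G x) k) $ i $ j" .
    qed
  qed
  then show ?thesis using L by (simp add: fmult_def L2_add)
qed

text \<open>Summing the integrable function \<open>1 / (1 + x\<^sup>2)\<close> over the translates of the unit interval
  bounds the sum over the integers.\<close>

lemma inverse_1_plus_square_freq: "integrable (\<nu> X) (\<lambda>k::real. 1 / (1 + k\<^sup>2))"
proof (cases X)
  case Line
  then show ?thesis using inverse_1_plus_square_integrable by simp
next
  case Torus
  \<comment> \<open>The factor 3 compensates for a shift by \<open>\<theta> \<in> [0, 1)\<close>: \<open>1 + (\<theta> + k)\<^sup>2 \<le> 3 (1 + k\<^sup>2)\<close>.\<close>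
  define \<phi> where "\<phi> x = ennreal (3 * (1 / (1 + x\<^sup>2)))" for x :: real
  define s where "s = (\<integral>\<^sup>+k. ennreal (1 / (1 + k\<^sup>2)) \<partial>count_space (\<int>::real set))"
  have [measurable]: "\<phi> \<in> borel_measurable borel" unfolding \<phi>_def by measurable
  have pos: "1 + x\<^sup>2 > 0" for x :: real by (simp add: add_pos_nonneg)
  have "s \<le> (\<integral>\<^sup>+k. \<phi> (\<theta> + k) \<partial>count_space \<int>)" if \<theta>: "\<theta> \<in> {0..<1}" for \<theta>
    unfolding s_def
  proof (rule nn_integral_mono)
    fix k :: real
    have lin: "1 + y \<le> 3 + 3 * b" if "a \<le> 1" "0 \<le> s" "y = 2 * a + 2 * b - s" "0 \<le> b" for a b s y :: real
      using that by linarith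
    have "\<theta>\<^sup>2 \<le> 1" using \<theta> by (auto simp: power_le_one)
    moreover have "(\<theta> + k)\<^sup>2 = 2 * \<theta>\<^sup>2 + 2 * k\<^sup>2 - (\<theta> - k)\<^sup>2"
      by (simp add: power2_eq_square algebra_simps)
    ultimately have "1 + (\<theta> + k)\<^sup>2 \<le> 3 + 3 * k\<^sup>2"
      by (rule lin[OF _ zero_le_power2 _ zero_le_power2])
    then have "1 / (1 + k\<^sup>2) \<le> 3 * (1 / (1 + (\<theta> + k)\<^sup>2))"
      using pos[of k] pos[of "\<theta> + k"] by (simp add: field_simps)
    then show "ennreal (1 / (1 + k\<^sup>2)) \<le> \<phi> (\<theta> + k)" unfolding \<phi>_def by (rule ennreal_leI)
  qed
  then have "(\<integral>\<^sup>+\<theta>. indicator {0..<1::real} \<theta> * s \<partial>lborel)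
      \<le> (\<integral>\<^sup>+\<theta>. indicator {0..<1} \<theta> * (\<integral>\<^sup>+k. \<phi> (\<theta> + k) \<partial>count_space \<int>) \<partial>lborel)"
    by (intro nn_integral_mono) (auto split: split_indicator)
  also have "\<dots> = (\<integral>\<^sup>+x. \<phi> x \<partial>lborel)"
    by (rule nn_integral_periodization[symmetric]) measurable
  also have "\<dots> < \<infinity>"
  proof -
    have int3: "integrable lborel (\<lambda>x::real. 3 * (1 / (1 + x\<^sup>2)))"
      by (intro integrable_mult_right inverse_1_plus_square_integrable)
    have nonneg: "AE x in lborel. 0 \<le> 3 * (1 / (1 + x\<^sup>2 :: real))"
      using pos by (intro AE_I2) (simp add: less_imp_le)
    show ?thesis unfolding \<phi>_def nn_integral_eq_integral[OF int3 nonneg] by simp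
  qed
  finally have "s < \<infinity>" by (simp add: nn_integral_multc)
  then show ?thesis using Torus by (simp add: integrable_iff_bounded s_def add_nonneg_nonneg)
qed

text \<open>One derivative in \<open>L\<^sup>2\<close> makes the Fourier transform integrable, and hence the function bounded.\<close>

lemma is_D_bounded:
  assumes "is_D X F F'"
  shows "\<exists>C. AE x in \<mu> X. norm (F x) \<le> C"
proof -
  note L = fmult_L2[OF assms]
  have "\<exists>C. AE x in \<mu> X. cmod (F x $ i $ j) \<le> C" for i j
  proof -
    define f where "f = entry (fourier X F) i j"
    define f' where "f' = entry (fourier X F') i j"
    have s: "f \<in> sqint (\<nu> X)" "f' \<in> sqint (\<nu> X)"
      unfolding f_def f'_def by (intro L2_entry fourier_L2 L)+
    have "integrable (\<nu> X) f"
    proof (rule Bochner_Integration.integrable_bound[where f="\<lambda>k. 1 / (1 + k\<^sup>2) + ((cmod (f k))\<^sup>2 + (cmod (f' k))\<^sup>2)"])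
      show "integrable (\<nu> X) (\<lambda>k. 1 / (1 + k\<^sup>2) + ((cmod (f k))\<^sup>2 + (cmod (f' k))\<^sup>2))"
        by (intro Bochner_Integration.integrable_add inverse_1_plus_square_freq sqint_integrable s)
      show "AE k in \<nu> X. norm (f k) \<le> norm (1 / (1 + k\<^sup>2) + ((cmod (f k))\<^sup>2 + (cmod (f' k))\<^sup>2))"
        using fmult_AE[OF assms]
      proof eventually_elim
        case (elim k)
        have f': "f' k = of_real k * f k" by (simp add: f_def f'_def elim)
        define w where "w = 1 + k\<^sup>2"
        have w: "w > 0" by (simp add: w_def add_pos_nonneg)
        have "0 \<le> (1 / sqrt w - sqrt w * cmod (f k))\<^sup>2" by simp
        also have "\<dots> = 1 / w + w * (cmod (f k))\<^sup>2 - 2 * cmod (f k)"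
          using w by (simp add: power2_diff power_divide power_mult_distrib)
        finally have "2 * cmod (f k) \<le> 1 / w + w * (cmod (f k))\<^sup>2" by simp
        moreover have "w * (cmod (f k))\<^sup>2 = (cmod (f k))\<^sup>2 + (cmod (f' k))\<^sup>2"
          by (simp add: w_def f' norm_mult power_mult_distrib algebra_simps)
        moreover have "0 \<le> 1 / w" "0 \<le> cmod (f k)" using w by auto
        ultimately show ?case unfolding w_def[symmetric] real_norm_def by linarith
      qed
    qed (use s in auto)
    from has_ft_bounded[OF has_ft_entry[OF L(1), of i j, folded f_def] this] show ?thesis by blast
  qed
  then obtain C where C: "\<And>i j. AE x in \<mu> X. cmod (F x $ i $ j) \<le> C i j" by metis
  have "AE x in \<mu> X. \<forall>i j. cmod (F x $ i $ j) \<le> C i j"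
    unfolding AE_all_countable using C by blast
  then have "AE x in \<mu> X. norm (F x) \<le> sqrt (\<Sum>i\<in>UNIV. \<Sum>j\<in>UNIV. (C i j)\<^sup>2)"
  proof eventually_elim
    case (elim x)
    have "(norm (F x))\<^sup>2 \<le> (\<Sum>i\<in>UNIV. \<Sum>j\<in>UNIV. (C i j)\<^sup>2)"
      unfolding norm_cmat_sq using elim by (intro sum_mono power_mono) auto
    then show ?case by (rule real_le_rsqrt)
  qed
  then show ?thesis by blast
qed

lemma measurable_matrix_mult:
  fixes F G :: "'a \<Rightarrow> 'd::finite cmat"
  assumes "F \<in> borel_measurable M" "G \<in> borel_measurable M"
  shows "(\<lambda>x. F x ** G x) \<in> borel_measurable M"
  unfolding measurable_cmat_iff matrix_mult_nth
  by (intro allI borel_measurable_sum borel_measurable_times measurable_entry assms)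

lemma L2_bound:
  fixes F :: "real \<Rightarrow> 'd::finite cmat"
  assumes "F \<in> borel_measurable M" "integrable M h" "AE x in M. (norm (F x))\<^sup>2 \<le> h x"
  shows "F \<in> L2 M"
proof -
  have "integrable M (\<lambda>x. (norm (F x))\<^sup>2)"
    by (rule Bochner_Integration.integrable_bound[OF assms(2)]) (use assms in auto)
  then show ?thesis using assms(1) by (simp add: L2_def)
qed

lemma L2_integrable: "F \<in> L2 M \<Longrightarrow> integrable M (\<lambda>x. (norm (F x))\<^sup>2)"
  by (simp add: L2_def)

lemma norm_mult_sq_le:
  assumes "norm (A :: 'd::finite cmat) \<le> C"
  shows "(norm (A ** B))\<^sup>2 \<le> C\<^sup>2 * (norm B)\<^sup>2" "(norm (B ** A))\<^sup>2 \<le> C\<^sup>2 * (norm B)\<^sup>2"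
proof -
  have C: "0 \<le> C" using norm_ge_zero assms by (rule order_trans)
  have "norm (A ** B) \<le> C * norm B" "norm (B ** A) \<le> C * norm B"
    using norm_matrix_mult_le[of A B] norm_matrix_mult_le[of B A] mult_right_mono[OF assms, of "norm B"]
    by (auto simp: mult.commute)
  then show "(norm (A ** B))\<^sup>2 \<le> C\<^sup>2 * (norm B)\<^sup>2" "(norm (B ** A))\<^sup>2 \<le> C\<^sup>2 * (norm B)\<^sup>2"
    unfolding power_mult_distrib[symmetric] by (intro power_mono; simp)+
qed

lemma L2_mult_bounded:
  assumes F: "F \<in> L2 M" and G: "G \<in> L2 M" "\<exists>C. AE x in M. norm (G x) \<le> C"
  shows "(\<lambda>x. G x ** F x) \<in> L2 M" "(\<lambda>x. F x ** G x) \<in> L2 M"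
proof -
  obtain C where C: "AE x in M. norm (G x) \<le> C" using G(2) by blast
  have i: "integrable M (\<lambda>x. C\<^sup>2 * (norm (F x))\<^sup>2)" by (intro integrable_mult_right L2_integrable F)
  show "(\<lambda>x. G x ** F x) \<in> L2 M"
    by (rule L2_bound[OF measurable_matrix_mult i]) (use C F G in \<open>auto intro: L2_measurable norm_mult_sq_le elim: eventually_mono\<close>)
  show "(\<lambda>x. F x ** G x) \<in> L2 M"
    by (rule L2_bound[OF measurable_matrix_mult i]) (use C F G in \<open>auto intro: L2_measurable norm_mult_sq_le elim: eventually_mono\<close>)
qed

lemma is_D_mult_L2:
  assumes "is_D X G G'" "F \<in> L2 (\<mu> X)"
  shows "(\<lambda>x. G x ** F x) \<in> L2 (\<mu> X)" "(\<lambda>x. F x ** G x) \<in> L2 (\<mu> X)"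
  by (rule L2_mult_bounded[OF assms(2) fmult_L2(1)[OF assms(1)] is_D_bounded[OF assms(1)]])+

lemma is_D_mult:
  assumes "is_D X F F'" "is_D X G G'"
  shows "is_D X (\<lambda>x. F x ** G x) (\<lambda>x. F' x ** G x + F x ** G' x)"
  using assms fmult_L2 is_D_mult_L2 by (intro Leibniz) blast+

section \<open>The projector onto the Hardy space\<close>

definition nonneg_symbol :: "real \<Rightarrow> complex" where
  "nonneg_symbol k = (if k < 0 then 0 else 1)"

lemma Parseval_cmat:
  assumes "F \<in> L2 (\<mu> X)"
  shows "(\<integral>x. (norm (F x))\<^sup>2 \<partial>\<mu> X) = (\<integral>k. (norm (fourier X F k))\<^sup>2 \<partial>\<nu> X) / (2 * pi)"
proof -
  have i: "integrable (\<mu> X) (\<lambda>x. (cmod (F x $ i $ j))\<^sup>2)"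
    "integrable (\<nu> X) (\<lambda>x. (cmod (fourier X F x $ i $ j))\<^sup>2)" for i j
    by (intro sqint_integrable L2_entry fourier_L2 assms)+
  have "(\<integral>x. (norm (F x))\<^sup>2 \<partial>\<mu> X) = (\<Sum>i\<in>UNIV. \<Sum>j\<in>UNIV. \<integral>x. (cmod (F x $ i $ j))\<^sup>2 \<partial>\<mu> X)"
    unfolding norm_cmat_sq using i by (simp add: Bochner_Integration.integral_sum)
  also have "\<dots> = (\<Sum>i\<in>UNIV. \<Sum>j\<in>UNIV. \<integral>k. (cmod (fourier X F k $ i $ j))\<^sup>2 \<partial>\<nu> X) / (2 * pi)"
    unfolding has_ft_norm[OF has_ft_entry[OF assms]] by (simp add: sum_divide_distrib)
  also have "(\<Sum>i\<in>UNIV. \<Sum>j\<in>UNIV. \<integral>k. (cmod (fourier X F k $ i $ j))\<^sup>2 \<partial>\<nu> X) = (\<integral>k. (norm (fourier X F k))\<^sup>2 \<partial>\<nu> X)"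
    unfolding norm_cmat_sq using i by (simp add: Bochner_Integration.integral_sum)
  finally show ?thesis .
qed

text \<open>The function with transform \<open>nonneg_symbol k * G k\<close> satisfies the orthogonality that specifies the
  projection, and this specification has only one solution up to null sets.\<close>

lemma hardy_proj_fmult:
  assumes G: "G \<in> L2 (\<mu> X)"
  shows "fmult X nonneg_symbol G (hardy_proj X G)"
proof -
  have "(\<lambda>k. nonneg_symbol k *\<^sub>c fourier X G k) \<in> L2 (\<nu> X)"
  proof (rule L2_cscale_dominated[where w="\<lambda>_. 1"])
    show "nonneg_symbol \<in> borel_measurable (\<nu> X)"
      unfolding nonneg_symbol_def[abs_def] by (intro borel_measurable_freq) measurable
  qed (auto simp: cscale_one fourier_L2 G nonneg_symbol_def)
  then obtain P0 where P0: "fmult X nonneg_symbol G P0" using fmult_exists[OF G] by blast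
  have P0h: "spec_in X {0..} P0" by (rule fmult_support[OF P0]) (simp add: nonneg_symbol_def)
  note P0L = spec_in_L2[OF P0h]
  have orth: "L2_inner X (\<lambda>x. G x - P0 x) K = 0" if K: "spec_in X {0..} K" for K
  proof -
    note KL = spec_in_L2[OF K]
    have "(\<integral>x. (G x - P0 x) $ i $ j * cnj (K x $ i $ j) \<partial>\<mu> X) = 0" for i j
    proof -
      have "AE k in \<nu> X. fourier X (\<lambda>x. G x - P0 x) k $ i $ j * cnj (fourier X K k $ i $ j) = 0"
        using fourier_diff[OF G P0L] fmult_AE[OF P0] conjunct2[OF K[unfolded spec_in_def]]
        by eventually_elim (auto simp: nonneg_symbol_def)
      then have "(\<integral>k. fourier X (\<lambda>x. G x - P0 x) k $ i $ j * cnj (fourier X K k $ i $ j) \<partial>\<nu> X) = 0"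
        by (rule integral_eq_zero_AE)
      then show ?thesis
        using has_ft_pairing_cnj[OF has_ft_entry[OF L2_diff[OF G P0L]] has_ft_entry[OF KL]] by simp
    qed
    then show ?thesis unfolding L2_inner_eq[OF L2_diff[OF G P0L] KL] by simp
  qed
  define P where "P = hardy_proj X G"
  have "P \<in> hardy X \<and> (\<forall>K \<in> hardy X. L2_inner X (\<lambda>x. G x - P x) K = 0)"
    unfolding P_def hardy_proj_def
    by (rule someI[where P="\<lambda>P. P \<in> hardy X \<and> (\<forall>K \<in> hardy X. L2_inner X (\<lambda>x. G x - P x) K = 0)"])
       (use P0h orth in \<open>auto simp: hardy_eq_spec_in\<close>)
  then have P: "spec_in X {0..} P" and Porth: "\<And>K. spec_in X {0..} K \<Longrightarrow> L2_inner X (\<lambda>x. G x - P x) K = 0"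
    by (auto simp: hardy_eq_spec_in)
  note PL = spec_in_L2[OF P]
  \<comment> \<open>The difference lies in the Hardy space and is orthogonal to it.\<close>
  define d where "d x = P x - P0 x" for x
  have ds: "spec_in X {0..} d" unfolding d_def by (rule spec_in_diff[OF P P0h])
  note dL = spec_in_L2[OF ds]
  have "(\<integral>x. (norm (d x))\<^sup>2 \<partial>\<mu> X) = 0"
  proof -
    have i: "integrable (\<mu> X) (\<lambda>x. H x $ i $ j * cnj (d x $ i $ j))" if "H \<in> L2 (\<mu> X)" for H i j
      by (intro sqint_mult_integrable sqint_cnj L2_entry that dL)
    have "(\<integral>x. d x $ i $ j * cnj (d x $ i $ j) \<partial>\<mu> X)
        = (\<integral>x. (G x - P0 x) $ i $ j * cnj (d x $ i $ j) \<partial>\<mu> X) - (\<integral>x. (G x - P x) $ i $ j * cnj (d x $ i $ j) \<partial>\<mu> X)" for i j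
    proof -
      have "(\<integral>x. (G x - P0 x) $ i $ j * cnj (d x $ i $ j) \<partial>\<mu> X) - (\<integral>x. (G x - P x) $ i $ j * cnj (d x $ i $ j) \<partial>\<mu> X)
         = (\<integral>x. (G x - P0 x) $ i $ j * cnj (d x $ i $ j) - (G x - P x) $ i $ j * cnj (d x $ i $ j) \<partial>\<mu> X)"
        by (intro Bochner_Integration.integral_diff[symmetric] i L2_diff G PL P0L)
      also have "\<dots> = (\<integral>x. d x $ i $ j * cnj (d x $ i $ j) \<partial>\<mu> X)"
        by (simp add: d_def algebra_simps)
      finally show ?thesis ..
    qed
    then have "L2_inner X d d = L2_inner X (\<lambda>x. G x - P0 x) d - L2_inner X (\<lambda>x. G x - P x) d"
      unfolding L2_inner_eq[OF dL dL] L2_inner_eq[OF L2_diff[OF G P0L] dL] L2_inner_eq[OF L2_diff[OF G PL] dL]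
      by (simp only: sum_subtractf)
    also have "\<dots> = 0" by (simp add: orth Porth ds)
    finally have "L2_inner X d d = 0" .
    moreover have "L2_inner X d d = of_real (\<integral>x. (norm (d x))\<^sup>2 \<partial>\<mu> X)"
    proof -
      have "integrable (\<mu> X) (\<lambda>x. (cmod (d x $ i $ j))\<^sup>2)" for i j
        by (intro sqint_integrable L2_entry dL)
      then show ?thesis
        unfolding L2_inner_eq[OF dL dL] sq_cmod_pairing norm_cmat_sq by (simp add: Bochner_Integration.integral_sum)
    qed
    ultimately show ?thesis by (simp only: of_real_eq_0_iff)
  qed
  then have "AE x in \<mu> X. (norm (d x))\<^sup>2 = 0"
    using L2_integrable[OF dL] by (subst (asm) integral_nonneg_eq_0_iff_AE) auto
  then have "AE x in \<mu> X. P0 x = P x" by eventually_elim (simp add: d_def)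
  from fmult_cong[OF P0 L2_measurable[OF G] _ L2_measurable[OF PL] this] show ?thesis
    unfolding P_def by simp
qed

text \<open>The projection only removes frequencies.\<close>

lemma hardy_proj_contraction:
  assumes G: "G \<in> L2 (\<mu> X)"
  shows "(\<integral>x. (norm (hardy_proj X G x))\<^sup>2 \<partial>\<mu> X) \<le> (\<integral>x. (norm (G x))\<^sup>2 \<partial>\<mu> X)"
proof -
  note P = hardy_proj_fmult[OF G]
  have "(\<integral>k. (norm (fourier X (hardy_proj X G) k))\<^sup>2 \<partial>\<nu> X) \<le> (\<integral>k. (norm (fourier X G k))\<^sup>2 \<partial>\<nu> X)"
  proof (rule integral_mono_AE)
    show "AE k in \<nu> X. (norm (fourier X (hardy_proj X G) k))\<^sup>2 \<le> (norm (fourier X G k))\<^sup>2"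
      using fmult_AE[OF P] by eventually_elim (auto simp: nonneg_symbol_def cscale_zero cscale_one)
  qed (intro L2_integrable fourier_L2 G fmult_L2(2)[OF P])+
  then show ?thesis
    unfolding Parseval_cmat[OF G] Parseval_cmat[OF fmult_L2(2)[OF P]] by (simp add: divide_right_mono)
qed

text \<open>The choice in \<^const>\<open>abs_D\<close> is determined as soon as some function has the required transform.\<close>

lemma abs_D_fmult:
  assumes V: "fmult X (\<lambda>k. of_real \<bar>k\<bar>) U V"
  shows "fmult X (\<lambda>k. of_real \<bar>k\<bar>) U (abs_D X U)"
proof -
  have "V \<in> L2 (\<mu> X) \<and> (AE k in \<nu> X. fourier X V k = \<bar>k\<bar> *\<^sub>R fourier X U k)"
    using V by (simp only: fmult_def scaleR_cscale)
  then have "abs_D X U \<in> L2 (\<mu> X) \<and> (AE k in \<nu> X. fourier X (abs_D X U) k = \<bar>k\<bar> *\<^sub>R fourier X U k)"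
    unfolding abs_D_def
    by (rule someI[where P="\<lambda>V. V \<in> L2 (\<mu> X) \<and> (AE k in \<nu> X. fourier X V k = \<bar>k\<bar> *\<^sub>R fourier X U k)"])
  then show ?thesis using fmult_L2(1)[OF V] by (simp only: fmult_def scaleR_cscale)
qed

lemma sobolev_2_fmult:
  assumes U: "U \<in> sobolev X 2" and m: "m \<in> borel_measurable borel" "\<And>k. cmod (m k) \<le> 1 + k\<^sup>2"
  obtains V where "fmult X m U V"
proof -
  have UL: "U \<in> L2 (\<mu> X)" using U by (simp add: sobolev_def)
  have pos: "0 < 1 + k\<^sup>2" for k :: real by (simp add: add_pos_nonneg)
  have "(\<lambda>k. complex_of_real (1 + k\<^sup>2) *\<^sub>c fourier X U k) \<in> L2 (\<nu> X)"
    using U pos unfolding sobolev_def sobolev_weight_def scaleR_cscale by simp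
  then have "(\<lambda>k. m k *\<^sub>c fourier X U k) \<in> L2 (\<nu> X)"
  proof (rule L2_cscale_dominated[OF _ fourier_L2[OF UL] borel_measurable_freq[OF m(1)]])
    show "cmod (m k) \<le> cmod (complex_of_real (1 + k\<^sup>2))" for k
      unfolding norm_of_real using m(2)[of k] by simp
  qed
  from fmult_exists[OF UL this] that show ?thesis by blast
qed

section \<open>The commutator of the Lax pair\<close>

abbreviation is_proj :: "base \<Rightarrow> 'd::finite field \<Rightarrow> 'd field \<Rightarrow> bool" where
  "is_proj X \<equiv> fmult X nonneg_symbol"

lemma fmult_factor:
  assumes "fmult X m F G" "fmult X (\<lambda>k. n k * m k) F H"
  shows "fmult X n G H"
proof -
  have "AE k in \<nu> X. fourier X H k = n k *\<^sub>c fourier X G k"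
    using fmult_AE[OF assms(1)] fmult_AE[OF assms(2)] by eventually_elim (simp add: cscale_cscale)
  then show ?thesis using fmult_L2(2)[OF assms(1)] fmult_L2(2)[OF assms(2)] by (simp add: fmult_def)
qed

lemma fmult_symbol_add:
  assumes "fmult X m F G" "fmult X n F H"
  shows "fmult X (\<lambda>k. m k + n k) F (\<lambda>x. G x + H x)"
proof -
  have "AE k in \<nu> X. fourier X (\<lambda>x. G x + H x) k = (m k + n k) *\<^sub>c fourier X F k"
    using fmult_AE[OF assms(1)] fmult_AE[OF assms(2)] fourier_add[OF fmult_L2(2)[OF assms(1)] fmult_L2(2)[OF assms(2)]]
    by eventually_elim (rule matrix_eqI, simp add: left_diff_distrib distrib_right)
  then show ?thesis using fmult_L2[OF assms(1)] fmult_L2[OF assms(2)] by (simp add: fmult_def L2_add)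
qed

lemma fmult_symbol_diff:
  assumes "fmult X m F G" "fmult X n F H"
  shows "fmult X (\<lambda>k. m k - n k) F (\<lambda>x. G x - H x)"
proof -
  have "AE k in \<nu> X. fourier X (\<lambda>x. G x - H x) k = (m k - n k) *\<^sub>c fourier X F k"
    using fmult_AE[OF assms(1)] fmult_AE[OF assms(2)] fourier_diff[OF fmult_L2(2)[OF assms(1)] fmult_L2(2)[OF assms(2)]]
    by eventually_elim (rule matrix_eqI, simp add: left_diff_distrib distrib_right)
  then show ?thesis using fmult_L2[OF assms(1)] fmult_L2[OF assms(2)] by (simp add: fmult_def L2_diff)
qed

lemma fmult_one: "F \<in> L2 (\<mu> X) \<Longrightarrow> fmult X (\<lambda>_. 1) F F"
  by (simp add: fmult_def cscale_one)

lemma is_proj_hardy: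
  assumes "spec_in X {0..} F"
  shows "is_proj X F F"
proof -
  have "AE k in \<nu> X. fourier X F k = nonneg_symbol k *\<^sub>c fourier X F k"
    using conjunct2[OF assms[unfolded spec_in_def]]
    by eventually_elim (auto simp: nonneg_symbol_def cscale_one cscale_zero)
  then show ?thesis using spec_in_L2[OF assms] by (simp add: fmult_def)
qed

lemma is_proj_antihardy:
  assumes "spec_in X {..<0} F"
  shows "is_proj X F (\<lambda>x. 0)"
proof -
  have z: "AE k in \<nu> X. fourier X (\<lambda>x. 0 :: 'a cmat) k = 0"
    by (rule fourier_AE_eqI[where G="\<lambda>_. 0"]) (simp add: has_ft_zero)
  have "AE k in \<nu> X. fourier X (\<lambda>x. 0) k = nonneg_symbol k *\<^sub>c fourier X F k"
    using conjunct2[OF assms[unfolded spec_in_def]] z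
    by eventually_elim (auto simp: nonneg_symbol_def cscale_zero)
  moreover have "(\<lambda>x. 0 :: 'a cmat) \<in> L2 (\<mu> X)" by (simp add: L2_iff)
  ultimately show ?thesis using spec_in_L2[OF assms] by (simp add: fmult_def)
qed

lemma is_proj_spec_in: "is_proj X F G \<Longrightarrow> spec_in X {0..} G"
  by (erule fmult_support) (simp add: nonneg_symbol_def)

lemma toeplitz_is_proj:
  assumes "(\<lambda>x. W x ** F x) \<in> L2 (\<mu> X)"
  shows "is_proj X (\<lambda>x. W x ** F x) (toeplitz X W F)"
  unfolding toeplitz_def by (rule hardy_proj_fmult[OF assms])

text \<open>The projector and the derivative are Fourier multipliers and commute.\<close>

lemma is_D_toeplitz:
  assumes "is_D X W W'" "is_D X F F'"
  shows "is_D X (toeplitz X W F) (hardy_proj X (\<lambda>x. W' x ** F x + W x ** F' x))"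
proof -
  note D = is_D_mult[OF assms]
  have "is_proj X (\<lambda>x. W x ** F x) (toeplitz X W F)"
    by (rule toeplitz_is_proj[OF fmult_L2(1)[OF D]])
  moreover have "is_proj X (\<lambda>x. W' x ** F x + W x ** F' x) (hardy_proj X (\<lambda>x. W' x ** F x + W x ** F' x))"
    by (rule hardy_proj_fmult[OF fmult_L2(2)[OF D]])
  ultimately show ?thesis by (rule fmult_commute[OF _ D])
qed

text \<open>The right-hand side of the equation, where \<open>v\<close> is \<open>|D|u\<close> and \<open>w\<close> is the derivative of \<open>v - u\<^sup>2\<close>.\<close>

definition spin_BO_rhs :: "'d::finite field \<Rightarrow> 'd field \<Rightarrow> 'd field \<Rightarrow> 'd field" where
  "spin_BO_rhs u v w = (\<lambda>x. w x - \<i> *\<^sub>c (u x ** v x - v x ** u x))"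

text \<open>The computation of the commutator, with the derivatives of \<open>u\<close> and \<open>v = |D|u\<close> as parameters. Both
  terms \<open>B (L F)\<close> and \<open>L (B F)\<close> are brought under a single projector, which gives a function \<open>Q\<close>
  whose projection is the commutator. Then \<open>Q + R F\<close> is shown to be the function \<open>E\<close>, whose spectrum
  is negative, and projecting it gives zero.\<close>

lemma lax_commutator_aux:
  fixes u :: "'d::finite field"
  assumes Du: "is_D X u Du" and v: "fmult X (\<lambda>k. of_real \<bar>k\<bar>) u v"
    and v_def: "v = abs_D X u"
    and D2u: "is_D X Du D2u" and Dv: "is_D X v Dv"
    and w_def: "w = (\<lambda>x. \<i> *\<^sub>c (Dv x - (Du x ** u x + u x ** Du x)))"
    and F: "F \<in> lax_dom X"
  shows "lax_B X u F \<in> lax_dom X"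
    and "is_proj X (\<lambda>x. - (spin_BO_rhs u v w x ** F x)) (op_commutator (lax_B X u) (lax_L X u) F)"
proof -
  have Fs: "spec_in X {0..} F" and "\<exists>G. is_D X F G" using F by (auto simp: lax_dom_iff hardy_eq_spec_in)
  then have DF: "is_D X F (D_op X F)" using is_D_D_op by blast
  define F' where "F' = D_op X F"
  note DF = DF[folded F'_def]
  define p where "p x = Du x + v x" for x
  \<comment> \<open>\<open>p\<close> and \<open>q\<close> have the symbols \<open>k + \<bar>k\<bar>\<close> and \<open>k - \<bar>k\<bar>\<close> relative to \<open>u\<close>.\<close>
  define q where "q x = Du x - v x" for x
  have ps: "spec_in X {0..} p"
    unfolding p_def by (rule fmult_support[OF fmult_symbol_add[OF Du v]]) auto
  have qs: "spec_in X {..<0} q"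
    unfolding q_def by (rule fmult_support[OF fmult_symbol_diff[OF Du v]]) auto
  have Dq: "is_D X q (\<lambda>x. D2u x - Dv x)"
    unfolding q_def by (rule fmult_diff[OF D2u Dv])
  define A where "A = toeplitz X u F"
  define A' where "A' = hardy_proj X (\<lambda>x. Du x ** F x + u x ** F' x)"
  have DA: "is_D X A A'" unfolding A_def A'_def by (rule is_D_toeplitz[OF Du DF])
  have PA: "is_proj X (\<lambda>x. u x ** F x) A"
    unfolding A_def by (rule toeplitz_is_proj[OF fmult_L2(1)[OF is_D_mult[OF Du DF]]])
  define a2 where "a2 = toeplitz X u A"
  define a2' where "a2' = hardy_proj X (\<lambda>x. Du x ** A x + u x ** A' x)"
  have Da2: "is_D X a2 a2'" unfolding a2_def a2'_def by (rule is_D_toeplitz[OF Du DA])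
  have Pa2: "is_proj X (\<lambda>x. u x ** A x) a2"
    unfolding a2_def by (rule toeplitz_is_proj[OF fmult_L2(1)[OF is_D_mult[OF Du DA]]])
  have Pa2': "is_proj X (\<lambda>x. Du x ** A x + u x ** A' x) a2'"
    unfolding a2'_def by (rule hardy_proj_fmult[OF fmult_L2(2)[OF is_D_mult[OF Du DA]]])
  define b1 where "b1 = toeplitz X v F"
  define b1' where "b1' = hardy_proj X (\<lambda>x. Dv x ** F x + v x ** F' x)"
  have Db1: "is_D X b1 b1'" unfolding b1_def b1'_def by (rule is_D_toeplitz[OF Dv DF])
  have Pb1: "is_proj X (\<lambda>x. v x ** F x) b1"
    unfolding b1_def by (rule toeplitz_is_proj[OF fmult_L2(1)[OF is_D_mult[OF Dv DF]]])
  have Pb1': "is_proj X (\<lambda>x. Dv x ** F x + v x ** F' x) b1'"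
    unfolding b1'_def by (rule hardy_proj_fmult[OF fmult_L2(2)[OF is_D_mult[OF Dv DF]]])
  define B where "B = lax_B X u F"
  have B_eq: "B = (\<lambda>x. \<i> *\<^sub>c (b1 x - a2 x))"
    by (simp add: B_def lax_B_def b1_def a2_def A_def v_def)
  define B' where "B' x = \<i> *\<^sub>c (b1' x - a2' x)" for x
  have DB: "is_D X B B'" unfolding B_eq B'_def by (rule fmult_cscale[OF fmult_diff[OF Db1 Da2]])
  have Bs: "spec_in X {0..} B"
  proof -
    have "spec_in X {0..} (\<lambda>x. b1 x - a2 x)" by (intro spec_in_diff is_proj_spec_in[OF Pb1] is_proj_spec_in[OF Pa2])
    moreover have "fmult X (\<lambda>k. \<i> * 1) (\<lambda>x. b1 x - a2 x) B"
      unfolding B_eq by (rule fmult_smult[OF fmult_one]) (intro L2_diff fmult_L2(2)[OF Pb1] fmult_L2(2)[OF Pa2])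
    ultimately show ?thesis by (rule fmult_spec_in[rotated])
  qed
  show "lax_B X u F \<in> lax_dom X"
    using Bs DB unfolding B_def by (auto simp: lax_dom_iff hardy_eq_spec_in)
  define Z where "Z x = F' x - A x" for x
  have Z_eq: "lax_L X u F = Z" by (simp add: lax_L_def Z_def F'_def A_def fun_eq_iff)
  have ZL: "Z \<in> L2 (\<mu> X)" unfolding Z_def by (intro L2_diff fmult_L2(2)[OF DF] fmult_L2(1)[OF DA])
  define Y where "Y = toeplitz X u Z"
  have PY: "is_proj X (\<lambda>x. u x ** Z x) Y"
    unfolding Y_def by (rule toeplitz_is_proj[OF is_D_mult_L2(1)[OF Du ZL]])
  have PvZ: "is_proj X (\<lambda>x. v x ** Z x) (toeplitz X v Z)"
    by (rule toeplitz_is_proj[OF is_D_mult_L2(1)[OF Dv ZL]])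
  have PuY: "is_proj X (\<lambda>x. u x ** Y x) (toeplitz X u Y)"
    by (rule toeplitz_is_proj[OF is_D_mult_L2(1)[OF Du fmult_L2(2)[OF PY]]])
  have PuB: "is_proj X (\<lambda>x. u x ** B x) (toeplitz X u B)"
    by (rule toeplitz_is_proj[OF is_D_mult_L2(1)[OF Du fmult_L2(1)[OF DB]]])
  define Q where "Q x = \<i> *\<^sub>c (v x ** Z x - u x ** Y x)
     - (\<i> *\<^sub>c ((Dv x ** F x + v x ** F' x) - (Du x ** A x + u x ** A' x)) - u x ** B x)" for x
  define C where "C = op_commutator (lax_B X u) (lax_L X u) F"
  have C_eq: "C x = \<i> *\<^sub>c (toeplitz X v Z x - toeplitz X u Y x) - (D_op X B x - toeplitz X u B x)" for x
    unfolding C_def op_commutator_def Z_eq B_def[symmetric]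
    by (simp add: lax_B_def lax_L_def v_def Y_def)
  have QC: "is_proj X Q C"
  proof -
    have PQ: "is_proj X Q (\<lambda>x. \<i> *\<^sub>c (toeplitz X v Z x - toeplitz X u Y x) - (\<i> *\<^sub>c (b1' x - a2' x) - toeplitz X u B x))"
      unfolding Q_def by (intro fmult_diff fmult_cscale PvZ PuY Pb1' Pa2' PuB)
    have D: "is_D X B (D_op X B)" by (rule is_D_D_op[OF DB])
    have "AE x in \<mu> X. B' x = D_op X B x" by (rule fmult_unique[OF DB D]) simp
    then have "AE x in \<mu> X. \<i> *\<^sub>c (toeplitz X v Z x - toeplitz X u Y x) - (\<i> *\<^sub>c (b1' x - a2' x) - toeplitz X u B x) = C x"
      by eventually_elim (simp add: C_eq B'_def)
    moreover have "C \<in> L2 (\<mu> X)"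
      unfolding C_eq[abs_def]
      by (intro L2_diff L2_cscale fmult_L2(2)[OF PvZ] fmult_L2(2)[OF PuY] fmult_L2(2)[OF PuB] fmult_L2(2)[OF D])
    ultimately show ?thesis
      using fmult_cong[OF PQ L2_measurable[OF fmult_L2(1)[OF PQ]] _ L2_measurable] by simp
  qed
  define a1 where "a1 = toeplitz X u F'"
  have F'L: "F' \<in> L2 (\<mu> X)" by (rule fmult_L2(2)[OF DF])
  have Pa1: "is_proj X (\<lambda>x. u x ** F' x) a1"
    unfolding a1_def by (rule toeplitz_is_proj[OF is_D_mult_L2(1)[OF Du F'L]])
  define a3 where "a3 = toeplitz X Du F"
  have Pa3: "is_proj X (\<lambda>x. Du x ** F x) a3"
    unfolding a3_def by (rule toeplitz_is_proj[OF is_D_mult_L2(2)[OF DF fmult_L2(2)[OF Du]]])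
  have Y_AE: "AE x in \<mu> X. Y x = a1 x - a2 x"
    by (rule fmult_unique[OF PY fmult_diff[OF Pa1 Pa2]]) (simp add: Z_def matrix_mult_diff)
  have PA': "is_proj X (\<lambda>x. Du x ** F x + u x ** F' x) A'"
    unfolding A'_def by (rule hardy_proj_fmult[OF fmult_L2(2)[OF is_D_mult[OF Du DF]]])
  have A'_AE: "AE x in \<mu> X. A' x = a3 x + a1 x"
    by (rule fmult_unique[OF PA' fmult_add[OF Pa3 Pa1]]) simp
  \<comment> \<open>The symbol \<open>p\<close> preserves the Hardy space, so the projector can be dropped.\<close>
  have pF_AE: "AE x in \<mu> X. a3 x + b1 x = p x ** F x"
  proof -
    have "(\<lambda>x. p x ** F x) \<in> L2 (\<mu> X)"
      by (rule is_D_mult_L2(2)[OF DF spec_in_L2[OF ps]])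
    from is_proj_hardy[OF spec_in_product[OF ps Fs _ this]] have "is_proj X (\<lambda>x. p x ** F x) (\<lambda>x. p x ** F x)"
      by simp
    from fmult_unique[OF fmult_add[OF Pa3 Pb1] this] show ?thesis
      by (simp add: p_def matrix_mult_add(2))
  qed
  \<comment> \<open>The symbol \<open>q\<close> preserves negative spectrum, so the projector below it can be dropped.\<close>
  define E where "E x = \<i> *\<^sub>c (q x ** (A x - u x ** F x))" for x
  have PE: "is_proj X E (\<lambda>x. 0)"
  proof -
    have uFL: "(\<lambda>x. u x ** F x) \<in> L2 (\<mu> X)" by (rule fmult_L2(1)[OF PA])
    have As: "spec_in X {..<0} (\<lambda>x. A x - u x ** F x)"
      by (rule fmult_support[OF fmult_symbol_diff[OF PA fmult_one[OF uFL]]]) (auto simp: nonneg_symbol_def)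
    have "spec_in X {..<0} (\<lambda>x. q x ** (A x - u x ** F x))"
      by (rule spec_in_product[OF qs As]) (auto intro: is_D_mult_L2(1)[OF Dq] spec_in_L2[OF As])
    from fmult_cscale[OF is_proj_antihardy[OF this], of \<i>] show ?thesis
      unfolding E_def by (simp add: cscale_zero)
  qed
  have QE: "AE x in \<mu> X. Q x - E x = - (spin_BO_rhs u v w x ** F x)"
    using Y_AE A'_AE pF_AE
  proof eventually_elim
    case (elim x)
    have b1: "b1 x = Du x ** F x + v x ** F x - a3 x"
      using elim(3) by (simp add: p_def matrix_mult_add(2) algebra_simps)
    show ?case
      unfolding Q_def E_def elim(1,2) B_eq b1 Z_def q_def spin_BO_rhs_def w_def
      by (simp add: matrix_mult_diff matrix_mult_add cscale_add cscale_diff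
          cscale_mult_left cscale_mult_right matrix_mul_assoc)
  qed
  have PQE: "is_proj X (\<lambda>x. Q x - E x) C"
    using fmult_diff[OF QC PE] by simp
  have wL: "w \<in> L2 (\<mu> X)" and uvL: "(\<lambda>x. u x ** v x - v x ** u x) \<in> L2 (\<mu> X)"
    unfolding w_def
    by (intro L2_cscale L2_diff fmult_L2(2)[OF Dv] fmult_L2(2)[OF is_D_mult[OF Du Du]]
        fmult_L2(1)[OF is_D_mult[OF Du Dv]] fmult_L2(1)[OF is_D_mult[OF Dv Du]])+
  have "spin_BO_rhs u v w \<in> L2 (\<mu> X)"
    unfolding spin_BO_rhs_def by (rule L2_diff[OF wL L2_cscale[OF uvL]])
  from L2_cscale[OF is_D_mult_L2(2)[OF DF this], of "-1"]
  have "(\<lambda>x. - (spin_BO_rhs u v w x ** F x)) \<in> L2 (\<mu> X)"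
    by (simp add: cscale_minus_one)
  from fmult_cong[OF PQE L2_measurable[OF this] QE L2_measurable[OF fmult_L2(2)[OF PQE]]]
  show "is_proj X (\<lambda>x. - (spin_BO_rhs u v w x ** F x)) (op_commutator (lax_B X u) (lax_L X u) F)"
    unfolding C_def by simp
qed

text \<open>Two derivatives of \<open>u\<close> make \<open>u\<close>, \<open>Du\<close> and \<open>|D|u\<close> differentiable in \<open>L\<^sup>2\<close>, which is what the
  computation needs.\<close>

lemma lax_commutator:
  fixes u :: "'d::finite field"
  assumes u: "u \<in> sobolev X 2"
  shows "\<exists>w. has_dx X (\<lambda>x. abs_D X u x - u x ** u x) w \<and>
    spin_BO_rhs u (abs_D X u) w \<in> L2 (\<mu> X) \<and>
    (\<forall>F \<in> lax_dom X. lax_B X u F \<in> lax_dom X \<and>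
      is_proj X (\<lambda>x. - (spin_BO_rhs u (abs_D X u) w x ** F x))
       (op_commutator (lax_B X u) (lax_L X u) F))"
proof -
  have le: "\<bar>k\<bar> \<le> 1 + k\<^sup>2" for k :: real
    using zero_le_power2[of "\<bar>k\<bar> - 1"] by (simp add: power2_diff)
  obtain Du where Du: "is_D X u Du"
    by (rule sobolev_2_fmult[OF u, of complex_of_real]) (auto simp: le)
  obtain V where V: "fmult X (\<lambda>k. of_real \<bar>k\<bar>) u V"
    by (rule sobolev_2_fmult[OF u, of "\<lambda>k. complex_of_real \<bar>k\<bar>"]) (auto simp: le)
  define v where "v = abs_D X u"
  have v: "fmult X (\<lambda>k. of_real \<bar>k\<bar>) u v" unfolding v_def by (rule abs_D_fmult[OF V])
  obtain D2u where "fmult X (\<lambda>k. of_real k * of_real k) u D2u"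
    by (rule sobolev_2_fmult[OF u, of "\<lambda>k. complex_of_real k * of_real k"])
       (auto simp: norm_mult power2_eq_square)
  then have D2u: "is_D X Du D2u" by (rule fmult_factor[OF Du])
  obtain Dv where "fmult X (\<lambda>k. of_real k * of_real \<bar>k\<bar>) u Dv"
    by (rule sobolev_2_fmult[OF u, of "\<lambda>k. complex_of_real k * of_real \<bar>k\<bar>"])
       (auto simp: norm_mult power2_eq_square)
  then have Dv: "is_D X v Dv" by (rule fmult_factor[OF v])
  define w where "w = (\<lambda>x. \<i> *\<^sub>c (Dv x - (Du x ** u x + u x ** Du x)))"
  have dx: "has_dx X (\<lambda>x. v x - u x ** u x) w"
    unfolding w_def has_dx_iff_is_D by (rule fmult_diff[OF Dv is_D_mult[OF Du Du]])
  have wL: "w \<in> L2 (\<mu> X)" using dx by (simp add: has_dx_def)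
  have uvL: "(\<lambda>x. u x ** v x - v x ** u x) \<in> L2 (\<mu> X)"
    by (intro L2_diff fmult_L2(1)[OF is_D_mult[OF Du Dv]] fmult_L2(1)[OF is_D_mult[OF Dv Du]])
  have "spin_BO_rhs u v w \<in> L2 (\<mu> X)"
    unfolding spin_BO_rhs_def by (rule L2_diff[OF wL L2_cscale[OF uvL]])
  with dx lax_commutator_aux[OF Du v v_def D2u Dv w_def] show ?thesis
    unfolding v_def by (intro exI[of _ w] conjI ballI)
qed

section \<open>Symbols are determined by their Toeplitz operators\<close>

text \<open>Off the origin the integral is \<open>(cis (- x) - 1) / (- \<i> x)\<close>, which vanishes only at multiples of
  \<open>2 \<pi>\<close>.\<close>

lemma line_ft_unit_interval_nonzero:
  "AE x in lborel. (\<integral>t. cis (- (x * t)) * indicator {0..1} t \<partial>lborel) \<noteq> 0"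
proof -
  define S where "S = insert 0 (range (\<lambda>n::int. real_of_int n * 2 * pi))"
  have "countable S" unfolding S_def by simp
  then have "S \<in> null_sets lborel" by (rule countable_imp_null_set_lborel)
  then have "AE x in lborel. x \<notin> S" by (rule AE_not_in)
  then show ?thesis
  proof eventually_elim
    case (elim x)
    then have x: "x \<noteq> 0" by (auto simp: S_def)
    have "((\<lambda>t. cis (- x * t) / (- \<i> * of_real x)) has_vector_derivative
        (\<i> * of_real (- x) * cis (- x * t)) / (- \<i> * of_real x)) (at t within {0..1})" for t
      by (intro has_vector_derivative_divide cis_has_vector_derivative)
    then have "((\<lambda>t. cis (- x * t) / (- \<i> * of_real x)) has_vector_derivative cis (- x * t)) (at t within {0..1})" for t
      using x by simp
    then have "(\<integral>t. indicator {0..1} t *\<^sub>R cis (- x * t) \<partial>lborel)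
        = cis (- x * 1) / (- \<i> * of_real x) - cis (- x * 0) / (- \<i> * of_real x)"
      by (intro integral_FTC_atLeastAtMost continuous_intros) auto
    moreover have "indicator {0..1} t *\<^sub>R cis (- x * t) = cis (- (x * t)) * indicator {0..1} t" for t
      by (auto split: split_indicator)
    ultimately have eq: "(\<integral>t. cis (- (x * t)) * indicator {0..1} t \<partial>lborel) = (cis (- x) - 1) / (- \<i> * of_real x)"
      by (simp add: diff_divide_distrib)
    have "cis (- x) \<noteq> 1"
    proof
      assume "cis (- x) = 1"
      then have "cos x = 1" by (simp add: complex_eq_iff)
      then show False using elim unfolding cos_one_2pi_int S_def by blast
    qed
    then show ?case unfolding eq using x by simp
  qed
qed

text \<open>A constant function on the torus; on the line the function whose transform is the indicator of the unit
  interval.\<close>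

lemma nonvanishing_hardy_function:
  obtains f \<phi> where "has_ft X f \<phi>" "AE k in \<nu> X. k \<notin> {0..1} \<longrightarrow> \<phi> k = 0"
    "AE x in \<mu> X. f x \<noteq> 0"
proof (cases X)
  case Line
  define \<phi> where "\<phi> = (\<lambda>k. indicator {0..1::real} k :: complex)"
  have \<phi>: "\<phi> \<in> sqint (base_measure Line)" unfolding \<phi>_def by (simp add: indicator_sqint)
  have i: "integrable (base_measure Line) \<phi>"
    unfolding \<phi>_def using truncated_integrable[OF indicator_sqint[of 0 1], of 1]
    by (rule Bochner_Integration.integrable_cong[THEN iffD1, rotated -1])
       (auto simp: truncated_def split: split_indicator)
  obtain G where G: "has_ft Line \<phi> G" using has_ft_exists[OF \<phi>] by blast
  have "AE x in lborel. G x \<noteq> 0"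
    using has_ft_integrable[OF G i] line_ft_unit_interval_nonzero
    unfolding freq_measure.simps base_measure.simps \<phi>_def by eventually_elim simp
  then have "AE x in freq_measure Line. G x \<noteq> 0" unfolding freq_measure.simps .
  from AE_distr_invariant[OF freq_uminus this]
  have nz: "AE x in base_measure Line. G (- x) / (2 * pi) \<noteq> 0"
    unfolding freq_measure.simps base_measure.simps by eventually_elim simp
  have supp: "AE k in freq_measure Line. k \<notin> {0..1} \<longrightarrow> \<phi> k = 0"
    by (rule AE_I2) (simp add: \<phi>_def)
  show ?thesis
    by (rule that[unfolded Line, OF line_has_ft_inversion[OF G] supp nz])
next
  case Torus
  have "(\<lambda>x. 1) \<in> sqint torus_measure" by (rule torus_bounded_sqint[of _ 1]) auto
  from has_ft_Torus[OF this] have f: "has_ft Torus (\<lambda>x. 1) (\<lambda>k. \<integral>x. cis (- (k * x)) * 1 \<partial>torus_measure)" .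
  have "(\<integral>x. cis (- (k * x)) * 1 \<partial>torus_measure) = 0" if "k \<in> \<int>" "k \<notin> {0..1}" for k
    using torus_orthogonal[of 0 k] that by auto
  then show ?thesis
    by (intro that[of "\<lambda>x. 1" "\<lambda>k. \<integral>x. cis (- (k * x)) * 1 \<partial>torus_measure"])
       (use f in \<open>auto simp: Torus AE_count_space\<close>)
qed

definition scalar_field :: "(real \<Rightarrow> complex) \<Rightarrow> 'd::finite field" where
  "scalar_field f x = (\<chi> i j. if i = j then f x else 0)"

lemma scalar_field_nth: "scalar_field f x $ i $ j = (if i = j then f x else 0)"
  by (simp add: scalar_field_def)

lemma scalar_field_zero: "f x = 0 \<Longrightarrow> scalar_field f x = 0"
  by (simp add: scalar_field_def vec_eq_iff)

lemma mult_scalar_field_nth: "((A :: 'd::finite cmat) ** scalar_field f x) $ i $ j = A $ i $ j * f x"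
  by (simp add: matrix_mult_nth scalar_field_nth if_distrib cong: if_cong)

lemma fourier_scalar_field:
  assumes "has_ft X f \<phi>"
  shows "(scalar_field f :: 'd::finite field) \<in> L2 (\<mu> X)"
    and "AE k in \<nu> X. fourier X (scalar_field f :: 'd field) k = scalar_field \<phi> k"
proof -
  have *: "has_ft X (entry (scalar_field f) i j) (entry (scalar_field \<phi>) i j)" for i j :: 'd
    using assms by (cases "i = j") (simp_all add: scalar_field_nth has_ft_zero)
  show "(scalar_field f :: 'd field) \<in> L2 (\<mu> X)" unfolding L2_iff using has_ft_sqint(1)[OF *] by blast
  show "AE k in \<nu> X. fourier X (scalar_field f :: 'd field) k = scalar_field \<phi> k"
    by (rule fourier_AE_eqI[OF *])
qed

text \<open>A bounded set of frequencies makes the derivative square integrable.\<close>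

lemma scalar_field_lax_dom:
  assumes f: "has_ft X f \<phi>" and supp: "AE k in \<nu> X. k \<notin> {0..real n + 1} \<longrightarrow> \<phi> k = 0"
  shows "(scalar_field f :: 'd::finite field) \<in> lax_dom X"
proof -
  have k\<phi>: "(\<lambda>k. of_real k * \<phi> k) \<in> sqint (\<nu> X)"
  proof (rule sqint_bound)
    show "integrable (\<nu> X) (\<lambda>k. (real n + 1)\<^sup>2 * (cmod (\<phi> k))\<^sup>2)"
      by (rule integrable_mult_right[OF sqint_integrable[OF has_ft_sqint(2)[OF f]]])
    show "(\<lambda>k. of_real k * \<phi> k) \<in> borel_measurable (\<nu> X)"
      by (rule borel_measurable_times[OF borel_measurable_freq sqint_measurable[OF has_ft_sqint(2)[OF f]]]) measurable
    show "AE k in \<nu> X. (cmod (of_real k * \<phi> k))\<^sup>2 \<le> (real n + 1)\<^sup>2 * (cmod (\<phi> k))\<^sup>2"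
      using supp
    proof eventually_elim
      case (elim k)
      show ?case
      proof (cases "k \<in> {0..real n + 1}")
        case True
        then have "k\<^sup>2 \<le> (real n + 1)\<^sup>2" by (intro power_mono) auto
        then have "k\<^sup>2 * (cmod (\<phi> k))\<^sup>2 \<le> (real n + 1)\<^sup>2 * (cmod (\<phi> k))\<^sup>2"
          by (rule mult_right_mono) simp
        then show ?thesis by (simp add: norm_mult power_mult_distrib)
      qed (use elim in simp)
    qed
  qed
  obtain g where g: "has_ft X g (\<lambda>k. of_real k * \<phi> k)" using has_ft_surj[OF k\<phi>] by blast
  note Ff = fourier_scalar_field[OF f, where ?'d='d] and Fg = fourier_scalar_field[OF g, where ?'d='d]
  have sc: "scalar_field (\<lambda>k. of_real k * \<phi> k) k = of_real k *\<^sub>c (scalar_field \<phi> k :: 'd cmat)" for k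
    by (rule matrix_eqI) (simp add: scalar_field_nth)
  have "AE k in \<nu> X. fourier X (scalar_field g :: 'd field) k = of_real k *\<^sub>c fourier X (scalar_field f) k"
    using Ff(2) Fg(2) by eventually_elim (simp only: sc)
  then have "is_D X (scalar_field f :: 'd field) (scalar_field g)" using Ff(1) Fg(1) by (simp add: fmult_def)
  then have dom: "\<exists>G. is_D X (scalar_field f :: 'd field) G" by blast
  have "AE k in \<nu> X. k \<notin> {0..} \<longrightarrow> fourier X (scalar_field f :: 'd field) k = 0"
    using Ff(2) supp
  proof eventually_elim
    case (elim k)
    show ?case
    proof
      assume "k \<notin> {0..}"
      then have "k \<notin> {0..real n + 1}" by simp
      with elim(2) have "\<phi> k = 0" by (rule mp)
      then show "fourier X (scalar_field f :: 'd field) k = 0" unfolding elim(1) by (rule scalar_field_zero)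
    qed
  qed
  then have "spec_in X {0..} (scalar_field f :: 'd field)" unfolding spec_in_def by (rule conjI[OF Ff(1)])
  then show ?thesis unfolding lax_dom_iff hardy_eq_spec_in by (intro conjI CollectI dom)
qed

text \<open>Multiplying \<open>F\<close> by \<open>cis (n x)\<close> shifts the spectrum of \<open>W F\<close> to the right by \<open>n\<close>, and the product
  still lies in the domain. If nonnegative frequencies are absent after each of these shifts, then
  \<open>W F\<close> has no frequencies at all.\<close>

lemma toeplitz_zero_imp_zero:
  fixes W :: "'d::finite field"
  assumes W: "W \<in> L2 (\<mu> X)"
    and 0: "\<And>F. F \<in> lax_dom X \<Longrightarrow> is_proj X (\<lambda>x. W x ** F x) (\<lambda>x. 0)"
  shows "AE x in \<mu> X. W x = 0"
proof -
  obtain f \<phi> where f: "has_ft X f \<phi>" "AE k in \<nu> X. k \<notin> {0..1} \<longrightarrow> \<phi> k = 0"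
    "AE x in \<mu> X. f x \<noteq> 0" using nonvanishing_hardy_function .
  define e where "e n x = cis (real n * x) * f x" for n x
  have nX: "real n \<in> space (\<nu> X)" "- real n \<in> space (\<nu> X)" for n by (cases X; simp)+
  have e: "has_ft X (e n) (\<lambda>k. \<phi> (k - real n))" for n
    unfolding e_def by (rule has_ft_modulate[OF f(1) nX(1)])
  have dom: "(scalar_field (e n) :: 'd field) \<in> lax_dom X" for n
  proof (rule scalar_field_lax_dom[OF e])
    show "AE k in \<nu> X. k \<notin> {0..real n + 1} \<longrightarrow> \<phi> (k - real n) = 0"
      using AE_distr_invariant[OF freq_shift[OF nX(1)[of n]] f(2)]
      by eventually_elim auto
  qed
  have "AE x in \<mu> X. W x $ i $ j = 0" for i j
  proof -
    have prod: "(\<lambda>x. W x ** (scalar_field (e n) :: 'd field) x) \<in> L2 (\<mu> X)" for n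
      by (rule fmult_L2(1)[OF 0[OF dom]])
    have e0: "e 0 = f" by (simp add: e_def fun_eq_iff)
    have s: "(\<lambda>x. W x $ i $ j * f x) \<in> sqint (\<mu> X)"
      using L2_entry[OF prod[of 0], of i j] by (simp add: mult_scalar_field_nth e0)
    obtain H where H: "has_ft X (\<lambda>x. W x $ i $ j * f x) H" using has_ft_exists[OF s] by blast
    have neg: "AE k in \<nu> X. k \<ge> - real n \<longrightarrow> H k = 0" for n
    proof -
      have eq: "entry (\<lambda>x. W x ** (scalar_field (e n) :: 'd field) x) i j = (\<lambda>x. cis (real n * x) * (W x $ i $ j * f x))"
        by (simp add: mult_scalar_field_nth e_def mult_ac)
      have "AE k in \<nu> X. fourier X (\<lambda>x. W x ** (scalar_field (e n) :: 'd field) x) k $ i $ j = H (k - real n)"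
        using has_ft_entry[OF prod[of n], of i j] unfolding eq by (rule has_ft_unique[OF _ has_ft_modulate[OF H nX(1)]])
      moreover have "AE k in \<nu> X. fourier X (\<lambda>x. 0 :: 'd cmat) k = 0"
        by (rule fourier_AE_eqI[where G="\<lambda>_. 0"]) (simp add: has_ft_zero)
      ultimately have "AE k in \<nu> X. k \<ge> 0 \<longrightarrow> H (k - real n) = 0"
        using fmult_AE[OF 0[OF dom[of n]]]
        by eventually_elim (auto simp: nonneg_symbol_def cscale_one)
      from AE_distr_invariant[OF freq_shift[OF nX(2)[of n]] this]
      show ?thesis by eventually_elim auto
    qed
    have "AE k in \<nu> X. \<forall>n. k \<ge> - real n \<longrightarrow> H k = 0"
      unfolding AE_all_countable using neg by blast
    then have "AE k in \<nu> X. H k = 0"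
    proof eventually_elim
      case (elim k)
      obtain n :: nat where "- k \<le> real n" using real_arch_simple by blast
      then have "k \<ge> - real n" by linarith
      with elim show ?case by blast
    qed
    from has_ft_inj[OF H has_ft_zero this] f(3) show ?thesis by eventually_elim simp
  qed
  then show ?thesis by (simp add: AE_entry_iff)
qed

section \<open>Time derivatives\<close>

lemma L2_nn_integral:
  assumes "F \<in> L2 M"
  shows "(\<integral>\<^sup>+x. ennreal ((norm (F x))\<^sup>2) \<partial>M) = ennreal (\<integral>x. (norm (F x))\<^sup>2 \<partial>M)"
  by (rule nn_integral_eq_integral[OF L2_integrable[OF assms]]) simp

lemma L2_scaleR: "F \<in> L2 M \<Longrightarrow> (\<lambda>x. r *\<^sub>R F x) \<in> L2 M"
  by (simp add: scaleR_cscale L2_cscale)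

lemma L2_uminus: "F \<in> L2 M \<Longrightarrow> (\<lambda>x. - F x) \<in> L2 M"
  using L2_cscale[of F M "-1"] by (simp add: cscale_minus_one)

text \<open>Limits in \<open>L\<^sup>2\<close> are unique, provided that \<open>t\<close> is not isolated in \<open>I\<close>.\<close>

lemma L2_has_time_derivative_unique:
  assumes u: "\<And>s. s \<in> I \<Longrightarrow> u s \<in> L2 (\<mu> X)" and t: "t \<in> I" "at t within I \<noteq> bot"
    and a: "L2_has_time_derivative X I u a t" and b: "L2_has_time_derivative X I u b t"
  shows "AE x in \<mu> X. a x = b x"
proof -
  let ?M = "\<mu> X"
  define q where "q s x = (1 / (s - t)) *\<^sub>R (u s x - u t x)" for s x
  have qL: "q s \<in> L2 ?M" if "s \<in> I" for s
    unfolding q_def by (intro L2_scaleR L2_diff u that t)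
  have aL: "a \<in> L2 ?M" and bL: "b \<in> L2 ?M" using a b by (auto simp: L2_has_time_derivative_def)
  have le: "(\<integral>\<^sup>+x. ennreal ((norm (a x - b x))\<^sup>2) \<partial>?M)
     \<le> 2 * (\<integral>\<^sup>+x. ennreal ((norm (q s x - a x))\<^sup>2) \<partial>?M) + 2 * (\<integral>\<^sup>+x. ennreal ((norm (q s x - b x))\<^sup>2) \<partial>?M)"
    if s: "s \<in> I" for s
  proof -
    have m: "(\<lambda>x. ennreal ((norm (q s x - c x))\<^sup>2)) \<in> borel_measurable ?M" if "c \<in> L2 ?M" for c
      using L2_measurable[OF L2_diff[OF qL[OF s] that]] by measurable
    have "(norm (a x - b x))\<^sup>2 \<le> 2 * (norm (q s x - a x))\<^sup>2 + 2 * (norm (q s x - b x))\<^sup>2" for x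
    proof -
      have "norm (a x - b x) \<le> norm (q s x - a x) + norm (q s x - b x)"
        using norm_triangle_ineq4[of "q s x - b x" "q s x - a x"] by (simp add: add.commute)
      then have "(norm (a x - b x))\<^sup>2 \<le> (norm (q s x - a x) + norm (q s x - b x))\<^sup>2"
        by (rule power_mono) simp
      also have "\<dots> \<le> 2 * (norm (q s x - a x))\<^sup>2 + 2 * (norm (q s x - b x))\<^sup>2"
        using zero_le_power2[of "norm (q s x - a x) - norm (q s x - b x)"] by (simp add: power2_eq_square algebra_simps)
      finally show ?thesis .
    qed
    then have "(\<integral>\<^sup>+x. ennreal ((norm (a x - b x))\<^sup>2) \<partial>?M)
       \<le> (\<integral>\<^sup>+x. 2 * ennreal ((norm (q s x - a x))\<^sup>2) + 2 * ennreal ((norm (q s x - b x))\<^sup>2) \<partial>?M)"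
      by (intro nn_integral_mono) (simp flip: ennreal_numeral ennreal_mult ennreal_plus)
    also have "\<dots> = 2 * (\<integral>\<^sup>+x. ennreal ((norm (q s x - a x))\<^sup>2) \<partial>?M) + 2 * (\<integral>\<^sup>+x. ennreal ((norm (q s x - b x))\<^sup>2) \<partial>?M)"
      using m[OF aL] m[OF bL] by (simp add: nn_integral_add nn_integral_cmult)
    finally show ?thesis .
  qed
  have "(\<integral>\<^sup>+x. ennreal ((norm (a x - b x))\<^sup>2) \<partial>?M) \<le> 0"
  proof (rule tendsto_lowerbound[OF _ _ t(2)])
    have "((\<lambda>s. 2 * (\<integral>\<^sup>+x. ennreal ((norm (q s x - a x))\<^sup>2) \<partial>?M) + 2 * (\<integral>\<^sup>+x. ennreal ((norm (q s x - b x))\<^sup>2) \<partial>?M))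
       \<longlongrightarrow> 2 * 0 + 2 * 0) (at t within I)"
      using a b unfolding L2_has_time_derivative_def L2_tendsto_def q_def
      by (intro tendsto_add ennreal_tendsto_cmult) auto
    then show "((\<lambda>s. 2 * (\<integral>\<^sup>+x. ennreal ((norm (q s x - a x))\<^sup>2) \<partial>?M) + 2 * (\<integral>\<^sup>+x. ennreal ((norm (q s x - b x))\<^sup>2) \<partial>?M))
       \<longlongrightarrow> 0) (at t within I)" by simp
    show "\<forall>\<^sub>F s in at t within I. (\<integral>\<^sup>+x. ennreal ((norm (a x - b x))\<^sup>2) \<partial>?M)
     \<le> 2 * (\<integral>\<^sup>+x. ennreal ((norm (q s x - a x))\<^sup>2) \<partial>?M) + 2 * (\<integral>\<^sup>+x. ennreal ((norm (q s x - b x))\<^sup>2) \<partial>?M)"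
      unfolding eventually_at_filter by (rule always_eventually) (use le in blast)
  qed
  then have "(\<integral>x. (norm (a x - b x))\<^sup>2 \<partial>?M) = 0"
    unfolding L2_nn_integral[OF L2_diff[OF aL bL]] by (simp add: ennreal_eq_0_iff antisym)
  then have "AE x in ?M. (norm (a x - b x))\<^sup>2 = 0"
    using L2_integrable[OF L2_diff[OF aL bL]] by (subst (asm) integral_nonneg_eq_0_iff_AE) auto
  then show ?thesis by eventually_elim simp
qed

lemma L2_has_time_derivative_cong:
  assumes a: "L2_has_time_derivative X I u a t" and b: "b \<in> L2 (\<mu> X)"
    and ab: "AE x in \<mu> X. a x = b x"
  shows "L2_has_time_derivative X I u b t"
proof -
  have "(\<integral>\<^sup>+x. ennreal ((norm (f x - a x))\<^sup>2) \<partial>\<mu> X) = (\<integral>\<^sup>+x. ennreal ((norm (f x - b x))\<^sup>2) \<partial>\<mu> X)" for f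
    by (rule nn_integral_cong_AE) (use ab in eventually_elim, simp)
  with a b show ?thesis by (simp add: L2_has_time_derivative_def L2_tendsto_def)
qed

text \<open>Elements of the domain are bounded functions, so that multiplication by them preserves
  \<open>L\<^sup>2\<close> convergence of the difference quotients; the projector is a contraction.\<close>

lemma lax_L_has_time_derivative:
  assumes u: "\<And>s. s \<in> I \<Longrightarrow> u s \<in> L2 (\<mu> X)" and t: "t \<in> I"
    and u': "L2_has_time_derivative X I u u' t" and F: "F \<in> lax_dom X"
  shows "L2_has_time_derivative X I (\<lambda>s. lax_L X (u s) F) (\<lambda>x. - hardy_proj X (\<lambda>x. u' x ** F x) x) t"
proof -
  let ?M = "\<mu> X"
  obtain F' where DF: "is_D X F F'" using F by (auto simp: lax_dom_iff)
  note mult = is_D_mult_L2(2)[OF DF]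
  obtain C where C: "AE x in ?M. norm (F x) \<le> C" using is_D_bounded[OF DF] by blast
  have u'L: "u' \<in> L2 ?M" using u' by (simp add: L2_has_time_derivative_def)
  define r where "r s = 1 / (s - t)" for s
  define q where "q s x = r s *\<^sub>R (u s x - u t x)" for s x
  have qL: "(\<lambda>x. q s x - u' x) \<in> L2 ?M" if "s \<in> I" for s
    unfolding q_def by (intro L2_scaleR L2_diff u that t u'L)
  note P = hardy_proj_fmult
  have PL: "hardy_proj X (\<lambda>x. u' x ** F x) \<in> L2 ?M" by (rule fmult_L2(2)[OF P[OF mult[OF u'L]]])
  have bound: "(\<integral>\<^sup>+x. ennreal ((norm ((1 / (s - t)) *\<^sub>R (lax_L X (u s) F x - lax_L X (u t) F x)
       - - hardy_proj X (\<lambda>x. u' x ** F x) x))\<^sup>2) \<partial>?M)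
     \<le> ennreal (C\<^sup>2) * (\<integral>\<^sup>+x. ennreal ((norm (q s x - u' x))\<^sup>2) \<partial>?M)" if s: "s \<in> I" for s
  proof -
    define d where "d x = q s x - u' x" for x
    have dL: "d \<in> L2 ?M" unfolding d_def by (rule qL[OF s])
    define h where "h x = r s *\<^sub>R (toeplitz X (u s) F x - toeplitz X (u t) F x) - hardy_proj X (\<lambda>x. u' x ** F x) x" for x
    have 1: "is_proj X (\<lambda>x. of_real (r s) *\<^sub>c (u s x ** F x - u t x ** F x) - u' x ** F x) h"
      unfolding h_def scaleR_cscale toeplitz_def
      by (intro fmult_diff fmult_cscale P mult u u'L s t)
    have 2: "of_real (r s) *\<^sub>c (u s x ** F x - u t x ** F x) - u' x ** F x = d x ** F x" for x
      by (simp add: d_def q_def scaleR_cscale matrix_mult_diff cscale_mult_left)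
    have h_AE: "AE x in ?M. h x = hardy_proj X (\<lambda>x. d x ** F x) x"
      by (rule fmult_unique[OF 1[unfolded 2] P[OF mult[OF dL]]]) simp
    have eq: "(1 / (s - t)) *\<^sub>R (lax_L X (u s) F x - lax_L X (u t) F x) - - hardy_proj X (\<lambda>x. u' x ** F x) x = - h x" for x
      by (simp add: lax_L_def h_def r_def algebra_simps)
    have "(\<integral>\<^sup>+x. ennreal ((norm (- h x))\<^sup>2) \<partial>?M) = (\<integral>\<^sup>+x. ennreal ((norm (hardy_proj X (\<lambda>x. d x ** F x) x))\<^sup>2) \<partial>?M)"
      by (rule nn_integral_cong_AE) (use h_AE in eventually_elim, simp)
    also have "\<dots> = ennreal (\<integral>x. (norm (hardy_proj X (\<lambda>x. d x ** F x) x))\<^sup>2 \<partial>?M)"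
      by (rule L2_nn_integral[OF fmult_L2(2)[OF P[OF mult[OF dL]]]])
    also have "\<dots> \<le> ennreal (\<integral>x. (norm (d x ** F x))\<^sup>2 \<partial>?M)"
      by (rule ennreal_leI[OF hardy_proj_contraction[OF mult[OF dL]]])
    also have "\<dots> \<le> ennreal (\<integral>x. C\<^sup>2 * (norm (d x))\<^sup>2 \<partial>?M)"
    proof (intro ennreal_leI integral_mono_AE L2_integrable mult integrable_mult_right dL)
      show "AE x in ?M. (norm (d x ** F x))\<^sup>2 \<le> C\<^sup>2 * (norm (d x))\<^sup>2"
        using C by eventually_elim (rule norm_mult_sq_le(2))
    qed
    also have "\<dots> = ennreal (C\<^sup>2) * (\<integral>\<^sup>+x. ennreal ((norm (d x))\<^sup>2) \<partial>?M)"
      unfolding L2_nn_integral[OF dL] by (simp add: ennreal_mult)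
    finally show ?thesis unfolding eq d_def .
  qed
  have "((\<lambda>s. ennreal (C\<^sup>2) * (\<integral>\<^sup>+x. ennreal ((norm (q s x - u' x))\<^sup>2) \<partial>?M)) \<longlongrightarrow> ennreal (C\<^sup>2) * 0) (at t within I)"
    using u' unfolding L2_has_time_derivative_def L2_tendsto_def q_def r_def
    by (intro ennreal_tendsto_cmult) auto
  then have lim: "((\<lambda>s. ennreal (C\<^sup>2) * (\<integral>\<^sup>+x. ennreal ((norm (q s x - u' x))\<^sup>2) \<partial>?M)) \<longlongrightarrow> 0) (at t within I)"
    by simp
  have "((\<lambda>s. \<integral>\<^sup>+x. ennreal ((norm ((1 / (s - t)) *\<^sub>R (lax_L X (u s) F x - lax_L X (u t) F x)
       - - hardy_proj X (\<lambda>x. u' x ** F x) x))\<^sup>2) \<partial>?M) \<longlongrightarrow> 0) (at t within I)"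
  proof (rule tendsto_sandwich[OF _ _ tendsto_const lim])
    show "\<forall>\<^sub>F s in at t within I. (\<integral>\<^sup>+x. ennreal ((norm ((1 / (s - t)) *\<^sub>R (lax_L X (u s) F x - lax_L X (u t) F x)
       - - hardy_proj X (\<lambda>x. u' x ** F x) x))\<^sup>2) \<partial>?M) \<le> ennreal (C\<^sup>2) * (\<integral>\<^sup>+x. ennreal ((norm (q s x - u' x))\<^sup>2) \<partial>?M)"
      unfolding eventually_at_filter by (rule always_eventually) (use bound in blast)
  qed simp
  then show ?thesis
    using L2_uminus[OF PL] by (simp add: L2_has_time_derivative_def L2_tendsto_def)
qed

section \<open>The Lax pair\<close>

theorem theorem1:
  fixes X :: base and I :: "real set" and U :: "real \<Rightarrow> real \<Rightarrow> complex ^ 'd::finite ^ 'd"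
  assumes "is_interval I" and "\<exists>a\<in>I. \<exists>b\<in>I. a < b"
    and "sobolev_continuous_on X 2 I U"
    and "L2_C1_on X I U"
  shows "spin_BO_solution X I U \<longleftrightarrow> lax_equation X I U"
proof -
  have sob: "U t \<in> sobolev X 2" if "t \<in> I" for t
    using assms(3) that by (simp add: sobolev_continuous_on_def)
  have UL: "U t \<in> L2 (\<mu> X)" if "t \<in> I" for t
    using sob[OF that] by (simp add: sobolev_def)
  have nontrivial: "at t within I \<noteq> bot" if "t \<in> I" for t
  proof -
    have "I \<noteq> {t}" using assms(2) by auto
    then have "t islimpt I"
      using connected_imp_perfect[OF is_interval_connected[OF assms(1)] that] assms(2) by blast
    then show ?thesis by (simp add: trivial_limit_within)
  qed
  have LL: "lax_L X (U s) F \<in> L2 (\<mu> X)" if "s \<in> I" "F \<in> lax_dom X" for s F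
  proof -
    obtain F' where DF: "is_D X F F'" using \<open>F \<in> lax_dom X\<close> by (auto simp: lax_dom_iff)
    have "is_proj X (\<lambda>x. U s x ** F x) (toeplitz X (U s) F)"
      by (rule toeplitz_is_proj[OF is_D_mult_L2(2)[OF DF UL[OF \<open>s \<in> I\<close>]]])
    then show ?thesis
      unfolding lax_L_def by (intro L2_diff fmult_L2(2)[OF is_D_D_op[OF DF]] fmult_L2(2))
  qed
  have mult: "(\<lambda>x. V x ** F x) \<in> L2 (\<mu> X)" if "V \<in> L2 (\<mu> X)" "F \<in> lax_dom X" for V F
    using that is_D_mult_L2(2) by (auto simp: lax_dom_iff)
  show ?thesis
  proof
    assume BO: "spin_BO_solution X I U"
    show "lax_equation X I U"
      unfolding lax_equation_def
    proof (intro ballI conjI)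
      fix t and F :: "'d field" assume t: "t \<in> I" and F: "F \<in> lax_dom X"
      obtain w where w: "has_dx X (\<lambda>x. abs_D X (U t) x - U t x ** U t x) w"
        "L2_has_time_derivative X I U (spin_BO_rhs (U t) (abs_D X (U t)) w) t"
        using BO t unfolding spin_BO_solution_def Let_def spin_BO_rhs_def by blast
      obtain w0 where w0: "has_dx X (\<lambda>x. abs_D X (U t) x - U t x ** U t x) w0"
        "spin_BO_rhs (U t) (abs_D X (U t)) w0 \<in> L2 (\<mu> X)"
        "\<forall>F \<in> lax_dom X. lax_B X (U t) F \<in> lax_dom X \<and>
           is_proj X (\<lambda>x. - (spin_BO_rhs (U t) (abs_D X (U t)) w0 x ** F x))
            (op_commutator (lax_B X (U t)) (lax_L X (U t)) F)"
        using lax_commutator[OF sob[OF t]] by (elim exE conjE) (rule that)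
      note w0F = conjunct1[OF bspec[OF w0(3) F]] conjunct2[OF bspec[OF w0(3) F]]
      show "lax_B X (U t) F \<in> lax_dom X" by (rule w0F(1))
      define R where "R = spin_BO_rhs (U t) (abs_D X (U t)) w"
      define R0 where "R0 = spin_BO_rhs (U t) (abs_D X (U t)) w0"
      have RL: "R \<in> L2 (\<mu> X)" using w(2) by (simp add: R_def L2_has_time_derivative_def)
      have "AE x in \<mu> X. w x = w0 x"
        using fmult_unique[OF w(1)[unfolded has_dx_iff_fmult] w0(1)[unfolded has_dx_iff_fmult]] by simp
      then have RR: "AE x in \<mu> X. - (R x ** F x) = - (R0 x ** F x)"
        by eventually_elim (simp add: R_def R0_def spin_BO_rhs_def)
      have "is_proj X (\<lambda>x. R x ** F x) (hardy_proj X (\<lambda>x. R x ** F x))"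
        by (rule hardy_proj_fmult[OF mult[OF RL F]])
      from fmult_cscale[OF this, of "-1"]
      have "is_proj X (\<lambda>x. - (R x ** F x)) (\<lambda>x. - hardy_proj X (\<lambda>x. R x ** F x) x)"
        by (simp add: cscale_minus_one)
      from fmult_unique[OF this w0F(2)[folded R0_def] RR]
      have eq: "AE x in \<mu> X. - hardy_proj X (\<lambda>x. R x ** F x) x = op_commutator (lax_B X (U t)) (lax_L X (U t)) F x" .
      show "L2_has_time_derivative X I (\<lambda>s. lax_L X (U s) F) (op_commutator (lax_B X (U t)) (lax_L X (U t)) F) t"
        by (rule L2_has_time_derivative_cong[OF lax_L_has_time_derivative[OF UL t w(2)[folded R_def] F]
              fmult_L2(2)[OF w0F(2)] eq])
    qed
  next
    assume lax: "lax_equation X I U"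
    show "spin_BO_solution X I U"
      unfolding spin_BO_solution_def Let_def
    proof (intro ballI)
      fix t assume t: "t \<in> I"
      obtain U' where U': "L2_has_time_derivative X I U U' t"
        using assms(4) t unfolding L2_C1_on_def by blast
      obtain w where w: "has_dx X (\<lambda>x. abs_D X (U t) x - U t x ** U t x) w"
        "spin_BO_rhs (U t) (abs_D X (U t)) w \<in> L2 (\<mu> X)"
        "\<forall>F \<in> lax_dom X. lax_B X (U t) F \<in> lax_dom X \<and>
           is_proj X (\<lambda>x. - (spin_BO_rhs (U t) (abs_D X (U t)) w x ** F x))
            (op_commutator (lax_B X (U t)) (lax_L X (U t)) F)"
        using lax_commutator[OF sob[OF t]] by (elim exE conjE) (rule that)
      define R where "R = spin_BO_rhs (U t) (abs_D X (U t)) w"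
      have RL: "R \<in> L2 (\<mu> X)" unfolding R_def by (rule w(2))
      have U'L: "U' \<in> L2 (\<mu> X)" using U' by (simp add: L2_has_time_derivative_def)
      have "AE x in \<mu> X. U' x - R x = 0"
      proof (rule toeplitz_zero_imp_zero[OF L2_diff[OF U'L RL]])
        fix F :: "'d field" assume F: "F \<in> lax_dom X"
        let ?C = "op_commutator (lax_B X (U t)) (lax_L X (U t)) F"
        have d: "L2_has_time_derivative X I (\<lambda>s. lax_L X (U s) F) ?C t"
          using lax t F by (simp add: lax_equation_def)
        have "AE x in \<mu> X. - hardy_proj X (\<lambda>x. U' x ** F x) x = ?C x"
          by (rule L2_has_time_derivative_unique[OF LL[OF _ F] t nontrivial[OF t] lax_L_has_time_derivative[OF UL t U' F] d])
        then have z: "AE x in \<mu> X. hardy_proj X (\<lambda>x. U' x ** F x) x - (-1) *\<^sub>c ?C x = 0"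
          by eventually_elim (metis cscale_minus_one add.right_inverse diff_minus_eq_add)
        have "is_proj X (\<lambda>x. U' x ** F x - (-1) *\<^sub>c (- (R x ** F x))) (\<lambda>x. hardy_proj X (\<lambda>x. U' x ** F x) x - (-1) *\<^sub>c ?C x)"
          by (intro fmult_diff fmult_cscale hardy_proj_fmult mult U'L F conjunct2[OF bspec[OF w(3) F], folded R_def])
        then have *: "is_proj X (\<lambda>x. (U' x - R x) ** F x) (\<lambda>x. hardy_proj X (\<lambda>x. U' x ** F x) x - (-1) *\<^sub>c ?C x)"
          by (simp add: cscale_minus_one matrix_mult_diff)
        show "is_proj X (\<lambda>x. (U' x - R x) ** F x) (\<lambda>x. 0)"
          by (rule fmult_cong[OF * L2_measurable[OF fmult_L2(1)[OF *]] _ _ z]) simp_all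
      qed
      then have "AE x in \<mu> X. U' x = R x" by eventually_elim simp
      from L2_has_time_derivative_cong[OF U' RL this] w(1)
      show "\<exists>w. has_dx X (\<lambda>x. abs_D X (U t) x - U t x ** U t x) w \<and>
          L2_has_time_derivative X I U
            (\<lambda>x. w x - \<i> *\<^sub>c (U t x ** abs_D X (U t) x - abs_D X (U t) x ** U t x)) t"
        unfolding R_def spin_BO_rhs_def by blast
    qed
  qed
qed

end
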